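(* Let $K$ be a field of characteristic $\neq 2$ and let $n\geq 1$ be an integer. Assume that $K$ has a PAC extension $M/K$ such that $M$ has a separable field extension of degree $n$. Then every non-degenerate quadratic form of dimension $n$ over $K$ is isomorphic (over $K$) to a scaled trace form over $K$.
   Context: A field extension $M/K$ is called a PAC extension if for any absolutely irreducible polynomial in two variables $f(X,Y)\in M[X,Y]$ that is separable in $Y$ (i.e. $\frac{\partial f}{\partial Y}\neq 0$) there are infinitely many $(x,y)\in K\times M$ such that $f(x,y)=0$. A scaled trace form over $K$ is a quadratic form of the shape $x\mapsto \mathrm{Tr}_{F/K}(\alpha x^2)$, $x\in F$, where $F/K$ is a finite separable field extension and $\alpha\in F$ is nonzero; it is a quadratic form over $K$ of dimension $[F:K]$. *)

theory Defs
  imports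
    "Jordan_Normal_Form.Matrix"
    "HOL-Algebra.Algebraic_Closure_Type"
    "HOL-Algebra.Subrings"
    "HOL-Computational_Algebra.Computational_Algebra"
begin

text \<open>
  A field is a type of class \<^class>\<open>field\<close>. An extension of \<open>'k\<close> is given by an embedding
  \<open>i :: 'k \<Rightarrow> 'e\<close> into an ambient field together with a subfield \<open>F\<close> of the ambient field that
  contains \<open>range i\<close>. Taking \<open>F = UNIV\<close> gives extensions that are whole types; taking \<open>i = to_ac\<close>
  gives the extensions inside the algebraic closure of \<open>'k\<close>, which include, up to
  \<open>'k\<close>-isomorphism, all finite extensions.
\<close>

definition field_extension :: "('k::field \<Rightarrow> 'e::field) \<Rightarrow> 'e set \<Rightarrow> bool" where
  "field_extension i F \<longleftrightarrow>
     field_hom i \<and> subfield F ring_of_type_algebra \<and> range i \<subseteq> F"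

definition ext_scale :: "('k::field \<Rightarrow> 'e::field) \<Rightarrow> 'k \<Rightarrow> 'e \<Rightarrow> 'e" where
  "ext_scale i c x = i c * x"

definition finite_extension :: "('k::field \<Rightarrow> 'e::field) \<Rightarrow> 'e set \<Rightarrow> bool" where
  "finite_extension i F \<longleftrightarrow>
     field_extension i F \<and> (\<exists>B. finite B \<and> module.span (ext_scale i) B = F)"

text \<open>Since \<open>dim\<close> is 0 on infinite-dimensional spaces, only positive values are meaningful.\<close>

definition extension_degree :: "('k::field \<Rightarrow> 'e::field) \<Rightarrow> 'e set \<Rightarrow> nat" where
  "extension_degree i F = vector_space.dim (ext_scale i) F"

definition separable_poly :: "'k::field poly \<Rightarrow> bool" where
  "separable_poly p \<longleftrightarrow> rsquarefree (map_poly to_ac p)"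

text \<open>
  An irreducible polynomial with root \<open>x\<close> is the minimal polynomial of \<open>x\<close> up to a constant
  factor, so the condition says that \<open>x\<close> is algebraic with separable minimal polynomial.
\<close>

definition separable_extension :: "('k::field \<Rightarrow> 'e::field) \<Rightarrow> 'e set \<Rightarrow> bool" where
  "separable_extension i F \<longleftrightarrow>
     field_extension i F \<and>
     (\<forall>x\<in>F. \<exists>p :: 'k poly. Factorial_Ring.irreducible p \<and> separable_poly p \<and>
        poly (map_poly i p) x = 0)"

text \<open>
  The trace of the \<open>'k\<close>-linear map \<open>y \<mapsto> x * y\<close> on \<open>F\<close>: the sum of the diagonal coefficients with
  respect to a basis, where the choice of the basis is immaterial.
\<close>

definition field_trace :: "('k::field \<Rightarrow> 'e::field) \<Rightarrow> 'e set \<Rightarrow> 'e \<Rightarrow> 'k" where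
  "field_trace i F x =
     (let B = (SOME B. \<not> module.dependent (ext_scale i) B \<and> module.span (ext_scale i) B = F)
      in \<Sum>b\<in>B. module.representation (ext_scale i) B (x * b) b)"

definition scaled_trace_form :: "('k::field \<Rightarrow> 'e::field) \<Rightarrow> 'e set \<Rightarrow> 'e \<Rightarrow> 'e \<Rightarrow> 'k" where
  "scaled_trace_form i F \<alpha> x = field_trace i F (\<alpha> * x ^ 2)"

text \<open>
  A bivariate polynomial \<open>f(X,Y)\<close> is a polynomial in \<open>Y\<close> whose coefficients are polynomials
  in \<open>X\<close>; hence \<open>pderiv f\<close> is the partial derivative with respect to \<open>Y\<close>.
\<close>

definition eval2 :: "'m::field poly poly \<Rightarrow> 'm \<Rightarrow> 'm \<Rightarrow> 'm" where
  "eval2 f x y = poly (poly f [:y:]) x"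

definition absolutely_irreducible :: "'m::field poly poly \<Rightarrow> bool" where
  "absolutely_irreducible f \<longleftrightarrow> Factorial_Ring.irreducible (map_poly (map_poly to_ac) f)"

definition PAC_extension :: "('k::field \<Rightarrow> 'm::field) \<Rightarrow> bool" where
  "PAC_extension i \<longleftrightarrow>
     field_hom i \<and>
     (\<forall>f :: 'm poly poly. absolutely_irreducible f \<and> pderiv f \<noteq> 0 \<longrightarrow>
        infinite {(x :: 'k, y :: 'm). eval2 f (i x) y = 0})"

definition polar_form :: "('v::ab_group_add \<Rightarrow> 'k::field) \<Rightarrow> 'v \<Rightarrow> 'v \<Rightarrow> 'k" where
  "polar_form q x y = q (x + y) - q x - q y"

text \<open>Linearity of the polar form in one argument suffices, because it is symmetric.\<close>

definition quadratic_form ::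
  "('k::field \<Rightarrow> 'v::ab_group_add \<Rightarrow> 'v) \<Rightarrow> ('v \<Rightarrow> 'k) \<Rightarrow> bool" where
  "quadratic_form s q \<longleftrightarrow>
     vector_space s \<and>
     (\<forall>c x. q (s c x) = c ^ 2 * q x) \<and>
     (\<forall>x. Vector_Spaces.linear s (*) (polar_form q x))"

definition nondegenerate :: "('v::ab_group_add \<Rightarrow> 'k::field) \<Rightarrow> bool" where
  "nondegenerate q \<longleftrightarrow> (\<forall>x. (\<forall>y. polar_form q x y = 0) \<longrightarrow> x = 0)"

definition isomorphic_forms ::
  "('k::field \<Rightarrow> 'v::ab_group_add \<Rightarrow> 'v) \<Rightarrow> ('v \<Rightarrow> 'k) \<Rightarrow>
   ('k \<Rightarrow> 'w::ab_group_add \<Rightarrow> 'w) \<Rightarrow> 'w set \<Rightarrow> ('w \<Rightarrow> 'k) \<Rightarrow> bool" where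
  "isomorphic_forms s q s' W q' \<longleftrightarrow>
     (\<exists>\<phi>. Vector_Spaces.linear s s' \<phi> \<and> bij_betw \<phi> UNIV W \<and> (\<forall>x. q' (\<phi> x) = q x))"

end

theory Submission
  imports Defs "Jordan_Normal_Form.Char_Poly"
begin

hide_const (open) Divisibility.irreducible Divisibility.prime
no_notation Matrix.vec_index (infixl "$" 100)

text \<open>
  Diagonalize the form as \<open>a\<^sub>1 x\<^sub>1\<^sup>2 + \<dots> + a\<^sub>n x\<^sub>n\<^sup>2\<close>. For distinct \<open>d\<^sub>i\<close> and nonzero \<open>v\<^sub>i\<close> in \<open>K\<close> put
  \<open>w\<^sub>i = a\<^sub>i v\<^sub>i\<^sup>2\<close> and \<open>f(Y) = \<Prod>\<^sub>i (Y - d\<^sub>i) - \<Sum>\<^sub>i w\<^sub>i \<Prod>\<^sub>j\<^sub>\<noteq>\<^sub>i (Y - d\<^sub>j)\<close>. If \<open>f\<close> is irreducible and separable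
  with root \<open>\<beta>\<close>, then by Lagrange interpolation the elements \<open>e\<^sub>i = w\<^sub>i / (v\<^sub>i (\<beta> - d\<^sub>i))\<close> form an
  orthogonal basis of \<open>K(\<beta>)\<close> for a form \<open>Tr(\<alpha> x y)\<close>, and \<open>Tr(\<alpha> e\<^sub>i\<^sup>2) = a\<^sub>i\<close>. It remains to choose the \<open>v\<^sub>i\<close>.

  Let first \<open>v\<^sub>i \<in> K[X]\<close> be such that there are \<open>n\<close> points at which \<open>k = 1, \<dots>, n\<close> of the roots \<open>r\<^sub>i\<close> of \<open>f\<close>
  come together like the roots of an Eisenstein polynomial of degree \<open>k\<close>; then the Galois group of
  \<open>f\<close> over \<open>\<Omega>(X)\<close>, where \<open>\<Omega>\<close> is the algebraic closure of \<open>M\<close>, is the full symmetric group. Let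
  \<open>\<theta>\<^sub>j\<close> be the conjugates of a generator of the given extension of \<open>M\<close> of degree \<open>n\<close>. The elements
  \<open>\<Sum>\<^sub>i \<theta>\<^sub>\<tau>\<^sub>(\<^sub>i\<^sub>) r\<^sub>i\<close>, with \<open>\<tau>\<close> ranging over the permutations, are the roots of a polynomial over \<open>M(X)\<close> that is
  irreducible over \<open>\<Omega>(X)\<close>. By the PAC property it has a root in \<open>M\<close> for infinitely many values
  \<open>x \<in> K\<close> of \<open>X\<close>. Then the Galois group of \<open>M\<close> permutes the roots of \<open>f(x, Y)\<close> as it permutes the
  \<open>\<theta>\<^sub>j\<close>, that is, transitively, so that \<open>f(x, Y)\<close> is irreducible over \<open>M\<close>, hence over \<open>K\<close>.
\<close>

section \<open>Subfields, algebraic elements and embeddings\<close>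

text \<open>The polynomial f(Y) is \<Prod>(Y - d_i) times 1 - \<Sum> w_i / (Y - d_i), and each w_i
  may run through the square class of a_i, so one form has a large family of candidates. The
  obstacle is to find an irreducible member although the PAC property only ever provides roots in M,
  which by itself favours splitting. The twist reverses this: a root in M of the twisted resolvent
  forces the Galois action on the roots of f(x, Y) to copy the one on the \<theta>_j. Since PAC asks
  for absolute irreducibility, the group over the algebraically closed constants has to be large.
  Ramification may be wild, so cycle types are avoided and only transitivity on the roots that meet
  is used: k = n, n - 1 and 2 give transitivity, double transitivity and a transposition. The
  degenerations prescribe the squares of the v_i, so their values are square roots over K;
  characteristic not 2 makes these separable, and the points where they are taken are allowed to lie
  outside K while the coefficients of v_i stay in K. A nonzero sum of the roots keeps the n! twisted
  sums distinct.\<close>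

definition subfld :: "'e::field set \<Rightarrow> bool" where
  "subfld F \<longleftrightarrow> 1 \<in> F \<and> (\<forall>x\<in>F. \<forall>y\<in>F. x - y \<in> F \<and> x * y \<in> F) \<and> (\<forall>x\<in>F. inverse x \<in> F)"

lemma subfldI:
  assumes "1 \<in> F" "\<And>x y. x \<in> F \<Longrightarrow> y \<in> F \<Longrightarrow> x - y \<in> F" "\<And>x y. x \<in> F \<Longrightarrow> y \<in> F \<Longrightarrow> x * y \<in> F"
    "\<And>x. x \<in> F \<Longrightarrow> x \<noteq> 0 \<Longrightarrow> inverse x \<in> F"
  shows "subfld F"
  using assms unfolding subfld_def by (metis inverse_zero)

lemma
  assumes F: "subfld F"
  shows subfld_1: "1 \<in> F" and subfld_0: "0 \<in> F"
    and subfld_diff: "x \<in> F \<Longrightarrow> y \<in> F \<Longrightarrow> x - y \<in> F"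
    and subfld_uminus: "x \<in> F \<Longrightarrow> - x \<in> F"
    and subfld_add: "x \<in> F \<Longrightarrow> y \<in> F \<Longrightarrow> x + y \<in> F"
    and subfld_mult: "x \<in> F \<Longrightarrow> y \<in> F \<Longrightarrow> x * y \<in> F"
    and subfld_inverse: "x \<in> F \<Longrightarrow> inverse x \<in> F"
    and subfld_divide: "x \<in> F \<Longrightarrow> y \<in> F \<Longrightarrow> x / y \<in> F"
    and subfld_power: "x \<in> F \<Longrightarrow> x ^ k \<in> F"
    and subfld_sum: "(\<And>i. i \<in> I \<Longrightarrow> f i \<in> F) \<Longrightarrow> sum f I \<in> F"
    and subfld_prod: "(\<And>i. i \<in> I \<Longrightarrow> f i \<in> F) \<Longrightarrow> prod f I \<in> F"
proof -
  show one: "1 \<in> F" using F by (auto simp: subfld_def)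
  show d: "x - y \<in> F" if "x \<in> F" "y \<in> F" for x y using F that by (auto simp: subfld_def)
  show m: "x * y \<in> F" if "x \<in> F" "y \<in> F" for x y using F that by (auto simp: subfld_def)
  show i: "inverse x \<in> F" if "x \<in> F" for x using F that by (auto simp: subfld_def)
  show z: "0 \<in> F" using d[OF one one] by simp
  show u: "- x \<in> F" if "x \<in> F" for x using d[OF z that] by simp
  show a: "x + y \<in> F" if "x \<in> F" "y \<in> F" for x y using d[OF that(1) u[OF that(2)]] by simp
  show "x / y \<in> F" if "x \<in> F" "y \<in> F" for x y using m[OF that(1) i[OF that(2)]]
    by (simp add: field_class.field_divide_inverse)
  show "x ^ k \<in> F" if "x \<in> F" for x k using that one m by (induction k) auto
  show "sum f I \<in> F" if "\<And>i. i \<in> I \<Longrightarrow> f i \<in> F" for I and f :: "'c \<Rightarrow> 'a"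
    using that z a by (induction I rule: infinite_finite_induct) auto
  show "prod f I \<in> F" if "\<And>i. i \<in> I \<Longrightarrow> f i \<in> F" for I and f :: "'d \<Rightarrow> 'a"
    using that one m by (induction I rule: infinite_finite_induct) auto
qed

text \<open>Intermediate fields are subsets of one type, so polynomials over them are polynomials
  over the ambient type with restricted coefficients; division with remainder and principal ideals
  have to be treated relative to \<open>F\<close>.\<close>

definition polys :: "'e::field set \<Rightarrow> 'e poly set" where
  "polys F = {p. \<forall>i. coeff p i \<in> F}"

lemma polysI: "(\<And>i. coeff p i \<in> F) \<Longrightarrow> p \<in> polys F"
  by (simp add: polys_def)

lemma polysD: "p \<in> polys F \<Longrightarrow> coeff p i \<in> F"
  by (simp add: polys_def)

lemma polys_mono: "F \<subseteq> G \<Longrightarrow> polys F \<subseteq> polys G"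
  by (auto simp: polys_def)

lemma
  assumes F: "subfld F"
  shows polys_0: "0 \<in> polys F" and polys_1: "1 \<in> polys F"
    and polys_diff: "p \<in> polys F \<Longrightarrow> q \<in> polys F \<Longrightarrow> p - q \<in> polys F"
    and polys_add: "p \<in> polys F \<Longrightarrow> q \<in> polys F \<Longrightarrow> p + q \<in> polys F"
    and polys_mult: "p \<in> polys F \<Longrightarrow> q \<in> polys F \<Longrightarrow> p * q \<in> polys F"
    and polys_const: "c \<in> F \<Longrightarrow> [:c:] \<in> polys F"
    and polys_monom: "c \<in> F \<Longrightarrow> monom c k \<in> polys F"
    and polys_smult: "c \<in> F \<Longrightarrow> p \<in> polys F \<Longrightarrow> smult c p \<in> polys F"
    and polys_uminus: "p \<in> polys F \<Longrightarrow> - p \<in> polys F"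
    and polys_pCons: "c \<in> F \<Longrightarrow> p \<in> polys F \<Longrightarrow> pCons c p \<in> polys F"
    and poly_in_subfld: "p \<in> polys F \<Longrightarrow> x \<in> F \<Longrightarrow> poly p x \<in> F"
    and polys_sum: "(\<And>i. i \<in> I \<Longrightarrow> f i \<in> polys F) \<Longrightarrow> sum f I \<in> polys F"
    and polys_prod: "(\<And>i. i \<in> I \<Longrightarrow> f i \<in> polys F) \<Longrightarrow> prod f I \<in> polys F"
    and polys_power: "p \<in> polys F \<Longrightarrow> p ^ k \<in> polys F"
    and polys_pcompose: "p \<in> polys F \<Longrightarrow> q \<in> polys F \<Longrightarrow> pcompose p q \<in> polys F"
    and polys_pderiv: "p \<in> polys F \<Longrightarrow> pderiv p \<in> polys F"
proof -
  note [simp] = subfld_0[OF F] subfld_1[OF F]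
  show z: "0 \<in> polys F" by (auto simp: polys_def)
  show one: "1 \<in> polys F" by (auto simp: polys_def coeff_1 )
  show "p - q \<in> polys F" if "p \<in> polys F" "q \<in> polys F" for p q
    using that by (auto simp: polys_def intro: subfld_diff[OF F])
  show a: "p + q \<in> polys F" if "p \<in> polys F" "q \<in> polys F" for p q
    using that by (auto simp: polys_def intro: subfld_add[OF F])
  show m: "p * q \<in> polys F" if "p \<in> polys F" "q \<in> polys F" for p q
    using that by (auto simp: polys_def coeff_mult intro!: subfld_sum[OF F] subfld_mult[OF F])
  show c: "[:c:] \<in> polys F" if "c \<in> F" for c
    using that by (auto simp: polys_def coeff_pCons split: nat.split)
  show "monom c k \<in> polys F" if "c \<in> F" for c k
    using that by (auto simp: polys_def)
  show "smult c p \<in> polys F" if "c \<in> F" "p \<in> polys F" for c p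
    using that by (auto simp: polys_def intro!: subfld_mult[OF F])
  show "- p \<in> polys F" if "p \<in> polys F" for p
    using that by (auto simp: polys_def intro!: subfld_uminus[OF F])
  show pc: "pCons c p \<in> polys F" if "c \<in> F" "p \<in> polys F" for c p
    using that by (auto simp: polys_def coeff_pCons split: nat.split)
  show "poly p x \<in> F" if "p \<in> polys F" "x \<in> F" for p x
    unfolding poly_altdef using that by (auto intro!: subfld_sum[OF F] subfld_mult[OF F] subfld_power[OF F] polysD)
  show "sum f I \<in> polys F" if "\<And>i. i \<in> I \<Longrightarrow> f i \<in> polys F" for I and f :: "'d \<Rightarrow> 'a poly"
    using that z a by (induction I rule: infinite_finite_induct) auto
  show "prod f I \<in> polys F" if "\<And>i. i \<in> I \<Longrightarrow> f i \<in> polys F" for I and f :: "'b \<Rightarrow> 'a poly"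
    using that one m by (induction I rule: infinite_finite_induct) auto
  show "p ^ k \<in> polys F" if "p \<in> polys F" for p k using that one m by (induction k) auto
  show "pcompose p q \<in> polys F" if "p \<in> polys F" "q \<in> polys F" for p q
    using that(1)
  proof (induction p)
    case (pCons c p)
    have "c \<in> F" using polysD[OF pCons.prems, of 0] by simp
    moreover have "p \<in> polys F" using polysD[OF pCons.prems, of "Suc _"] by (auto intro: polysI)
    ultimately show ?case using pCons.IH that(2) by (auto simp: pcompose_pCons intro: a m c)
  qed (use z in auto)
  show "pderiv p \<in> polys F" if "p \<in> polys F" for p
  proof (rule polysI)
    fix i
    have "of_nat k \<in> F" for k by (induction k) (auto intro: subfld_add[OF F])
    from subfld_mult[OF F this polysD[OF that]] show "coeff (pderiv p) i \<in> F"
      unfolding coeff_pderiv by blast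
  qed
qed

lemma polys_divmod:
  assumes F: "subfld F" and p: "p \<in> polys F" and q: "q \<in> polys F" "q \<noteq> 0"
  obtains s r where "s \<in> polys F" "r \<in> polys F" "p = q * s + r" "r = 0 \<or> degree r < degree q"
proof -
  have "\<exists>s\<in>polys F. \<exists>r\<in>polys F. p = q * s + r \<and> (r = 0 \<or> degree r < degree q)"
    using p
  proof (induction "degree p" arbitrary: p rule: less_induct)
    case (less p)
    show ?case
    proof (cases "degree p < degree q \<or> p = 0")
      case True
      then show ?thesis using less.prems polys_0[OF F] by (intro bexI[of _ 0] bexI[of _ p]) auto
    next
      case False
      define t where "t = monom (lead_coeff p / lead_coeff q) (degree p - degree q)"
      have t: "t \<in> polys F" unfolding t_def
        using less.prems q by (intro polys_monom[OF F] subfld_divide[OF F] polysD)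
      define p' where "p' = p - q * t"
      have p': "p' \<in> polys F" unfolding p'_def using less.prems q t by (intro polys_diff[OF F] polys_mult[OF F])
      have dt: "degree (q * t) = degree p"
        using False q by (subst degree_mult_eq) (auto simp: t_def degree_monom_eq)
      have lt: "coeff (q * t) (degree p) = coeff p (degree p)"
        using False q dt lead_coeff_mult[of q t] by (simp add: t_def degree_monom_eq)
      show ?thesis
      proof (cases "p' = 0")
        case True
        then show ?thesis using t polys_0[OF F] by (intro bexI[of _ t] bexI[of _ 0]) (auto simp: p'_def)
      next
        case nz: False
        have "degree p' < degree p"
        proof -
          have "degree p' \<le> degree p" unfolding p'_def using dt by (intro degree_diff_le) auto
          moreover have "coeff p' (degree p) = 0" using lt by (simp add: p'_def)
          ultimately show ?thesis using nz by (metis leading_coeff_0_iff le_neq_implies_less)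
        qed
        from less.hyps[OF this p'] obtain s r where sr: "s \<in> polys F" "r \<in> polys F"
          "p' = q * s + r" "r = 0 \<or> degree r < degree q" by blast
        then show ?thesis using t
          by (intro bexI[of _ "s + t"] bexI[of _ r]) (auto simp: p'_def algebra_simps intro: polys_add[OF F])
      qed
    qed
  qed
  thus thesis using that by blast
qed

text \<open>A member of least degree leaves no remainder in any other. Ideals enter only through
  closure properties, so that the lemma serves both for the polynomials vanishing at an element and
  for the ideal spanned by two polynomials, where it yields Bezout identities.\<close>

lemma polys_principal:
  assumes F: "subfld F" and I: "I \<subseteq> polys F" "\<And>p q. p \<in> I \<Longrightarrow> q \<in> I \<Longrightarrow> p - q \<in> I"
    "\<And>p q. p \<in> I \<Longrightarrow> q \<in> polys F \<Longrightarrow> p * q \<in> I" and p0: "p0 \<in> I" "p0 \<noteq> 0"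
  obtains d where "d \<in> I" "lead_coeff d = 1" "\<And>h. h \<in> I \<Longrightarrow> \<exists>s\<in>polys F. h = d * s"
proof -
  define P where "P = (\<lambda>k. \<exists>d\<in>I. d \<noteq> 0 \<and> degree d = k)"
  have "P (degree p0)" using p0 by (auto simp: P_def)
  hence "P (LEAST k. P k)" by (rule LeastI)
  then obtain d where d: "d \<in> I" "d \<noteq> 0" "degree d = (LEAST k. P k)" by (auto simp: P_def)
  have dF: "d \<in> polys F" using d I by auto
  have div: "\<exists>s\<in>polys F. h = d * s" if h: "h \<in> I" for h
  proof -
    obtain s r where sr: "s \<in> polys F" "r \<in> polys F" "h = d * s + r" "r = 0 \<or> degree r < degree d"
      using polys_divmod[OF F _ dF d(2)] h I(1) by blast
    have "r \<in> I" using I(2)[OF h I(3)[OF d(1) sr(1)]] sr(3) by simp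
    hence "r = 0" using sr(4) d(3) not_less_Least[of "degree r" P] by (auto simp: P_def)
    thus ?thesis using sr by auto
  qed
  define c where "c = lead_coeff d"
  have c: "c \<in> F" "c \<noteq> 0" using polysD[OF dF, of "degree d"] d(2) by (simp_all add: c_def)
  show thesis
  proof
    show "d * [:inverse c:] \<in> I" by (intro I(3) d polys_const[OF F] subfld_inverse[OF F] c)
    show "lead_coeff (d * [:inverse c:]) = 1" using c by (simp add: c_def)
    show "\<exists>s\<in>polys F. h = d * [:inverse c:] * s" if h: "h \<in> I" for h
    proof -
      obtain s where "s \<in> polys F" "h = d * s" using div[OF h] by blast
      thus ?thesis using c by (intro bexI[of _ "smult c s"]) (auto intro!: polys_smult[OF F])
    qed
  qed
qed

section \<open>Algebraic elements and simple extensions\<close>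

definition alg_over :: "'e::field set \<Rightarrow> 'e \<Rightarrow> bool" where
  "alg_over F x \<longleftrightarrow> (\<exists>p\<in>polys F. p \<noteq> 0 \<and> poly p x = 0)"

lemma alg_over_mono: "F \<subseteq> G \<Longrightarrow> alg_over F x \<Longrightarrow> alg_over G x"
  using polys_mono[of F G] by (auto simp: alg_over_def)

lemma alg_over_base: "subfld F \<Longrightarrow> x \<in> F \<Longrightarrow> alg_over F x"
  unfolding alg_over_def
  by (rule bexI[of _ "[:-x,1:]"]) (auto intro!: polys_pCons polys_0 subfld_1 subfld_uminus)

lemma minimal_polynomial:
  assumes F: "subfld F" and x: "alg_over F x"
  obtains m where "m \<in> polys F" "lead_coeff m = 1" "poly m x = 0" "degree m > 0"
    "\<And>h. h \<in> polys F \<Longrightarrow> poly h x = 0 \<Longrightarrow> \<exists>s\<in>polys F. h = m * s"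
proof -
  obtain p0 where "p0 \<in> polys F" "p0 \<noteq> 0" "poly p0 x = 0" using x by (auto simp: alg_over_def)
  then obtain d where d: "d \<in> {p \<in> polys F. poly p x = 0}" "lead_coeff d = 1"
    "\<And>h. h \<in> {p \<in> polys F. poly p x = 0} \<Longrightarrow> \<exists>s\<in>polys F. h = d * s"
    by (rule_tac polys_principal[OF F, of "{p \<in> polys F. poly p x = 0}" p0])
      (auto intro: polys_diff[OF F] polys_mult[OF F])
  have "degree d > 0"
  proof (rule ccontr)
    assume "\<not> degree d > 0"
    hence "d = [:1:]" using d(2) by (metis degree_0_id gr0I)
    with d(1) show False by auto
  qed
  with d show thesis by (intro that[of d]) auto
qed

text \<open>This is the ring \<open>F[x]\<close>; it coincides with the field \<open>F(x)\<close>
  when \<open>x\<close> is algebraic, by \<open>adj_inverse\<close>.\<close>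

definition adj :: "'e::field set \<Rightarrow> 'e \<Rightarrow> 'e set" where
  "adj F x = (\<lambda>p. poly p x) ` polys F"

lemma adj_base: "subfld F \<Longrightarrow> F \<subseteq> adj F x"
proof
  fix c assume "subfld F" "c \<in> F"
  thus "c \<in> adj F x" unfolding adj_def
    by (intro image_eqI[of _ _ "[:c:]"]) (auto intro: polys_const)
qed

lemma adj_gen: "subfld F \<Longrightarrow> x \<in> adj F x"
  unfolding adj_def by (intro image_eqI[of _ _ "[:0,1:]"])
    (auto intro!: polys_pCons polys_0 subfld_0 subfld_1)

text \<open>A generator \<open>d\<close> of the ideal spanned by \<open>p\<close> and the minimal
  polynomial \<open>m\<close> does not vanish at \<open>x\<close>, since it divides
  \<open>p\<close>. So its cofactor \<open>s\<close> in \<open>m\<close> vanishes there and is a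
  multiple of \<open>m\<close>; hence \<open>d\<close> is a unit, and the Bezout identity evaluated
  at \<open>x\<close> gives the inverse.\<close>

lemma adj_inverse:
  assumes F: "subfld F" and x: "alg_over F x" and p: "p \<in> polys F" "poly p x \<noteq> 0"
  obtains q where "q \<in> polys F" "poly (p * q - 1) x = 0"
proof -
  obtain m where m: "m \<in> polys F" "lead_coeff m = 1" "poly m x = 0" "degree m > 0"
    "\<And>h. h \<in> polys F \<Longrightarrow> poly h x = 0 \<Longrightarrow> \<exists>s\<in>polys F. h = m * s"
    using minimal_polynomial[OF F x] by blast
  define I where "I = {a * m + b * p | a b. a \<in> polys F \<and> b \<in> polys F}"
  have I: "a * m + b * p \<in> I" if "a \<in> polys F" "b \<in> polys F" for a b
    using that by (auto simp: I_def)
  have pI: "p \<in> I" and mI: "m \<in> I" using I[of 0 1] I[of 1 0] polys_0[OF F] polys_1[OF F] by auto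
  obtain d where d: "d \<in> I" "lead_coeff d = 1" "\<And>h. h \<in> I \<Longrightarrow> \<exists>s\<in>polys F. h = d * s"
  proof (rule polys_principal[OF F, of I p])
    show "I \<subseteq> polys F" using m p by (auto simp: I_def intro!: polys_add[OF F] polys_mult[OF F])
    show "u - v \<in> I" if uv: "u \<in> I" "v \<in> I" for u v
    proof -
      obtain a b where u: "u = a * m + b * p" "a \<in> polys F" "b \<in> polys F"
        using uv(1) by (auto simp: I_def)
      obtain a' b' where v: "v = a' * m + b' * p" "a' \<in> polys F" "b' \<in> polys F"
        using uv(2) by (auto simp: I_def)
      have "(a - a') * m + (b - b') * p \<in> I" using u v by (intro I polys_diff[OF F])
      thus ?thesis using u v by (simp add: algebra_simps)
    qed
    show "u * v \<in> I" if uv: "u \<in> I" "v \<in> polys F" for u v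
    proof -
      obtain a b where u: "u = a * m + b * p" "a \<in> polys F" "b \<in> polys F"
        using uv(1) by (auto simp: I_def)
      have "(a * v) * m + (b * v) * p \<in> I" using u uv by (intro I polys_mult[OF F])
      thus ?thesis using u by (simp add: algebra_simps)
    qed
  qed (use pI p in auto)
  obtain s where s: "s \<in> polys F" "m = d * s" using d(3)[OF mI] by blast
  obtain t where t: "t \<in> polys F" "p = d * t" using d(3)[OF pI] by blast
  have "poly d x \<noteq> 0" using t p by auto
  hence "poly s x = 0" using s m by auto
  then obtain s' where s': "s = m * s'" using m(5)[OF s(1)] by blast
  have m0: "m \<noteq> 0" using m by auto
  have "m = d * (m * s')" unfolding s'[symmetric] by (rule s(2))
  also have "\<dots> = m * (d * s')" by (rule mult.left_commute)
  finally have "m = m * (d * s')" .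
  hence ds: "d * s' = 1" using m0 by (metis mult_cancel_left2)
  have "degree d = 0"
  proof -
    have "d \<noteq> 0" "s' \<noteq> 0" using ds by auto
    hence "degree d + degree s' = 0" using arg_cong[OF ds, of degree] by (simp add: degree_mult_eq)
    thus ?thesis by simp
  qed
  hence d1: "d = 1" using d(2) by (metis degree_0_id one_pCons)
  then obtain a b where ab: "1 = a * m + b * p" "a \<in> polys F" "b \<in> polys F"
    using d(1) by (auto simp: I_def)
  have "p * b - 1 = - a * m" using ab(1) by (simp add: algebra_simps)
  hence "poly (p * b - 1) x = 0" using m by simp
  with ab that show thesis by blast
qed

lemma subfld_adj:
  assumes F: "subfld F" and x: "alg_over F x"
  shows "subfld (adj F x)"
proof (rule subfldI)
  show "1 \<in> adj F x" using adj_base[OF F] subfld_1[OF F] by auto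
  show "u - v \<in> adj F x" if "u \<in> adj F x" "v \<in> adj F x" for u v
    using that unfolding adj_def by (auto simp flip: poly_diff intro!: imageI polys_diff[OF F])
  show "u * v \<in> adj F x" if "u \<in> adj F x" "v \<in> adj F x" for u v
    using that unfolding adj_def by (auto simp flip: poly_mult intro!: imageI polys_mult[OF F])
  show "inverse u \<in> adj F x" if u: "u \<in> adj F x" "u \<noteq> 0" for u
  proof -
    obtain p where p: "p \<in> polys F" "u = poly p x" using u by (auto simp: adj_def)
    then obtain q where q: "q \<in> polys F" "poly (p * q - 1) x = 0"
      using adj_inverse[OF F x, of p] u by auto
    hence "u * poly q x = 1" using p by simp
    hence "inverse u = poly q x" by (rule inverse_unique)
    thus ?thesis using q by (auto simp: adj_def)
  qed
qed

lemma adj_least: "subfld G \<Longrightarrow> F \<subseteq> G \<Longrightarrow> x \<in> G \<Longrightarrow> adj F x \<subseteq> G"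
  using poly_in_subfld[of G _ x] polys_mono[of F G] by (auto simp: adj_def)

text \<open>An embedding of a subfield \<open>A\<close>, carried by a total function whose values
  outside \<open>A\<close> are irrelevant. Differences and products suffice; sums, inverses and
  injectivity follow.\<close>

definition hom_on :: "'e::field set \<Rightarrow> ('e \<Rightarrow> 'f::field) \<Rightarrow> bool" where
  "hom_on A \<phi> \<longleftrightarrow> \<phi> 1 = 1 \<and> (\<forall>x\<in>A. \<forall>y\<in>A. \<phi> (x - y) = \<phi> x - \<phi> y \<and> \<phi> (x * y) = \<phi> x * \<phi> y)"

lemma
  assumes A: "subfld A" and h: "hom_on A \<phi>"
  shows hom_on_1: "\<phi> 1 = 1" and hom_on_0: "\<phi> 0 = 0"
    and hom_on_diff: "x \<in> A \<Longrightarrow> y \<in> A \<Longrightarrow> \<phi> (x - y) = \<phi> x - \<phi> y"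
    and hom_on_mult: "x \<in> A \<Longrightarrow> y \<in> A \<Longrightarrow> \<phi> (x * y) = \<phi> x * \<phi> y"
    and hom_on_add: "x \<in> A \<Longrightarrow> y \<in> A \<Longrightarrow> \<phi> (x + y) = \<phi> x + \<phi> y"
    and hom_on_sum: "(\<And>i. i \<in> I \<Longrightarrow> f i \<in> A) \<Longrightarrow> \<phi> (sum f I) = (\<Sum>i\<in>I. \<phi> (f i))"
    and hom_on_eq_0: "x \<in> A \<Longrightarrow> \<phi> x = 0 \<longleftrightarrow> x = 0"
    and hom_on_inverse: "x \<in> A \<Longrightarrow> \<phi> (inverse x) = inverse (\<phi> x)"
proof -
  show one: "\<phi> 1 = 1" using h by (auto simp: hom_on_def)
  show d: "\<phi> (x - y) = \<phi> x - \<phi> y" if "x \<in> A" "y \<in> A" for x y using h that by (auto simp: hom_on_def)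
  show m: "\<phi> (x * y) = \<phi> x * \<phi> y" if "x \<in> A" "y \<in> A" for x y using h that by (auto simp: hom_on_def)
  show z: "\<phi> 0 = 0" using d[OF subfld_1[OF A] subfld_1[OF A]] by simp
  show a: "\<phi> (x + y) = \<phi> x + \<phi> y" if "x \<in> A" "y \<in> A" for x y
    using d[of x "0 - y"] d[of 0 y] that subfld_0[OF A] subfld_uminus[OF A] z by simp
  show "\<phi> (sum f I) = (\<Sum>i\<in>I. \<phi> (f i))" if "\<And>i. i \<in> I \<Longrightarrow> f i \<in> A"
    using that by (induction I rule: infinite_finite_induct) (auto simp: z a subfld_sum[OF A])
  show e: "\<phi> x = 0 \<longleftrightarrow> x = 0" if "x \<in> A" for x
  proof
    assume "\<phi> x = 0"
    show "x = 0"
    proof (rule ccontr)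
      assume "x \<noteq> 0"
      with m[OF that subfld_inverse[OF A that]] one \<open>\<phi> x = 0\<close> show False by simp
    qed
  qed (use z in auto)
  show "\<phi> (inverse x) = inverse (\<phi> x)" if "x \<in> A" for x
  proof (cases "x = 0")
    case False
    hence "\<phi> x * \<phi> (inverse x) = 1" using m[OF that subfld_inverse[OF A that]] one by simp
    thus ?thesis by (metis inverse_unique)
  qed (use z in auto)
qed

lemma
  assumes A: "subfld A" and h: "hom_on A \<phi>"
  shows map_poly_hom_on_diff: "p \<in> polys A \<Longrightarrow> q \<in> polys A \<Longrightarrow> map_poly \<phi> (p - q) = map_poly \<phi> p - map_poly \<phi> q"
    and map_poly_hom_on_mult: "p \<in> polys A \<Longrightarrow> q \<in> polys A \<Longrightarrow> map_poly \<phi> (p * q) = map_poly \<phi> p * map_poly \<phi> q"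
    and map_poly_hom_on_1: "map_poly \<phi> 1 = 1"
    and degree_map_poly_hom_on: "p \<in> polys A \<Longrightarrow> degree (map_poly \<phi> p) = degree p"
proof -
  note z = hom_on_0[OF A h]
  show "map_poly \<phi> (p - q) = map_poly \<phi> p - map_poly \<phi> q" if "p \<in> polys A" "q \<in> polys A"
    by (rule poly_eqI) (use that in \<open>auto simp: coeff_map_poly z hom_on_diff[OF A h] polysD\<close>)
  show "map_poly \<phi> (p * q) = map_poly \<phi> p * map_poly \<phi> q" if "p \<in> polys A" "q \<in> polys A"
    by (rule poly_eqI) (use that in \<open>auto simp: coeff_map_poly z coeff_mult hom_on_mult[OF A h]
        polysD hom_on_sum[OF A h] subfld_mult[OF A] cong: sum.cong_simp\<close>)
  show "map_poly \<phi> 1 = 1" by (rule poly_eqI) (auto simp: coeff_map_poly z coeff_1 hom_on_1[OF A h])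
  show "degree (map_poly \<phi> p) = degree p" if "p \<in> polys A"
    by (rule degree_map_poly) (use hom_on_eq_0[OF A h polysD[OF that]] in auto)
qed

lemma map_poly_pCons_0: "f 0 = 0 \<Longrightarrow> map_poly f (pCons a p) = pCons (f a) (map_poly f p)"
  by (rule poly_eqI) (auto simp: coeff_map_poly coeff_pCons split: nat.split)

text \<open>The only possible value at \<open>poly p x\<close> is
  \<open>poly (map_poly \<phi> p) y\<close>. It is well defined because two polynomials with equal
  value at \<open>x\<close> differ by one vanishing at \<open>x\<close>, which by the last
  assumption vanishes at \<open>y\<close> once \<open>\<phi>\<close> is applied.\<close>

lemma hom_extend_adj:
  assumes A: "subfld A" and h: "hom_on A \<phi>" and x: "alg_over A x"
    and y: "\<And>p. p \<in> polys A \<Longrightarrow> poly p x = 0 \<Longrightarrow> poly (map_poly \<phi> p) y = 0"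
  obtains \<psi> where "hom_on (adj A x) \<psi>" "\<And>a. a \<in> A \<Longrightarrow> \<psi> a = \<phi> a" "\<psi> x = y"
proof -
  define \<psi> where "\<psi> u = poly (map_poly \<phi> (SOME p. p \<in> polys A \<and> poly p x = u)) y" for u
  have eq: "\<psi> (poly p x) = poly (map_poly \<phi> p) y" if p: "p \<in> polys A" for p
  proof -
    define q where "q = (SOME q. q \<in> polys A \<and> poly q x = poly p x)"
    have "q \<in> polys A \<and> poly q x = poly p x" unfolding q_def
      by (rule someI[of _ p]) (use p in auto)
    hence q: "q \<in> polys A" "poly q x = poly p x" by auto
    have "poly (map_poly \<phi> (q - p)) y = 0" using q p by (intro y polys_diff[OF A]) auto
    thus ?thesis using map_poly_hom_on_diff[OF A h q(1) p] by (simp add: \<psi>_def q_def)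
  qed
  show thesis
  proof
    show "hom_on (adj A x) \<psi>" unfolding hom_on_def
    proof (intro conjI ballI)
      show "\<psi> 1 = 1" using eq[OF polys_1[OF A]] by (simp add: map_poly_hom_on_1[OF A h])
      fix u v assume uv: "u \<in> adj A x" "v \<in> adj A x"
      then obtain p q where pq: "p \<in> polys A" "q \<in> polys A" "u = poly p x" "v = poly q x"
        by (auto simp: adj_def)
      show "\<psi> (u - v) = \<psi> u - \<psi> v" using eq[OF polys_diff[OF A pq(1,2)]]
        by (simp add: pq eq map_poly_hom_on_diff[OF A h])
      show "\<psi> (u * v) = \<psi> u * \<psi> v" using eq[OF polys_mult[OF A pq(1,2)]]
        by (simp add: pq eq map_poly_hom_on_mult[OF A h])
    qed
    show "\<psi> a = \<phi> a" if "a \<in> A" for a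
      using eq[OF polys_const[OF A that]] by (simp add: map_poly_pCons_0 hom_on_0[OF A h])
    have *: "[:0,1:] \<in> polys A" by (intro polys_pCons[OF A] polys_0[OF A] subfld_0[OF A] subfld_1[OF A])
    show "\<psi> x = y" using eq[OF *] by (simp add: map_poly_pCons_0 hom_on_0[OF A h] hom_on_1[OF A h])
  qed
qed

text \<open>Any root of the transported minimal polynomial can serve as the image of
  \<open>x\<close>; algebraic closedness of the target provides one.\<close>

lemma hom_extend_root:
  fixes \<phi> :: "'e::field \<Rightarrow> 'f::alg_closed_field"
  assumes A: "subfld A" and h: "hom_on A \<phi>" and x: "alg_over A x"
  obtains \<psi> where "hom_on (adj A x) \<psi>" "\<And>a. a \<in> A \<Longrightarrow> \<psi> a = \<phi> a"
proof -
  obtain m where m: "m \<in> polys A" "lead_coeff m = 1" "poly m x = 0" "degree m > 0"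
    "\<And>h. h \<in> polys A \<Longrightarrow> poly h x = 0 \<Longrightarrow> \<exists>s\<in>polys A. h = m * s"
    using minimal_polynomial[OF A x] by blast
  obtain y where y: "poly (map_poly \<phi> m) y = 0"
    using alg_closed_imp_poly_has_root[of "map_poly \<phi> m"] degree_map_poly_hom_on[OF A h m(1)] m(4) by auto
  show thesis
  proof (rule hom_extend_adj[OF A h x])
    fix p assume "p \<in> polys A" "poly p x = 0"
    then obtain s where "s \<in> polys A" "p = m * s" using m(5) by blast
    thus "poly (map_poly \<phi> p) y = 0" using y m(1) by (simp add: map_poly_hom_on_mult[OF A h])
  qed (rule that)
qed

lemma hom_on_poly:
  assumes A: "subfld A" and h: "hom_on A \<phi>" and p: "p \<in> polys A" and x: "x \<in> A"
  shows "\<phi> (poly p x) = poly (map_poly \<phi> p) (\<phi> x)"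
proof -
  have pw: "\<phi> (x ^ k) = \<phi> x ^ k" for k
    by (induction k) (simp_all add: hom_on_1[OF A h] hom_on_mult[OF A h x subfld_power[OF A x]])
  have "\<phi> (poly p x) = (\<Sum>k\<le>degree p. \<phi> (coeff p k * x ^ k))"
    unfolding poly_altdef by (intro hom_on_sum[OF A h] subfld_mult[OF A] polysD[OF p] subfld_power[OF A x])
  also have "\<dots> = (\<Sum>k\<le>degree p. coeff (map_poly \<phi> p) k * \<phi> x ^ k)"
    by (intro sum.cong refl) (simp add: hom_on_mult[OF A h polysD[OF p] subfld_power[OF A x]] pw coeff_map_poly hom_on_0[OF A h])
  finally show ?thesis unfolding poly_altdef degree_map_poly_hom_on[OF A h p] .
qed

lemma hom_on_UNIV: "hom_on UNIV \<phi> \<longleftrightarrow> field_hom \<phi>"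
proof
  assume h: "hom_on UNIV \<phi>"
  have U: "subfld (UNIV :: 'a set)" by (auto simp: subfld_def)
  show "field_hom \<phi>"
    by unfold_locales (auto simp: hom_on_add[OF U h] hom_on_mult[OF U h] hom_on_1[OF U h] hom_on_0[OF U h])
next
  assume "field_hom \<phi>"
  then interpret field_hom \<phi> .
  show "hom_on UNIV \<phi>" by (auto simp: hom_on_def hom_distribs)
qed

text \<open>Partial embeddings are represented by their graphs, so that Zorn's lemma can be applied to
  inclusion.\<close>

theorem hom_extend:
  fixes \<phi> :: "'e::field \<Rightarrow> 'f::alg_closed_field"
  assumes A: "subfld A" and h: "hom_on A \<phi>" and alg: "\<And>x. alg_over A x"
  obtains \<psi> where "field_hom \<psi>" "\<And>a. a \<in> A \<Longrightarrow> \<psi> a = \<phi> a"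
proof -
  \<comment> \<open>Single-valuedness is imposed only over 0, which is enough because the graphs are
    closed under differences.\<close>
  define good :: "('e \<times> 'f) set \<Rightarrow> bool" where
    "good G \<longleftrightarrow> (\<forall>a\<in>A. (a, \<phi> a) \<in> G) \<and>
      (\<forall>z\<in>G. \<forall>w\<in>G. (fst z - fst w, snd z - snd w) \<in> G \<and> (fst z * fst w, snd z * snd w) \<in> G) \<and>
      (\<forall>z\<in>G. (inverse (fst z), inverse (snd z)) \<in> G) \<and> (\<forall>b. (0, b) \<in> G \<longrightarrow> b = 0)" for G
  define G0 where "G0 = (\<lambda>a. (a, \<phi> a)) ` A"
  have "good G0" unfolding good_def G0_def
    using hom_on_diff[OF A h] hom_on_mult[OF A h] hom_on_inverse[OF A h] hom_on_0[OF A h]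
        subfld_diff[OF A] subfld_mult[OF A] subfld_inverse[OF A]
    by (auto simp: image_iff)
  have "\<exists>M\<in>{G. good G}. \<forall>H\<in>{G. good G}. M \<subseteq> H \<longrightarrow> H = M"
  proof (rule subset_Zorn_nonempty)
    show "{G. good G} \<noteq> {}" using \<open>good G0\<close> by auto
    fix \<C> assume C: "\<C> \<noteq> {}" "subset.chain ({G. good G}) \<C>"
    have g: "good G" if "G \<in> \<C>" for G using C(2) that by (auto simp: subset.chain_def)
    have two: "\<exists>G\<in>\<C>. z \<in> G \<and> w \<in> G" if zw: "z \<in> \<Union>\<C>" "w \<in> \<Union>\<C>" for z w
    proof -
      obtain G H where GH: "G \<in> \<C>" "H \<in> \<C>" "z \<in> G" "w \<in> H" using zw by auto
      hence "G \<subseteq> H \<or> H \<subseteq> G" using subset.chain_total[OF C(2)] by auto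
      thus ?thesis using GH by auto
    qed
    show "\<Union>\<C> \<in> {G. good G}" unfolding mem_Collect_eq good_def
    proof (intro conjI ballI allI impI)
      fix a assume "a \<in> A"
      thus "(a, \<phi> a) \<in> \<Union>\<C>" using C(1) g by (fastforce simp: good_def)
    next
      fix z w assume "z \<in> \<Union>\<C>" "w \<in> \<Union>\<C>"
      then obtain G where G: "G \<in> \<C>" "z \<in> G" "w \<in> G" using two by blast
      show "(fst z - fst w, snd z - snd w) \<in> \<Union>\<C>" "(fst z * fst w, snd z * snd w) \<in> \<Union>\<C>"
        using g[OF G(1)] G unfolding good_def by blast+
    next
      fix z assume "z \<in> \<Union>\<C>"
      then obtain G where G: "G \<in> \<C>" "z \<in> G" by auto
      show "(inverse (fst z), inverse (snd z)) \<in> \<Union>\<C>" using g[OF G(1)] G unfolding good_def by blast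
    next
      fix b assume "(0, b) \<in> \<Union>\<C>"
      then obtain G where G: "G \<in> \<C>" "(0, b) \<in> G" by auto
      thus "b = 0" using g[OF G(1)] by (auto simp: good_def)
    qed
  qed
  then obtain M where M: "good M" "\<And>H. good H \<Longrightarrow> M \<subseteq> H \<Longrightarrow> H = M" by auto
  note gM = M(1)[unfolded good_def]
  have Md: "(a - a', b - b') \<in> M" and Mm: "(a * a', b * b') \<in> M" if "(a, b) \<in> M" "(a', b') \<in> M" for a b a' b'
    using gM[THEN conjunct2, THEN conjunct1, rule_format, OF that] by auto
  have Mi: "(inverse a, inverse b) \<in> M" if "(a, b) \<in> M" for a b
    using gM[THEN conjunct2, THEN conjunct2, THEN conjunct1, rule_format, OF that] by auto
  have MA: "(a, \<phi> a) \<in> M" if "a \<in> A" for a using gM that by blast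
  have sv: "b = b'" if "(a, b) \<in> M" "(a, b') \<in> M" for a b b'
  proof -
    have "(0, b - b') \<in> M" using Md[OF that] by simp
    thus ?thesis using gM by auto
  qed
  define B where "B = fst ` M"
  define \<psi> where "\<psi> a = (THE b. (a, b) \<in> M)" for a
  have psi: "\<psi> a = b" if "(a, b) \<in> M" for a b unfolding \<psi>_def using that sv by blast
  have BM: "(a, \<psi> a) \<in> M" if "a \<in> B" for a using that psi by (auto simp: B_def)
  have MB: "a \<in> B" if "(a, b) \<in> M" for a b using that by (force simp: B_def)
  have AB: "A \<subseteq> B" using MA MB by blast
  have B: "subfld B"
  proof (rule subfldI)
    show "1 \<in> B" using AB subfld_1[OF A] by auto
    show "u - v \<in> B" "u * v \<in> B" if "u \<in> B" "v \<in> B" for u v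
      using MB[OF Md[OF BM[OF that(1)] BM[OF that(2)]]] MB[OF Mm[OF BM[OF that(1)] BM[OF that(2)]]] by simp_all
    show "inverse u \<in> B" if "u \<in> B" for u using MB[OF Mi[OF BM[OF that]]] .
  qed
  have one: "(1, 1) \<in> M" using MA[OF subfld_1[OF A]] hom_on_1[OF A h] by simp
  have hB: "hom_on B \<psi>" unfolding hom_on_def
  proof (intro conjI ballI)
    show "\<psi> 1 = 1" by (rule psi[OF one])
    fix u v assume uv: "u \<in> B" "v \<in> B"
    show "\<psi> (u - v) = \<psi> u - \<psi> v" by (rule psi[OF Md[OF BM[OF uv(1)] BM[OF uv(2)]]])
    show "\<psi> (u * v) = \<psi> u * \<psi> v" by (rule psi[OF Mm[OF BM[OF uv(1)] BM[OF uv(2)]]])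
  qed
  \<comment> \<open>By maximality the domain \<open>B\<close> is everything: otherwise
    \<open>hom_extend_root\<close> would adjoin one more element.\<close>
  have "x \<in> B" for x
  proof -
    have ax: "alg_over B x" using alg_over_mono[OF AB alg] .
    obtain \<chi> where c: "hom_on (adj B x) \<chi>" "\<And>a. a \<in> B \<Longrightarrow> \<chi> a = \<psi> a"
      by (rule hom_extend_root[OF B hB ax]) (rule that)
    define H where "H = (\<lambda>u. (u, \<chi> u)) ` adj B x"
    note sa = subfld_adj[OF B ax]
    have "good H" unfolding good_def
    proof (intro conjI ballI allI impI)
      fix a assume "a \<in> A"
      hence "a \<in> B" using AB by auto
      thus "(a, \<phi> a) \<in> H" using c(2)[of a] adj_base[OF B, of x] psi[OF MA[OF \<open>a \<in> A\<close>]]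
        by (auto simp: H_def image_iff)
    qed (auto simp: H_def hom_on_diff[OF sa c(1)] hom_on_mult[OF sa c(1)] hom_on_inverse[OF sa c(1)]
          hom_on_0[OF sa c(1)] subfld_diff[OF sa] subfld_mult[OF sa] subfld_inverse[OF sa] image_iff)
    moreover have "M \<subseteq> H"
    proof (clarify)
      fix a b assume ab: "(a, b) \<in> M"
      show "(a, b) \<in> H" using c(2)[OF MB[OF ab]] psi[OF ab] MB[OF ab] adj_base[OF B, of x]
        by (auto simp: H_def image_iff)
    qed
    ultimately have "H = M" by (rule M(2))
    moreover have "(x, \<chi> x) \<in> H" using adj_gen[OF B, of x] by (auto simp: H_def image_iff)
    ultimately show "x \<in> B" using MB by auto
  qed
  hence "B = UNIV" by auto
  show thesis
  proof
    show "field_hom \<psi>" using hB \<open>B = UNIV\<close> by (simp add: hom_on_UNIV)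
    show "\<psi> a = \<phi> a" if "a \<in> A" for a using psi[OF MA[OF that]] .
  qed
qed

section \<open>Squarefree polynomials\<close>

lemma prod_linear_dvd:
  fixes p :: "'a::idom poly"
  assumes "finite S" "\<And>a. a \<in> S \<Longrightarrow> poly p a = 0"
  shows "(\<Prod>a\<in>S. [:-a,1:]) dvd p"
  using assms
proof (induction S arbitrary: p)
  case (insert a S)
  obtain q where q: "p = [:-a,1:] * q" using insert.prems by (metis dvdE insertI1 poly_eq_0_iff_dvd)
  have "poly q b = 0" if "b \<in> S" for b
  proof -
    have "b \<noteq> a" using that insert.hyps by auto
    thus ?thesis using insert.prems[of b] that unfolding q by auto
  qed
  hence "[:-a,1:] * (\<Prod>a\<in>S. [:-a,1:]) dvd [:-a,1:] * q" by (intro mult_dvd_mono insert.IH dvd_refl)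
  thus ?case unfolding q using insert.hyps by (simp del: mult_pCons_left)
qed auto

lemma poly_pderiv_linear_mult: "poly (pderiv ([:-a,1:] * q)) a = poly q (a::'a::idom)"
  by (simp only: pderiv_mult poly_add poly_mult) (simp add: pderiv_pCons)

text \<open>Splitting off one factor, \<open>p = (X - a) q\<close>, gives
  \<open>p'(a) = q(a)\<close>, so the multiplicity of a root exceeds 1 exactly if the derivative
  vanishes there too.\<close>

lemma rsquarefree_iff_pderiv:
  fixes p :: "'a::field poly"
  assumes "p \<noteq> 0"
  shows "rsquarefree p \<longleftrightarrow> (\<forall>a. poly p a = 0 \<longrightarrow> poly (pderiv p) a \<noteq> 0)"
proof -
  have "order a p \<le> 1 \<longleftrightarrow> poly (pderiv p) a \<noteq> 0" if a: "poly p a = 0" for a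
  proof -
    obtain q where q: "p = [:-a,1:] * q" using a by (metis dvdE poly_eq_0_iff_dvd)
    hence q0: "q \<noteq> 0" using assms by auto
    have "poly (pderiv p) a = poly q a" unfolding q by (rule poly_pderiv_linear_mult)
    moreover have "order a p = 1 + order a q"
      using assms unfolding q by (subst order_mult) (auto simp: order_linear' )
    ultimately show ?thesis using order_root[of q a] q0 by auto
  qed
  moreover have "order a p = 0" if "poly p a \<noteq> 0" for a using that by (rule order_0I)
  ultimately show ?thesis unfolding rsquarefree_def using assms
    by (metis One_nat_def le_Suc_eq le_zero_eq order_root zero_le_one le_refl)
qed

lemma rsquarefree_dvd:
  assumes "rsquarefree q" "p dvd q"
  shows "rsquarefree p"
proof -
  have "q \<noteq> 0" using assms by (simp add: rsquarefree_def)
  moreover hence "p \<noteq> 0" using assms by auto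
  ultimately show ?thesis using assms dvd_imp_order_le[of q p] unfolding rsquarefree_def
    by (metis le_zero_eq le_Suc_eq One_nat_def)
qed

lemma rsquarefree_prod_linear:
  fixes S :: "'a::field set"
  assumes "finite S"
  shows "rsquarefree (\<Prod>a\<in>S. [:-a,1:])"
proof (subst rsquarefree_iff_pderiv)
  show "(\<Prod>a\<in>S. [:-a,1:]) \<noteq> 0" using assms by auto
  show "\<forall>a. poly (\<Prod>a\<in>S. [:-a,1:]) a = 0 \<longrightarrow> poly (pderiv (\<Prod>a\<in>S. [:-a,1:])) a \<noteq> 0"
  proof (intro allI impI)
    fix a assume "poly (\<Prod>a\<in>S. [:-a,1:]) a = 0"
    hence a: "a \<in> S" using assms by (auto simp: poly_prod)
    have "(\<Prod>a\<in>S. [:-a,1:]) = [:-a,1:] * (\<Prod>b\<in>S-{a}. [:-b,1:])" using a assms by (rule prod.remove[rotated])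
    moreover have "poly (\<Prod>b\<in>S-{a}. [:-b,1:]) a \<noteq> 0" using assms by (auto simp: poly_prod)
    ultimately show "poly (pderiv (\<Prod>a\<in>S. [:-a,1:])) a \<noteq> 0" by (metis poly_pderiv_linear_mult)
  qed
qed

text \<open>A nonconstant cofactor of the product over the distinct roots would have a root, which
  would then be a multiple root of \<open>p\<close>.\<close>

lemma rsquarefree_split:
  fixes p :: "'a::alg_closed_field poly"
  assumes "rsquarefree p"
  shows "p = smult (lead_coeff p) (\<Prod>a\<in>{a. poly p a = 0}. [:-a,1:])"
    and "card {a. poly p a = 0} = degree p"
proof -
  define S where "S = {a. poly p a = 0}"
  have p: "p \<noteq> 0" using assms by (simp add: rsquarefree_def)
  have S: "finite S" unfolding S_def by (rule poly_roots_finite[OF p])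
  obtain q where q: "p = (\<Prod>a\<in>S. [:-a,1:]) * q"
    using prod_linear_dvd[OF S, of p] by (auto simp: S_def)
  have q0: "q \<noteq> 0" using p q by auto
  have "degree q = 0"
  proof (rule ccontr)
    assume "degree q \<noteq> 0"
    then obtain b where b: "poly q b = 0" using alg_closed_imp_poly_has_root[of q] by auto
    hence bS: "b \<in> S" unfolding S_def by (subst q) auto
    have "(\<Prod>a\<in>S. [:-a,1:]) \<noteq> 0" using S by auto
    hence "order b p = order b (\<Prod>a\<in>S. [:-a,1:]) + order b q" using p unfolding q by (subst order_mult) auto
    moreover have "poly (\<Prod>a\<in>S. [:-a,1:]) b = 0" using bS S by (auto simp: poly_prod)
    hence "order b (\<Prod>a\<in>S. [:-a,1:]) > 0"
      using \<open>(\<Prod>a\<in>S. [:-a,1:]) \<noteq> 0\<close> by (metis order_root neq0_conv)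
    moreover have "order b q > 0" using b q0 by (simp add: order_root)
    moreover have "order b p = 0 \<or> order b p = 1" using assms unfolding rsquarefree_def by blast
    ultimately show False by linarith
  qed
  then obtain c where c: "q = [:c:]" by (metis degree_0_id)
  have pc: "p = smult c (\<Prod>a\<in>S. [:-a,1:])" using q c by simp
  have lc: "lead_coeff (\<Prod>a\<in>S. [:-a,1:]) = 1" by (simp add: lead_coeff_prod)
  have "lead_coeff p = c" unfolding pc lead_coeff_smult lc by simp
  with pc show "p = smult (lead_coeff p) (\<Prod>a\<in>{a. poly p a = 0}. [:-a,1:])" by (simp add: S_def)
  have "degree p = degree (\<Prod>a\<in>S. [:-a,1:])" using pc q0 c by simp
  also have "\<dots> = card S" by (subst degree_prod_eq_sum_degree) auto
  finally show "card {a. poly p a = 0} = degree p" by (simp add: S_def)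
qed

section \<open>Galois theory with field endomorphisms\<close>

text \<open>Endomorphisms of the ambient field stand for the Galois group. Injectivity already makes
  them permute finite root sets, which is what most arguments use; bijectivity is a consequence of
  algebraicity, proved in \<open>homs_over_surj\<close>.\<close>

definition homs_over :: "'e::field set \<Rightarrow> ('e \<Rightarrow> 'e) set" where
  "homs_over F = {\<sigma>. field_hom \<sigma> \<and> (\<forall>a\<in>F. \<sigma> a = a)}"

lemma homs_over_mono: "F \<subseteq> G \<Longrightarrow> homs_over G \<subseteq> homs_over F"
  by (auto simp: homs_over_def)

lemma homs_over_map_poly: "\<sigma> \<in> homs_over F \<Longrightarrow> p \<in> polys F \<Longrightarrow> map_poly \<sigma> p = p"
proof -
  assume a: "\<sigma> \<in> homs_over F" "p \<in> polys F"
  then interpret field_hom \<sigma> by (simp add: homs_over_def)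
  show ?thesis by (rule poly_eqI) (use a in \<open>auto simp: homs_over_def polys_def\<close>)
qed

lemma homs_over_poly: "\<sigma> \<in> homs_over F \<Longrightarrow> p \<in> polys F \<Longrightarrow> poly p (\<sigma> x) = \<sigma> (poly p x)"
proof -
  assume a: "\<sigma> \<in> homs_over F" "p \<in> polys F"
  then interpret field_hom \<sigma> by (simp add: homs_over_def)
  show ?thesis using poly_map_poly[of p x] homs_over_map_poly[OF a] by simp
qed

lemma field_hom_inj: "field_hom \<sigma> \<Longrightarrow> \<sigma> x = \<sigma> y \<longleftrightarrow> x = y"
proof -
  assume "field_hom \<sigma>"
  then interpret field_hom \<sigma> .
  show ?thesis by simp
qed

lemma homs_over_root: "\<sigma> \<in> homs_over F \<Longrightarrow> p \<in> polys F \<Longrightarrow> poly p (\<sigma> x) = 0 \<longleftrightarrow> poly p x = 0"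
proof -
  assume a: "\<sigma> \<in> homs_over F" "p \<in> polys F"
  then interpret field_hom \<sigma> by (simp add: homs_over_def)
  show ?thesis using homs_over_poly[OF a, of x] by simp
qed

text \<open>The assumption on \<open>y\<close> is exactly what \<open>hom_extend_adj\<close> needs
  to send \<open>x\<close> to \<open>y\<close>; \<open>hom_extend\<close> then continues this to the
  whole field.\<close>

lemma conjugate_hom:
  fixes x y :: "'e::alg_closed_field"
  assumes F: "subfld F" and alg: "\<And>x::'e. alg_over F x"
    and y: "\<And>p. p \<in> polys F \<Longrightarrow> poly p x = 0 \<Longrightarrow> poly p y = 0"
  obtains \<sigma> where "\<sigma> \<in> homs_over F" "\<sigma> x = y"
proof -
  have h: "hom_on F (\<lambda>x. x)" by (auto simp: hom_on_def)
  obtain \<psi> where \<psi>: "hom_on (adj F x) \<psi>" "\<And>a. a \<in> F \<Longrightarrow> \<psi> a = a" "\<psi> x = y"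
    by (rule hom_extend_adj[OF F h alg[of x], of y]) (use y in \<open>auto simp: map_poly_idI\<close>)
  obtain \<sigma> where "field_hom \<sigma>" "\<And>a. a \<in> adj F x \<Longrightarrow> \<sigma> a = \<psi> a"
    using hom_extend[OF subfld_adj[OF F alg] \<psi>(1)] alg_over_mono[OF adj_base[OF F] alg] by blast
  thus thesis using \<psi> adj_base[OF F, of x] adj_gen[OF F, of x]
    by (intro that[of \<sigma>]) (auto simp: homs_over_def)
qed

text \<open>The witness may be any squarefree polynomial with root \<open>x\<close>, not only the
  minimal one, which makes the notion visibly stable under enlarging \<open>F\<close>.\<close>

definition sep_over :: "'e::field set \<Rightarrow> 'e \<Rightarrow> bool" where
  "sep_over F x \<longleftrightarrow> (\<exists>p\<in>polys F. rsquarefree p \<and> poly p x = 0)"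

lemma sep_over_mono: "F \<subseteq> G \<Longrightarrow> sep_over F x \<Longrightarrow> sep_over G x"
  using polys_mono[of F G] by (auto simp: sep_over_def)

text \<open>Write \<open>x = h(a)\<close> with \<open>h\<close> of degree below that of the minimal
  polynomial \<open>m\<close>. Applying endomorphisms shows \<open>h(b) = x\<close> at every root
  \<open>b\<close> of \<open>m\<close>, and separability supplies \<open>degree m\<close> such
  roots, so \<open>h - x\<close> is zero and \<open>x\<close> is a coefficient of
  \<open>h\<close>.\<close>

lemma fixed_adj:
  fixes x :: "'e::alg_closed_field"
  assumes F: "subfld F" and alg: "\<And>x::'e. alg_over F x" and a: "sep_over F a"
    and x: "x \<in> adj F a" "\<And>\<sigma>. \<sigma> \<in> homs_over F \<Longrightarrow> \<sigma> x = x"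
  shows "x \<in> F"
proof -
  obtain m where m: "m \<in> polys F" "lead_coeff m = 1" "poly m a = 0" "degree m > 0"
    "\<And>h. h \<in> polys F \<Longrightarrow> poly h a = 0 \<Longrightarrow> \<exists>s\<in>polys F. h = m * s"
    using minimal_polynomial[OF F alg[of a]] by blast
  obtain f where f: "f \<in> polys F" "rsquarefree f" "poly f a = 0" using a by (auto simp: sep_over_def)
  have "m dvd f" using m(5)[OF f(1,3)] by auto
  hence "rsquarefree m" using f(2) rsquarefree_dvd by blast
  hence card: "card {b. poly m b = 0} = degree m" by (rule rsquarefree_split)
  obtain h0 where h0: "h0 \<in> polys F" "x = poly h0 a" using x(1) by (auto simp: adj_def)
  have "m \<noteq> 0" using m by auto
  then obtain s h where h: "h \<in> polys F" "h0 = m * s + h" "h = 0 \<or> degree h < degree m"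
    using polys_divmod[OF F h0(1) m(1)] by blast
  have hx: "poly h a = x" using h0 h m(3) by simp
  define g where "g = h - [:x:]"
  have "poly g b = 0" if b: "poly m b = 0" for b
  proof -
    obtain \<sigma> where s: "\<sigma> \<in> homs_over F" "\<sigma> a = b"
    proof (rule conjugate_hom[OF F alg, of a b])
      fix p assume "p \<in> polys F" "poly p a = 0"
      thus "poly p b = 0" using m(5) b by (metis mult_zero_left poly_mult)
    qed
    have "poly h b = \<sigma> (poly h a)" using homs_over_poly[OF s(1) h(1), of a] s(2) by simp
    also have "\<dots> = x" using x(2)[OF s(1)] hx by simp
    finally show ?thesis by (simp add: g_def)
  qed
  hence sub: "{b. poly m b = 0} \<subseteq> {b. poly g b = 0}" by auto
  have "g = 0"
  proof (rule ccontr)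
    assume g: "g \<noteq> 0"
    have "degree m \<le> card {b. poly g b = 0}" unfolding card[symmetric]
      by (rule card_mono[OF poly_roots_finite[OF g] sub])
    also have "\<dots> \<le> degree g" by (rule card_poly_roots_bound[OF g])
    also have "\<dots> < degree m" using h(3) m(4) unfolding g_def
      by (metis degree_diff_less degree_pCons_0 degree_0)
    finally show False by simp
  qed
  hence "h = [:x:]" by (simp add: g_def)
  thus ?thesis using polysD[OF h(1), of 0] by simp
qed

section \<open>Fields generated by finitely many separable elements\<close>

definition gen_fld :: "'e::field set \<Rightarrow> 'e set \<Rightarrow> 'e set" where
  "gen_fld F A = \<Inter>{L. subfld L \<and> F \<subseteq> L \<and> A \<subseteq> L}"

lemma gen_fld_base: "F \<subseteq> gen_fld F A" and gen_fld_gens: "A \<subseteq> gen_fld F A"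
  by (auto simp: gen_fld_def)

lemma gen_fld_least: "subfld L \<Longrightarrow> F \<subseteq> L \<Longrightarrow> A \<subseteq> L \<Longrightarrow> gen_fld F A \<subseteq> L"
  by (auto simp: gen_fld_def)

lemma subfld_gen_fld: "subfld (gen_fld F A)"
  unfolding gen_fld_def
  by (rule subfldI) (auto intro: subfld_1 subfld_diff subfld_mult subfld_inverse)

lemma gen_fld_mono: "A \<subseteq> B \<Longrightarrow> gen_fld F A \<subseteq> gen_fld F B"
  by (intro gen_fld_least subfld_gen_fld gen_fld_base order.trans[OF _ gen_fld_gens])

lemma gen_fld_insert: "gen_fld F (insert a A) \<subseteq> gen_fld (adj F a) A" if "subfld F"
  using adj_base[OF that, of a] adj_gen[OF that, of a] gen_fld_base[of "adj F a" A] gen_fld_gens[of A "adj F a"]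
  by (intro gen_fld_least subfld_gen_fld) auto

text \<open>Induction on the generators with \<open>F\<close> arbitrary: endomorphisms over
  \<open>F(a)\<close> are endomorphisms over \<open>F\<close>, so the induction hypothesis puts
  \<open>x\<close> in \<open>F(a)\<close>, and \<open>fixed_adj\<close> brings it down to
  \<open>F\<close>.\<close>

theorem fixed_gen_fld:
  fixes x :: "'e::alg_closed_field"
  assumes "finite A" "subfld F" "\<And>x::'e. alg_over F x" "\<And>a. a \<in> A \<Longrightarrow> sep_over F a"
    "x \<in> gen_fld F A" "\<And>\<sigma>. \<sigma> \<in> homs_over F \<Longrightarrow> \<sigma> x = x"
  shows "x \<in> F"
  using assms
proof (induction A arbitrary: F)
  case empty
  thus ?case using gen_fld_least[of F F "{}"] by auto
next
  case (insert a A)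
  note F = insert.prems(1) and alg = insert.prems(2)
  note ab = adj_base[OF F, of a]
  have "x \<in> adj F a"
  proof (rule insert.IH)
    show "subfld (adj F a)" by (rule subfld_adj[OF F alg])
    show "alg_over (adj F a) y" for y by (rule alg_over_mono[OF ab alg])
    show "sep_over (adj F a) b" if "b \<in> A" for b using sep_over_mono[OF ab] insert.prems(3) that by auto
    show "x \<in> gen_fld (adj F a) A" using gen_fld_insert[OF F] insert.prems(4) by auto
    show "\<sigma> x = x" if "\<sigma> \<in> homs_over (adj F a)" for \<sigma>
      using homs_over_mono[OF ab] insert.prems(5) that by auto
  qed
  thus ?case using fixed_adj[OF F alg, of a x] insert.prems(3,5) by auto
qed

lemma hom_gen_fld:
  assumes s: "\<sigma> \<in> homs_over F" and AB: "\<And>a. a \<in> A \<Longrightarrow> \<sigma> a \<in> gen_fld F B" and x: "x \<in> gen_fld F A"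
  shows "\<sigma> x \<in> gen_fld F B"
proof -
  interpret field_hom \<sigma> using s by (simp add: homs_over_def)
  note G = subfld_gen_fld[of F B]
  have "subfld {x. \<sigma> x \<in> gen_fld F B}"
    by (rule subfldI) (auto simp: hom_distribs subfld_1[OF G] subfld_diff[OF G] subfld_mult[OF G] subfld_inverse[OF G])
  moreover have "F \<subseteq> {x. \<sigma> x \<in> gen_fld F B}" using s gen_fld_base[of F B] by (auto simp: homs_over_def)
  ultimately show ?thesis using gen_fld_least[of _ F A] AB x by blast
qed

lemma map_poly_prod_linear:
  assumes "field_hom \<sigma>"
  shows "map_poly \<sigma> (\<Prod>y\<in>S. [:- f y, 1:]) = (\<Prod>y\<in>S. [:- \<sigma> (f y), 1:])"
proof -
  interpret field_hom \<sigma> by fact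
  interpret mp: map_poly_idom_hom \<sigma> ..
  show ?thesis by (simp add: mp.hom_prod map_poly_pCons_0 hom_distribs)
qed

text \<open>A separable polynomial is provided by the orbit of the element under the endomorphisms over the
  base field.\<close>

theorem sep_over_gen_fld:
  fixes x :: "'e::alg_closed_field"
  assumes A: "finite A" and F: "subfld F" and alg: "\<And>x::'e. alg_over F x"
    and sep: "\<And>a. a \<in> A \<Longrightarrow> sep_over F a" and x: "x \<in> gen_fld F A"
  shows "sep_over F x"
proof -
  define f where "f a = (SOME p. p \<in> polys F \<and> rsquarefree p \<and> poly p a = 0)" for a
  have f: "f a \<in> polys F" "rsquarefree (f a)" "poly (f a) a = 0" if "a \<in> A" for a
    using someI_ex[of "\<lambda>p. p \<in> polys F \<and> rsquarefree p \<and> poly p a = 0"] sep[OF that]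
    unfolding sep_over_def f_def by blast+
  \<comment> \<open>All roots of the chosen polynomials become generators: an endomorphism moves the
    members of \<open>A\<close> into \<open>B\<close>, so the whole orbit of \<open>x\<close> lies
    in a field to which \<open>fixed_gen_fld\<close> applies.\<close>
  define B where "B = (\<Union>a\<in>A. {b. poly (f a) b = 0})"
  have B: "finite B" unfolding B_def using A f by (auto intro!: poly_roots_finite simp: rsquarefree_def)
  have sepB: "sep_over F b" if "b \<in> B" for b using that f by (auto simp: B_def sep_over_def)
  define S where "S = (\<lambda>\<sigma>. \<sigma> x) ` homs_over F"
  obtain p where p: "p \<in> polys F" "p \<noteq> 0" "poly p x = 0" using alg[of x] by (auto simp: alg_over_def)
  have "S \<subseteq> {b. poly p b = 0}" using homs_over_root[OF _ p(1), of _ x] p(3) by (auto simp: S_def)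
  hence S: "finite S" using poly_roots_finite[OF p(2)] finite_subset by blast
  have SB: "S \<subseteq> gen_fld F B"
  proof
    fix y assume "y \<in> S"
    then obtain \<sigma> where s: "\<sigma> \<in> homs_over F" "y = \<sigma> x" by (auto simp: S_def)
    have "\<sigma> a \<in> gen_fld F B" if "a \<in> A" for a
      using homs_over_root[OF s(1) f(1)[OF that], of a] f(3)[OF that] that gen_fld_gens[of B F] by (auto simp: B_def)
    thus "y \<in> gen_fld F B" using hom_gen_fld[OF s(1) _ x] s(2) by blast
  qed
  define q where "q = (\<Prod>y\<in>S. [:-y,1:])"
  note G = subfld_gen_fld[of F B]
  have qG: "q \<in> polys (gen_fld F B)" unfolding q_def
    using SB by (intro polys_prod[OF G]) (auto intro!: polys_pCons[OF G] polys_0[OF G] subfld_uminus[OF G] subfld_1[OF G])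
  have "q \<in> polys F"
  proof (rule polysI)
    fix i
    show "coeff q i \<in> F"
    proof (rule fixed_gen_fld[OF B F alg])
      show "coeff q i \<in> gen_fld F B" using polysD[OF qG] .
      fix \<sigma> assume s: "\<sigma> \<in> homs_over F"
      interpret field_hom \<sigma> using s by (simp add: homs_over_def)
      have "\<sigma> ` S \<subseteq> S"
      proof
        fix y assume "y \<in> \<sigma> ` S"
        then obtain \<tau> where t: "\<tau> \<in> homs_over F" "y = \<sigma> (\<tau> x)" by (auto simp: S_def)
        have "field_hom (\<sigma> \<circ> \<tau>)"
        proof -
          interpret t: field_hom \<tau> using t by (simp add: homs_over_def)
          show ?thesis by unfold_locales (auto simp: hom_distribs)
        qed
        hence "\<sigma> \<circ> \<tau> \<in> homs_over F" using s t by (auto simp: homs_over_def)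
        thus "y \<in> S" using t by (auto simp: S_def intro!: image_eqI[of _ _ "\<sigma> \<circ> \<tau>"])
      qed
      moreover have inj: "inj_on \<sigma> S" by (auto simp: inj_on_def)
      ultimately have SS: "\<sigma> ` S = S" using S by (metis card_image card_subset_eq)
      have "map_poly \<sigma> q = (\<Prod>y\<in>S. [:- \<sigma> y, 1:])" unfolding q_def
        by (rule map_poly_prod_linear) (use s in \<open>simp add: homs_over_def\<close>)
      also have "\<dots> = (\<Prod>y\<in>\<sigma> ` S. [:- y, 1:])" using inj by (simp add: prod.reindex)
      finally have "map_poly \<sigma> q = q" unfolding SS q_def .
      thus "\<sigma> (coeff q i) = coeff q i" by (metis coeff_map_poly_hom)
    qed (use sepB in auto)
  qed
  moreover have "rsquarefree q" unfolding q_def by (rule rsquarefree_prod_linear[OF S])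
  moreover have "(\<lambda>x. x) \<in> homs_over F" by (auto simp: homs_over_def simp flip: hom_on_UNIV) (auto simp: hom_on_def)
  hence "x \<in> S" unfolding S_def by (rule image_eqI[rotated]) auto
  hence "poly q x = 0" using S by (auto simp: q_def poly_prod)
  ultimately show ?thesis by (auto simp: sep_over_def)
qed

text \<open>The usual \<open>c = a + l * b\<close>, argued through fixed fields instead of greatest
  common divisors: an endomorphism over \<open>F(c)\<close> satisfies
  \<open>\<sigma> a - a = l * (b - \<sigma> b)\<close>, so for \<open>l\<close> outside the finite
  set \<open>T\<close> of quotients it fixes \<open>b\<close> and then \<open>a\<close>, and both
  lie in \<open>F(c)\<close>.\<close>

lemma primitive_element_two:
  fixes a b :: "'e::alg_closed_field"
  assumes F: "subfld F" "infinite F" and alg: "\<And>x::'e. alg_over F x" and a: "sep_over F a" and b: "sep_over F b"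
  obtains c where "c \<in> gen_fld F {a,b}" "a \<in> adj F c" "b \<in> adj F c"
proof -
  obtain f where f: "f \<in> polys F" "rsquarefree f" "poly f a = 0" using a by (auto simp: sep_over_def)
  obtain g where g: "g \<in> polys F" "rsquarefree g" "poly g b = 0" using b by (auto simp: sep_over_def)
  define T where "T = (\<lambda>(a', b'). (a' - a) / (b - b')) ` ({a'. poly f a' = 0} \<times> {b'. poly g b' = 0})"
  have "finite T" unfolding T_def using f g by (auto intro!: poly_roots_finite simp: rsquarefree_def)
  then obtain l where l: "l \<in> F" "l \<notin> T" using F(2) by (meson finite_subset subsetI)
  define c where "c = a + l * b"
  note G = subfld_gen_fld[of F "{a,b}"]
  have c: "c \<in> gen_fld F {a,b}" unfolding c_def
    using l(1) gen_fld_base[of F "{a,b}"] gen_fld_gens[of "{a,b}" F]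
    by (auto intro!: subfld_add[OF G] subfld_mult[OF G])
  have A: "subfld (adj F c)" "F \<subseteq> adj F c" "c \<in> adj F c" using subfld_adj[OF F(1) alg] adj_base[OF F(1)] adj_gen[OF F(1)] by auto
  have fix_ab: "\<sigma> a = a \<and> \<sigma> b = b" if s: "\<sigma> \<in> homs_over (adj F c)" for \<sigma>
  proof -
    interpret field_hom \<sigma> using s by (simp add: homs_over_def)
    have sF: "\<sigma> \<in> homs_over F" using homs_over_mono[OF A(2)] s by auto
    have "\<sigma> c = c" using s A(3) by (auto simp: homs_over_def)
    moreover have "\<sigma> l = l" using sF l by (auto simp: homs_over_def)
    ultimately have e: "\<sigma> a + l * \<sigma> b = a + l * b" unfolding c_def by (simp add: hom_distribs)
    have "\<sigma> b = b"
    proof (rule ccontr)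
      assume ne: "\<sigma> b \<noteq> b"
      have "\<sigma> a - a = l * (b - \<sigma> b)" using e by (simp add: algebra_simps)
      hence "l = (\<sigma> a - a) / (b - \<sigma> b)" using ne by (simp add: field_simps)
      moreover have "poly f (\<sigma> a) = 0" "poly g (\<sigma> b) = 0"
        using homs_over_root[OF sF f(1)] homs_over_root[OF sF g(1)] f g by auto
      ultimately show False using l(2) by (auto simp: T_def image_iff)
    qed
    thus ?thesis using e by simp
  qed
  have algc: "alg_over (adj F c) x" for x by (rule alg_over_mono[OF A(2) alg])
  have "x \<in> adj F c" if "x \<in> {a, b}" for x
  proof (rule fixed_gen_fld[of "{a,b}"])
    show "sep_over (adj F c) y" if "y \<in> {a,b}" for y using sep_over_mono[OF A(2)] a b that by auto
  qed (use that gen_fld_gens[of "{a,b}" "adj F c"] fix_ab A algc in auto)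
  thus thesis using that c by blast
qed

theorem primitive_element:
  fixes A :: "'e::alg_closed_field set"
  assumes "finite A" and F: "subfld F" "infinite F" and alg: "\<And>x::'e. alg_over F x"
    and sep: "\<And>a. a \<in> A \<Longrightarrow> sep_over F a"
  obtains c where "c \<in> gen_fld F A" "A \<subseteq> adj F c"
proof -
  have "\<exists>c\<in>gen_fld F A. A \<subseteq> adj F c" using assms(1) sep
  proof (induction A)
    case empty
    show ?case using subfld_0[OF subfld_gen_fld[of F "{}"]] by (intro bexI[of _ 0]) auto
  next
    case (insert a A)
    then obtain c where c: "c \<in> gen_fld F A" "A \<subseteq> adj F c" by auto
    have "sep_over F c" using sep_over_gen_fld[OF _ F(1) alg _ c(1)] insert by auto
    then obtain d where d: "d \<in> gen_fld F {a,c}" "a \<in> adj F d" "c \<in> adj F d"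
      using primitive_element_two[OF F alg, of a c] insert.prems by auto
    have "c \<in> gen_fld F (insert a A)" using c(1) gen_fld_mono[of A "insert a A" F] by auto
    hence "gen_fld F {a,c} \<subseteq> gen_fld F (insert a A)"
      using gen_fld_gens[of "insert a A" F] by (intro gen_fld_least subfld_gen_fld gen_fld_base) auto
    moreover have "adj F c \<subseteq> adj F d" by (intro adj_least subfld_adj[OF F(1) alg] adj_base[OF F(1)] d)
    ultimately show ?case using c d by (intro bexI[of _ d]) auto
  qed
  thus thesis using that by blast
qed

section \<open>Transitivity of algebraicity\<close>

text \<open>There are \<open>N\<close> homogeneous equations, indexed by \<open>j < N\<close>, in
  \<open>N + 1\<close> unknowns \<open>c i\<close> with \<open>i \<le> N\<close>. Elimination is
  carried out explicitly because the solution has to lie in the subfield \<open>F\<close>.\<close>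

lemma underdetermined_system:
  fixes A :: "nat \<Rightarrow> nat \<Rightarrow> 'e::field"
  assumes F: "subfld F" and A: "\<And>i j. i \<le> N \<Longrightarrow> j < N \<Longrightarrow> A i j \<in> F"
  shows "\<exists>c. (\<forall>i\<le>N. c i \<in> F) \<and> (\<exists>i\<le>N. c i \<noteq> 0) \<and> (\<forall>j<N. (\<Sum>i\<le>N. c i * A i j) = 0)"
  using A
proof (induction N arbitrary: A)
  case 0
  show ?case by (intro exI[of _ "\<lambda>_. 1"]) (auto simp: subfld_1[OF F])
next
  case (Suc N)
  show ?case
  proof (cases "\<exists>p\<le>Suc N. A p N \<noteq> 0")
    case False
    obtain c where c: "\<forall>i\<le>N. c i \<in> F" "\<exists>i\<le>N. c i \<noteq> 0" "\<forall>j<N. (\<Sum>i\<le>N. c i * A i j) = 0"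
      using Suc.IH[of A] Suc.prems by auto
    define c' where "c' = c(Suc N := 0)"
    have s: "(\<Sum>i\<le>Suc N. c' i * A i j) = (\<Sum>i\<le>N. c i * A i j)" for j
      by (simp add: c'_def)
    have "(\<Sum>i\<le>Suc N. c' i * A i j) = 0" if "j < Suc N" for j
    proof (cases "j = N")
      case True
      show ?thesis unfolding True by (intro sum.neutral) (use False in auto)
    qed (use s c that in auto)
    moreover have "\<forall>i\<le>Suc N. c' i \<in> F" using c(1) by (auto simp: c'_def le_Suc_eq subfld_0[OF F])
    moreover have "\<exists>i\<le>Suc N. c' i \<noteq> 0"
    proof -
      obtain i where "i \<le> N" "c i \<noteq> 0" using c(2) by auto
      thus ?thesis by (intro exI[of _ i]) (auto simp: c'_def)
    qed
    ultimately show ?thesis by blast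
  next
    case True
    then obtain p where p: "p \<le> Suc N" "A p N \<noteq> 0" by auto
    define \<pi> where "\<pi> = transpose p (Suc N)"
    have \<pi>: "\<pi> i \<le> Suc N" if "i \<le> Suc N" for i using that p(1) by (auto simp: \<pi>_def transpose_def)
    define B where "B i j = A (\<pi> i) j" for i j
    have B: "B i j \<in> F" if "i \<le> Suc N" "j < Suc N" for i j using Suc.prems[OF \<pi>] that by (auto simp: B_def)
    have piv: "B (Suc N) N \<noteq> 0" using p by (simp add: B_def \<pi>_def)
    define A' where "A' i j = B i j - B i N / B (Suc N) N * B (Suc N) j" for i j
    have "A' i j \<in> F" if "i \<le> N" "j < N" for i j
      unfolding A'_def using that by (intro subfld_diff[OF F] subfld_mult[OF F] subfld_divide[OF F] B) auto
    then obtain c where c: "\<forall>i\<le>N. c i \<in> F" "\<exists>i\<le>N. c i \<noteq> 0" "\<forall>j<N. (\<Sum>i\<le>N. c i * A' i j) = 0"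
      using Suc.IH[of A'] by auto
    \<comment> \<open>The pivot unknown is chosen so that equation \<open>N\<close> holds;
      \<open>A'\<close> is made so that the remaining equations then hold as well.\<close>
    define d where "d = - (\<Sum>i\<le>N. c i * B i N) / B (Suc N) N"
    define c' where "c' = c(Suc N := d)"
    have dF: "d \<in> F" unfolding d_def using c(1) B
      by (intro subfld_divide[OF F] subfld_uminus[OF F] subfld_sum[OF F] subfld_mult[OF F]) auto
    have s: "(\<Sum>i\<le>Suc N. c' i * B i j) = (\<Sum>i\<le>N. c i * B i j) + d * B (Suc N) j" for j
      by (simp add: c'_def)
    have z: "(\<Sum>i\<le>Suc N. c' i * B i j) = 0" if "j < Suc N" for j
    proof (cases "j = N")
      case True
      show ?thesis unfolding True s using piv by (simp add: d_def)
    next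
      case False
      have "(\<Sum>i\<le>N. c i * A' i j) = (\<Sum>i\<le>N. c i * B i j) + d * B (Suc N) j"
        unfolding A'_def d_def by (simp add: algebra_simps sum_subtractf sum_distrib_left sum_distrib_right sum_divide_distrib)
      thus ?thesis using s c(3) that False by simp
    qed
    have bij: "bij_betw \<pi> {..Suc N} {..Suc N}"
      unfolding \<pi>_def using p(1) by (intro bij_betw_imageI) (auto simp: inj_on_def transpose_def image_iff split: if_splits)
    have pp: "\<pi> (\<pi> i) = i" for i by (simp add: \<pi>_def)
    show ?thesis
    proof (intro exI[of _ "\<lambda>i. c' (\<pi> i)"] conjI allI impI)
      fix i assume "i \<le> Suc N"
      hence "\<pi> i \<le> Suc N" by (rule \<pi>)
      thus "c' (\<pi> i) \<in> F" using c(1) dF by (auto simp: c'_def le_Suc_eq)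
    next
      obtain i where i: "i \<le> N" "c i \<noteq> 0" using c(2) by auto
      thus "\<exists>i\<le>Suc N. c' (\<pi> i) \<noteq> 0" using \<pi>[of i] by (intro exI[of _ "\<pi> i"]) (auto simp: pp c'_def)
    next
      fix j assume j: "j < Suc N"
      have "(\<Sum>i\<le>Suc N. c' (\<pi> i) * A i j) = (\<Sum>i\<le>Suc N. c' (\<pi> i) * B (\<pi> i) j)" by (simp add: B_def pp)
      also have "\<dots> = (\<Sum>i\<le>Suc N. c' i * B i j)" by (rule sum.reindex_bij_betw[OF bij])
      finally show "(\<Sum>i\<le>Suc N. c' (\<pi> i) * A i j) = 0" using z[OF j] by simp
    qed
  qed
qed

lemma adj_reduce:
  assumes F: "subfld F" and x: "alg_over F x"
  obtains d where "\<And>u. u \<in> adj F x \<Longrightarrow> \<exists>f. (\<forall>i<d. f i \<in> F) \<and> u = (\<Sum>i<d. f i * x ^ i)"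
proof -
  obtain m where m: "m \<in> polys F" "poly m x = 0" "degree m > 0"
    using minimal_polynomial[OF F x] by metis
  have "\<exists>f. (\<forall>i<degree m. f i \<in> F) \<and> u = (\<Sum>i<degree m. f i * x ^ i)" if u: "u \<in> adj F x" for u
  proof -
    obtain p where p: "p \<in> polys F" "u = poly p x" using u by (auto simp: adj_def)
    have "m \<noteq> 0" using m by auto
    then obtain s r where r: "r \<in> polys F" "p = m * s + r" "r = 0 \<or> degree r < degree m"
      using polys_divmod[OF F p(1) m(1)] by metis
    have dr: "coeff r i = 0" if "i \<ge> degree m" for i using r(3) that by (auto intro: coeff_eq_0)
    have "u = poly r x" using p r m by simp
    also have "\<dots> = (\<Sum>i\<le>degree r. coeff r i * x ^ i)" by (simp add: poly_altdef)
    also have "\<dots> = (\<Sum>i<degree m. coeff r i * x ^ i)"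
      by (rule sum.mono_neutral_cong) (auto simp: dr coeff_eq_0)
    finally show ?thesis using polysD[OF r(1)] by (intro exI[of _ "coeff r"]) auto
  qed
  thus thesis by (rule that)
qed

text \<open>With \<open>d\<close> and \<open>k\<close> bounding the degrees of the two steps, the
  powers \<open>e ^ t\<close> for \<open>t \<le> k * d\<close> are \<open>k * d + 1\<close>
  combinations over \<open>F\<close> of the \<open>k * d\<close> products
  \<open>x ^ i * e ^ j\<close>, hence linearly dependent.\<close>

lemma alg_over_adj_trans:
  assumes F: "subfld F" and x: "alg_over F x" and e: "alg_over (adj F x) e"
  shows "alg_over F e"
proof -
  note G = subfld_adj[OF F x]
  obtain d where d: "\<And>u. u \<in> adj F x \<Longrightarrow> \<exists>f. (\<forall>i<d. f i \<in> F) \<and> u = (\<Sum>i<d. f i * x ^ i)"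
    using adj_reduce[OF F x] by blast
  obtain k where k: "\<And>u. u \<in> adj (adj F x) e \<Longrightarrow> \<exists>f. (\<forall>i<k. f i \<in> adj F x) \<and> u = (\<Sum>i<k. f i * e ^ i)"
    using adj_reduce[OF G e] by blast
  have "\<exists>f. (\<forall>j<k. \<forall>i<d. f j i \<in> F) \<and> e ^ t = (\<Sum>j<k. (\<Sum>i<d. f j i * x ^ i) * e ^ j)" for t
  proof -
    have "e ^ t \<in> adj (adj F x) e"
      by (intro subfld_power[OF subfld_adj[OF G e]] adj_gen[OF G])
    then obtain g where g: "\<forall>j<k. g j \<in> adj F x" "e ^ t = (\<Sum>j<k. g j * e ^ j)" using k by blast
    have "\<forall>j. \<exists>f. j < k \<longrightarrow> (\<forall>i<d. f i \<in> F) \<and> g j = (\<Sum>i<d. f i * x ^ i)" using g(1) d by blast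
    then obtain f where f: "\<And>j. j < k \<Longrightarrow> (\<forall>i<d. f j i \<in> F) \<and> g j = (\<Sum>i<d. f j i * x ^ i)" by metis
    have "e ^ t = (\<Sum>j<k. (\<Sum>i<d. f j i * x ^ i) * e ^ j)" unfolding g(2) using f by (intro sum.cong) auto
    thus ?thesis using f by blast
  qed
  hence "\<forall>t. \<exists>f. (\<forall>j<k. \<forall>i<d. f j i \<in> F) \<and> e ^ t = (\<Sum>j<k. (\<Sum>i<d. f j i * x ^ i) * e ^ j)" by blast
  then obtain f where fe: "\<forall>t. (\<forall>j<k. \<forall>i<d. f t j i \<in> F) \<and> e ^ t = (\<Sum>j<k. (\<Sum>i<d. f t j i * x ^ i) * e ^ j)"
    by (rule choice[THEN exE])
  hence f: "\<And>t j i. j < k \<Longrightarrow> i < d \<Longrightarrow> f t j i \<in> F"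
    "\<And>t. e ^ t = (\<Sum>j<k. (\<Sum>i<d. f t j i * x ^ i) * e ^ j)" by blast+
  \<comment> \<open>The equations are numbered by \<open>s = j * d + i\<close>, one for each product
    \<open>x ^ i * e ^ j\<close>.\<close>
  define N where "N = k * d"
  have "s div d < k \<and> s mod d < d" if "s < N" for s
  proof -
    have "d > 0" using that by (cases d) (auto simp: N_def)
    thus ?thesis using that by (auto simp: N_def less_mult_imp_div_less)
  qed
  then obtain c where c: "\<forall>t\<le>N. c t \<in> F" "\<exists>t\<le>N. c t \<noteq> 0"
    "\<forall>s<N. (\<Sum>t\<le>N. c t * f t (s div d) (s mod d)) = 0"
    using underdetermined_system[OF F, of N "\<lambda>t s. f t (s div d) (s mod d)"] f(1) by auto
  have c0: "(\<Sum>t\<le>N. c t * f t j i) = 0" if "j < k" "i < d" for j i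
  proof -
    have "j * d + i < Suc j * d" using that by simp
    also have "\<dots> \<le> N" unfolding N_def using that by (intro mult_le_mono1) simp
    finally have "j * d + i < N" .
    moreover have "(j * d + i) div d = j" "(j * d + i) mod d = i" using that by auto
    ultimately show ?thesis using c(3) by metis
  qed
  define p where "p = (\<Sum>t\<le>N. monom (c t) t)"
  have cp: "coeff p t = (if t \<le> N then c t else 0)" for t by (simp add: p_def coeff_sum)
  have ct: "c t * e ^ t = (\<Sum>j<k. \<Sum>i<d. c t * f t j i * (x ^ i * e ^ j))" for t
  proof -
    have "c t * e ^ t = c t * (\<Sum>j<k. (\<Sum>i<d. f t j i * x ^ i) * e ^ j)" by (rule arg_cong[OF f(2)])
    also have "\<dots> = (\<Sum>j<k. \<Sum>i<d. c t * f t j i * (x ^ i * e ^ j))"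
      by (simp add: sum_distrib_left sum_distrib_right mult.assoc)
    finally show ?thesis .
  qed
  have "poly p e = (\<Sum>t\<le>N. c t * e ^ t)" by (simp add: p_def poly_sum poly_monom)
  also have "\<dots> = (\<Sum>t\<le>N. \<Sum>j<k. \<Sum>i<d. c t * f t j i * (x ^ i * e ^ j))"
    by (intro sum.cong refl ct)
  also have "\<dots> = (\<Sum>j<k. \<Sum>i<d. \<Sum>t\<le>N. c t * f t j i * (x ^ i * e ^ j))"
    by (subst sum.swap) (intro sum.cong refl sum.swap)
  also have "\<dots> = (\<Sum>j<k. \<Sum>i<d. (\<Sum>t\<le>N. c t * f t j i) * (x ^ i * e ^ j))"
    by (intro sum.cong refl sum_distrib_right[symmetric])
  also have "\<dots> = 0" by (intro sum.neutral ballI) (simp add: c0)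
  finally have "poly p e = 0" .
  moreover have "p \<noteq> 0"
  proof -
    obtain t where "t \<le> N" "c t \<noteq> 0" using c(2) by auto
    hence "coeff p t \<noteq> 0" by (simp add: cp)
    thus ?thesis by auto
  qed
  moreover have "p \<in> polys F" using c(1) by (intro polysI) (auto simp: cp subfld_0[OF F])
  ultimately show ?thesis by (auto simp: alg_over_def)
qed

lemma alg_over_gen_fld_trans:
  assumes "finite B" "subfld F" "\<And>b. b \<in> B \<Longrightarrow> alg_over F b" "alg_over (gen_fld F B) e"
  shows "alg_over F e"
  using assms
proof (induction B arbitrary: F)
  case empty
  have "gen_fld F {} \<subseteq> F" using empty by (intro gen_fld_least) auto
  thus ?case using empty alg_over_mono by blast
next
  case (insert b B)
  have b: "alg_over F b" using insert.prems by auto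
  have "alg_over (adj F b) e"
  proof (rule insert.IH)
    show "subfld (adj F b)" by (rule subfld_adj[OF insert.prems(1) b])
    show "alg_over (adj F b) b'" if "b' \<in> B" for b'
      using alg_over_mono[OF adj_base[OF insert.prems(1)]] insert.prems(2) that by auto
    show "alg_over (gen_fld (adj F b) B) e"
      using alg_over_mono[OF gen_fld_insert[OF insert.prems(1)] insert.prems(3)] .
  qed
  thus ?case using alg_over_adj_trans[OF insert.prems(1) b] by blast
qed

text \<open>Only the finitely many coefficients of one annihilating polynomial matter, which reduces
  the claim to a finitely generated field.\<close>

theorem alg_over_trans:
  assumes F: "subfld F" and G: "\<And>x. x \<in> G \<Longrightarrow> alg_over F x" and e: "alg_over G e"
  shows "alg_over F e"
proof -
  obtain p where p: "p \<in> polys G" "p \<noteq> 0" "poly p e = 0" using e by (auto simp: alg_over_def)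
  define B where "B = coeff p ` {..degree p}"
  note H = subfld_gen_fld[of F B]
  have "p \<in> polys (gen_fld F B)"
  proof (rule polysI)
    fix i show "coeff p i \<in> gen_fld F B"
      using gen_fld_gens[of B F] subfld_0[OF H] coeff_eq_0[of p i] by (cases "i \<le> degree p") (auto simp: B_def)
  qed
  hence "alg_over (gen_fld F B) e" using p by (auto simp: alg_over_def)
  moreover have "alg_over F b" if "b \<in> B" for b using that G polysD[OF p(1)] by (auto simp: B_def)
  ultimately show ?thesis using alg_over_gen_fld_trans[of B F e] F by (auto simp: B_def)
qed

section \<open>Power series: Hensel lifting and Eisenstein polynomials\<close>

lemma fps_X_power_dvd_iff: "fps_X ^ k dvd (f :: 'a::field fps) \<longleftrightarrow> (\<forall>i<k. f $ i = 0)"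
proof
  assume "fps_X ^ k dvd f"
  then obtain g where "f = fps_X ^ k * g" by (auto elim: dvdE)
  thus "\<forall>i<k. f $ i = 0" by (simp add: fps_X_power_mult_nth)
next
  assume z: "\<forall>i<k. f $ i = 0"
  have "f = fps_X ^ k * Abs_fps (\<lambda>i. f $ (i + k))"
    by (rule fps_ext) (use z in \<open>auto simp: fps_X_power_mult_nth\<close>)
  thus "fps_X ^ k dvd f" by (metis dvd_triv_left)
qed

lemma poly_taylor2:
  fixes f :: "'a::idom poly"
  obtains g where "\<And>h. poly f (r + h) = poly f r + h * poly (pderiv f) r + h ^ 2 * poly g h"
proof -
  have "\<exists>g. \<forall>h. poly f (r + h) = poly f r + h * poly (pderiv f) r + h ^ 2 * poly g h"
  proof (induction f)
    case (pCons a f)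
    then obtain g where g: "\<And>h. poly f (r + h) = poly f r + h * poly (pderiv f) r + h ^ 2 * poly g h" by blast
    show ?case
    proof (intro exI[of _ "smult r g + [:poly (pderiv f) r:] + pCons 0 g"] allI)
      fix h
      have "poly (pCons a f) (r + h) = a + (r + h) * (poly f r + h * poly (pderiv f) r + h ^ 2 * poly g h)"
        by (simp add: g)
      thus "poly (pCons a f) (r + h) = poly (pCons a f) r + h * poly (pderiv (pCons a f)) r +
          h ^ 2 * poly (smult r g + [:poly (pderiv f) r:] + pCons 0 g) h"
        by (simp add: pderiv_pCons algebra_simps power2_eq_square)
    qed
  qed (auto intro: exI[of _ 0])
  thus thesis using that by blast
qed

lemma poly_diff_dvd: "(x - y :: 'a::comm_ring_1) dvd poly f x - poly f y"
proof (induction f)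
  case (pCons a f)
  have "poly (pCons a f) x - poly (pCons a f) y = x * (poly f x - poly f y) + (x - y) * poly f y"
    by (simp add: algebra_simps)
  thus ?case using pCons.IH by (auto intro!: dvd_add)
qed auto

text \<open>Reduction modulo the maximal ideal of the power series ring.\<close>

abbreviation red :: "'a::field fps poly \<Rightarrow> 'a poly" where
  "red \<equiv> map_poly (\<lambda>c. c $ 0)"

lemma fps_nth_0_hom: "idom_hom (\<lambda>c :: 'a::field fps. c $ 0)"
  by unfold_locales auto

lemma poly_nth_0: "poly f r $ 0 = poly (red f) (r $ 0)"
proof -
  interpret idom_hom "\<lambda>c :: 'a fps. c $ 0" by (rule fps_nth_0_hom)
  show ?thesis by simp
qed

lemma
  fixes p q :: "'a::field fps poly"
  shows red_mult: "red (p * q) = red p * red q" and red_pderiv: "red (pderiv p) = pderiv (red p)"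
    and red_pCons: "red (pCons a p) = pCons (a $ 0) (red p)"
proof -
  interpret h: idom_hom "\<lambda>c :: 'a fps. c $ 0" by (rule fps_nth_0_hom)
  interpret mp: map_poly_idom_hom "\<lambda>c :: 'a fps. c $ 0" ..
  show "red (p * q) = red p * red q" "red (pderiv p) = pderiv (red p)"
    "red (pCons a p) = pCons (a $ 0) (red p)"
    by (simp_all add: mp.hom_mult h.map_poly_pderiv h.map_poly_pCons_hom)
qed

lemma red_prod: "red (prod f S) = (\<Prod>i\<in>S. red (f i))"
  by (induction S rule: infinite_finite_induct) (simp_all add: red_mult)

lemmas red_simps = red_mult red_pderiv red_pCons red_prod

text \<open>Newton's method, one coefficient at a time: \<open>P N r\<close> says that
  \<open>r\<close> is a root modulo \<open>X^(N+1)\<close>, and \<open>Q\<close> that consecutive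
  approximations agree to that order, so that the diagonal sequence of coefficients is the
  limit.\<close>

theorem fps_hensel:
  fixes f :: "'a::field fps poly"
  assumes r0: "poly (red f) r0 = 0" "poly (pderiv (red f)) r0 \<noteq> 0"
  obtains r where "r $ 0 = r0" "poly f r = 0"
proof -
  define P where "P N r \<longleftrightarrow> r $ 0 = r0 \<and> fps_X ^ Suc N dvd poly f r" for N r
  define Q where "Q N r r' \<longleftrightarrow> fps_X ^ Suc N dvd r' - r" for N :: nat and r r' :: "'a fps"
  have d: "poly (pderiv f) r $ 0 \<noteq> 0" if "r $ 0 = r0" for r
    using r0(2) that by (simp add: poly_nth_0 red_simps)
  have "\<exists>\<rho>. \<forall>N. P N (\<rho> N) \<and> Q N (\<rho> N) (\<rho> (Suc N))"
  proof (rule dependent_nat_choice)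
    have "P 0 (fps_const r0)" 
      unfolding P_def fps_X_power_dvd_iff using r0(1) by (simp add: poly_nth_0)
    thus "\<exists>r. P 0 r" by blast
  next
    fix r N assume P: "P N r"
    then obtain u where u: "poly f r = fps_X ^ Suc N * u" by (auto simp: P_def elim: dvdE)
    obtain g where g: "\<And>h. poly f (r + h) = poly f r + h * poly (pderiv f) r + h ^ 2 * poly g h"
      using poly_taylor2[of f r] by blast
    \<comment> \<open>Solves the linear equation for the next coefficient; the quadratic Taylor term
      has order at least \<open>2 * N + 2\<close> and does not interfere.\<close>
    define a where "a = - (u $ 0) / poly (pderiv f) r $ 0"
    define h where "h = fps_X ^ Suc N * fps_const a"
    have "(u + fps_const a * poly (pderiv f) r) $ 0 = 0" using d[of r] P by (simp add: a_def P_def)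
    hence "fps_X ^ 1 dvd u + fps_const a * poly (pderiv f) r" unfolding fps_X_power_dvd_iff by auto
    hence "fps_X ^ Suc N * fps_X ^ 1 dvd fps_X ^ Suc N * (u + fps_const a * poly (pderiv f) r)"
      by (rule mult_dvd_mono[OF dvd_refl])
    moreover have "h ^ 2 * poly g h = (fps_X ^ Suc N * fps_X ^ 1) * (fps_X ^ N * (fps_const a ^ 2 * poly g h))"
    proof -
      have "h ^ 2 = fps_X ^ Suc N * fps_X ^ 1 * (fps_X ^ N * fps_const a ^ 2)"
        by (simp add: h_def power2_eq_square algebra_simps)
      thus ?thesis by (simp only: mult.assoc)
    qed
    hence "fps_X ^ Suc N * fps_X ^ 1 dvd h ^ 2 * poly g h" by (metis dvd_triv_left)
    moreover have "h * poly (pderiv f) r = fps_X ^ Suc N * (fps_const a * poly (pderiv f) r)"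
      by (simp only: h_def mult.assoc)
    hence "poly f (r + h) = fps_X ^ Suc N * (u + fps_const a * poly (pderiv f) r) + h ^ 2 * poly g h"
      unfolding g u by (simp only: distrib_left)
    ultimately have "fps_X ^ Suc N * fps_X ^ 1 dvd poly f (r + h)" by (simp only: dvd_add)
    moreover have "(r + h) $ 0 = r0" using P by (simp add: P_def h_def)
    ultimately have "P (Suc N) (r + h)" by (simp add: P_def mult.commute)
    moreover have "Q N r (r + h)" by (simp add: Q_def h_def)
    ultimately show "\<exists>r'. P (Suc N) r' \<and> Q N r r'" by blast
  qed
  then obtain \<rho> where \<rho>: "\<And>N. P N (\<rho> N)" "\<And>N. Q N (\<rho> N) (\<rho> (Suc N))" by blast
  have step: "\<rho> (Suc N) $ k = \<rho> N $ k" if "k \<le> N" for N k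
    using \<rho>(2)[of N] that by (auto simp: Q_def fps_X_power_dvd_iff simp del: power_Suc)
  have stable: "\<rho> N $ k = \<rho> k $ k" if "k \<le> N" for N k
    using that by (induction rule: dec_induct) (auto simp: step)
  define r where "r = Abs_fps (\<lambda>n. \<rho> n $ n)"
  have close: "fps_X ^ Suc N dvd r - \<rho> N" for N
    unfolding fps_X_power_dvd_iff
  proof (intro allI impI)
    fix i assume "i < Suc N"
    hence "\<rho> N $ i = \<rho> i $ i" by (intro stable) simp
    thus "(r - \<rho> N) $ i = 0" by (simp add: r_def)
  qed
  have "fps_X ^ Suc N dvd poly f r" for N
  proof -
    have "fps_X ^ Suc N dvd poly f r - poly f (\<rho> N)" using close poly_diff_dvd dvd_trans by blast
    moreover have "fps_X ^ Suc N dvd poly f (\<rho> N)" using \<rho>(1)[of N] by (simp add: P_def)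
    ultimately show ?thesis by (metis dvd_add_right_iff diff_add_cancel dvd_add)
  qed
  hence "poly f r $ N = 0" for N unfolding fps_X_power_dvd_iff by blast
  hence "poly f r = 0" by (intro fps_ext) simp
  moreover have "r $ 0 = r0" using \<rho>(1)[of 0] by (simp add: r_def P_def)
  ultimately show thesis using that by blast
qed

text \<open>Makes Gauss's lemma available for polynomials over power series, as used at the end of
  \<open>fps_eisenstein\<close>.\<close>

instance fps :: (field) semiring_gcd_mult_normalize ..

text \<open>Eisenstein's criterion at the prime \<open>X\<close>. In a factorization into
  nonconstant \<open>A\<close> and \<open>B\<close> the orders of the reductions at 0 add up to
  \<open>degree f\<close>, so both are positive; thus both constant terms are divisible by
  \<open>X\<close>, and their product has no linear coefficient. Gauss's lemma passes to the
  fraction field.\<close>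

theorem fps_eisenstein:
  fixes f :: "'a::field fps poly"
  assumes lc: "lead_coeff f = 1" and deg: "degree f > 0" and r: "red f = monom 1 (degree f)"
    and e: "coeff f 0 $ 1 \<noteq> 0"
  shows "irreducible (fract_poly f)"
proof -
  have "irreducible f"
  proof (rule Factorial_Ring.irreducibleI)
    show "f \<noteq> 0" using deg by auto
    show "\<not> f dvd 1" using dvd_imp_degree_le[of f 1] deg by auto
    fix A B assume AB: "f = A * B"
    have nz: "A \<noteq> 0" "B \<noteq> 0" using AB deg by auto
    have "lead_coeff A * lead_coeff B = 1" using lc AB by (simp add: lead_coeff_mult)
    hence u: "lead_coeff A dvd 1" "lead_coeff B dvd 1"
      using dvd_triv_left[of "lead_coeff A" "lead_coeff B"] dvd_triv_right[of "lead_coeff B" "lead_coeff A"] by simp_all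
    show "A dvd 1 \<or> B dvd 1"
    proof (rule ccontr)
      assume nu: "\<not> (A dvd 1 \<or> B dvd 1)"
      have unit: "C dvd 1" if C: "degree C = 0" "lead_coeff C dvd 1" for C :: "'a fps poly"
      proof -
        obtain c where c: "C = [:c:]" using C(1) by (metis degree_0_id)
        thus ?thesis using C(2) by (simp add: is_unit_const_poly_iff)
      qed
      have degs: "degree A > 0" "degree B > 0" using nu unit[OF _ u(1)] unit[OF _ u(2)] neq0_conv by blast+
      have "degree A + degree B = degree f" using AB nz by (simp add: degree_mult_eq)
      hence lt: "degree A < degree f" "degree B < degree f" using degs by auto
      have rAB: "red A * red B = monom 1 (degree f)" unfolding r[symmetric] by (subst AB) (simp only: red_mult)
      have rnz: "red A \<noteq> 0" "red B \<noteq> 0" using rAB by (metis mult_zero_left mult_zero_right monom_eq_0_iff one_neq_zero)+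
      have oo: "order 0 (red A) + order 0 (red B) = degree f"
        using order_mult[of "red A" "red B" 0] unfolding rAB by (simp add: order_0_monom)
      have "order 0 (red A) \<le> degree A" "order 0 (red B) \<le> degree B"
        using order_degree[OF rnz(1)] order_degree[OF rnz(2)] degree_map_poly_le order_trans by blast+
      hence "order 0 (red A) > 0" "order 0 (red B) > 0" using oo lt by auto
      hence "coeff A 0 $ 0 = 0" "coeff B 0 $ 0 = 0"
        using order_root[of "red A" 0] order_root[of "red B" 0] by (auto simp: poly_0_coeff_0 coeff_map_poly)
      moreover have "coeff f 0 $ 1 = coeff A 0 $ 0 * coeff B 0 $ 1 + coeff A 0 $ 1 * coeff B 0 $ 0"
        by (subst AB) (simp add: coeff_mult fps_mult_nth)
      ultimately show False using e by simp
    qed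
  qed
  thus ?thesis using nonconst_poly_irreducible_iff[of f] deg by simp
qed

text \<open>Hensel lifts every simple root in \<open>S\<close> of the reduction to a linear factor,
  and the remaining factor \<open>g\<close> reduces to \<open>Y^k\<close>. As the constant term of
  \<open>g\<close> vanishes at 0, the linear coefficient of that of \<open>f\<close> can only come
  from \<open>g\<close>, so \<open>g\<close> is Eisenstein.\<close>

theorem fps_factorization:
  fixes f :: "'a::field fps poly"
  assumes lc: "lead_coeff f = 1" and S: "finite S" "0 \<notin> S" and k: "k > 0"
    and r: "red f = monom 1 k * (\<Prod>e\<in>S. [:-e,1:])" and e: "coeff f 0 $ 1 \<noteq> 0"
  obtains g T where "f = g * (\<Prod>t\<in>T. [:-t,1:])" "finite T" "card T = card S" "degree g = k"
    "irreducible (fract_poly g)"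
proof -
  have "\<exists>t. t $ 0 = s \<and> poly f t = 0" if s: "s \<in> S" for s
  proof -
    have f: "red f = [:-s,1:] * (monom 1 k * (\<Prod>e\<in>S-{s}. [:-e,1:]))"
      unfolding r using s S(1) by (simp only: prod.remove[OF S(1) s] mult.left_commute)
    have "poly (red f) s = 0" unfolding f by simp
    moreover have "poly (pderiv (red f)) s \<noteq> 0"
      unfolding f poly_pderiv_linear_mult using s S by (auto simp: poly_monom poly_prod)
    ultimately obtain t where "t $ 0 = s" "poly f t = 0" by (rule fps_hensel)
    thus ?thesis by blast
  qed
  then obtain t where t: "\<And>s. s \<in> S \<Longrightarrow> t s $ 0 = s" "\<And>s. s \<in> S \<Longrightarrow> poly f (t s) = 0" by metis
  define T where "T = t ` S"
  have inj: "inj_on t S" using t(1) by (metis inj_onI)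
  have T: "finite T" "card T = card S" using S inj by (auto simp: T_def card_image)
  have "(\<Prod>t\<in>T. [:-t,1:]) dvd f" by (rule prod_linear_dvd[OF T(1)]) (use t(2) in \<open>auto simp: T_def\<close>)
  then obtain g where g: "f = (\<Prod>t\<in>T. [:-t,1:]) * g" by (rule dvdE)
  have nz: "(\<Prod>t\<in>T. [:-t,1:]) \<noteq> 0" "g \<noteq> 0" using g lc T by auto
  have lcT: "lead_coeff (\<Prod>t\<in>T. [:-t,1:]) = 1" by (simp add: lead_coeff_prod)
  have lcg: "lead_coeff g = 1" using lc lcT unfolding g by (simp add: lead_coeff_mult)
  have redT: "red (\<Prod>t\<in>T. [:-t,1:]) = (\<Prod>e\<in>S. [:-e,1:])"
    unfolding red_simps T_def using t(1) by (auto simp: prod.reindex[OF inj] red_simps intro!: prod.cong)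
  have "(\<Prod>e\<in>S. [:-e,1:]) \<noteq> 0" using S by auto
  hence redg: "red g = monom 1 k" using r redT unfolding g red_simps
    by (simp add: mult.commute)
  have deg: "degree g = k"
  proof -
    have "degree (red g) = degree g" by (rule map_poly_degree_eq) (use lcg in auto)
    thus ?thesis using redg by (simp add: degree_monom_eq)
  qed
  have "coeff g 0 $ 0 = 0" using arg_cong[OF redg, of "\<lambda>p. coeff p 0"] k by (simp add: coeff_map_poly)
  moreover have "coeff f 0 = coeff (\<Prod>t\<in>T. [:-t,1:]) 0 * coeff g 0" unfolding g by (simp add: coeff_mult)
  ultimately have "coeff g 0 $ 1 \<noteq> 0" using e by (auto simp: fps_mult_nth)
  hence "irreducible (fract_poly g)" using fps_eisenstein[of g] lcg deg k redg by auto
  thus thesis using that[of g T] g T deg by (simp add: mult.commute)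
qed

section \<open>Places of a rational function field\<close>

lemma subfld_range: "field_hom h \<Longrightarrow> subfld (range h)"
proof -
  assume "field_hom h"
  then interpret field_hom h .
  show ?thesis
  proof (rule subfldI)
    show "1 \<in> range h" by (metis hom_one rangeI)
    fix x y assume "x \<in> range h" "y \<in> range h"
    then obtain a b where ab: "x = h a" "y = h b" by blast
    show "x - y \<in> range h" unfolding ab hom_minus[symmetric] by (rule rangeI)
    show "x * y \<in> range h" unfolding ab hom_mult[symmetric] by (rule rangeI)
  next
    fix x assume "x \<in> range h"
    then obtain a where a: "x = h a" by blast
    show "inverse x \<in> range h" unfolding a hom_inverse[symmetric] by (rule rangeI)
  qed
qed

lemma polys_range: "field_hom h \<Longrightarrow> p \<in> polys (range h) \<longleftrightarrow> (\<exists>p'. p = map_poly h p')"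
proof -
  assume "field_hom h"
  then interpret field_hom h .
  show ?thesis
  proof
    assume p: "p \<in> polys (range h)"
    have "p = map_poly h (map_poly (inv_into UNIV h) p)"
    proof (rule poly_eqI)
      fix i
      have "inv_into UNIV h 0 = 0" using inv_f_f[of 0] by simp
      thus "coeff p i = coeff (map_poly h (map_poly (inv_into UNIV h) p)) i"
        using polysD[OF p, of i] by (auto simp: coeff_map_poly f_inv_into_f)
    qed
    thus "\<exists>p'. p = map_poly h p'" by blast
  qed (auto simp: polys_def)
qed

lemma to_ac_hom: "field_hom (to_ac :: 'a::field \<Rightarrow> 'a alg_closure)"
  by unfold_locales auto

lemma polys_range_iff: "q \<in> polys (range (to_ac :: 'a::field \<Rightarrow> 'a alg_closure)) \<longleftrightarrow> (\<exists>q'. q = map_poly to_ac q')"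
  by (rule polys_range[OF to_ac_hom])

lemma alg_closure_alg_over: "alg_over (range to_ac) (x :: 'a::field alg_closure)"
proof -
  interpret field_hom "to_ac :: 'a \<Rightarrow> 'a alg_closure" by (rule to_ac_hom)
  obtain p :: "'a poly" where "p \<noteq> 0" "poly (map_poly to_ac p) x = 0" by (rule alg_closure_algebraic)
  thus ?thesis unfolding alg_over_def polys_range[OF to_ac_hom] by (intro bexI[of _ "map_poly to_ac p"]) (auto simp: polys_def)
qed

lemma fract_hom_extend:
  fixes h :: "'b::idom \<Rightarrow> 'f::field"
  assumes h: "idom_hom h" and inj: "\<And>b. h b = 0 \<Longrightarrow> b = 0"
  obtains h' where "field_hom h'" "\<And>b. h' (to_fract b) = h b"
proof -
  interpret idom_hom h by fact
  define h' where "h' x = (SOME y. \<exists>a b. b \<noteq> 0 \<and> x = to_fract a / to_fract b \<and> y = h a / h b)" for x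
  have eq: "h' (to_fract a / to_fract b) = h a / h b" if b: "b \<noteq> 0" for a b
    unfolding h'_def
  proof (rule some_equality)
    show "\<exists>a' b'. b' \<noteq> 0 \<and> to_fract a / to_fract b = to_fract a' / to_fract b' \<and> h a / h b = h a' / h b'"
      by (intro exI[of _ a] exI[of _ b] conjI b refl)
    fix y assume "\<exists>a' b'. b' \<noteq> 0 \<and> to_fract a / to_fract b = to_fract a' / to_fract b' \<and> y = h a' / h b'"
    then obtain a' b' where a': "b' \<noteq> 0" "to_fract a / to_fract b = to_fract a' / to_fract b'" "y = h a' / h b'" by (elim exE conjE) (rule that)
    have nf: "to_fract b \<noteq> 0" "to_fract b' \<noteq> 0" using b a'(1) by (simp_all only: to_fract_eq_0_iff not_False_eq_True)
    have "to_fract (a * b') = to_fract (a' * b)"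
      using a'(2) unfolding frac_eq_eq[OF nf] to_fract_mult .
    hence "a * b' = a' * b" by (simp only: to_fract_eq_iff)
    hence "h a * h b' = h a' * h b" by (simp only: hom_mult[symmetric])
    moreover have "h b \<noteq> 0" "h b' \<noteq> 0" using inj[of b] inj[of b'] a'(1) b by blast+
    ultimately show "y = h a / h b" unfolding a'(3) by (subst frac_eq_eq) simp_all
  qed
  have rep: "\<exists>a b. b \<noteq> 0 \<and> x = to_fract a / to_fract b" for x :: "'b fract"
  proof (cases x)
    case (Fract a b)
    thus ?thesis by (intro exI[of _ a] exI[of _ b]) (simp add: Fract_conv_to_fract)
  qed
  have h1: "h' (to_fract b) = h b" for b using eq[of 1 b] by simp
  show thesis
  proof
    show "h' (to_fract b) = h b" for b by (rule h1)
    show "field_hom h'"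
    proof
      show "h' 0 = 0" using h1[of 0] by simp
      show "h' 1 = 1" using h1[of 1] by simp
      fix x y :: "'b fract"
      obtain a b where ab: "b \<noteq> 0" "x = to_fract a / to_fract b" using rep[of x] by (elim exE conjE) (rule that)
      obtain c d where cd: "d \<noteq> 0" "y = to_fract c / to_fract d" using rep[of y] by (elim exE conjE) (rule that)
      have nz: "h b \<noteq> 0" "h d \<noteq> 0" using inj[of b] inj[of d] ab(1) cd(1) by blast+
      have hx: "h' x = h a / h b" and hy: "h' y = h c / h d" unfolding ab(2) cd(2) by (rule eq[OF ab(1)], rule eq[OF cd(1)])
      have bd: "b * d \<noteq> 0" using ab(1) cd(1) by simp
      have nf: "to_fract b \<noteq> 0" "to_fract d \<noteq> 0" using ab(1) cd(1) by simp_all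
      have "x + y = to_fract (a * d + c * b) / to_fract (b * d)"
        unfolding ab(2) cd(2) add_frac_eq[OF nf] by (simp only: to_fract_add to_fract_mult)
      thus "h' (x + y) = h' x + h' y" by (simp only: hx hy eq[OF bd] add_frac_eq[OF nz] hom_add hom_mult)
      have "x * y = to_fract (a * c) / to_fract (b * d)"
        unfolding ab(2) cd(2) by (simp only: times_divide_times_eq to_fract_mult)
      thus "h' (x * y) = h' x * h' y" by (simp only: hx hy eq[OF bd] times_divide_times_eq hom_mult)
    qed
  qed
qed

lemma alg_closure_fract_hom_extend:
  fixes h :: "'b::idom \<Rightarrow> 'f::alg_closed_field"
  assumes h: "idom_hom h" and inj: "\<And>b. h b = 0 \<Longrightarrow> b = 0"
  obtains \<psi> :: "'b fract alg_closure \<Rightarrow> 'f" where "field_hom \<psi>" "\<And>b. \<psi> (to_ac (to_fract b)) = h b"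
proof -
  obtain h' where h': "field_hom h'" "\<And>b. h' (to_fract b) = h b" using fract_hom_extend[OF h inj] by blast
  interpret h': field_hom h' by fact
  have "hom_on (range to_ac) (\<lambda>x. h' (of_ac x))"
    unfolding hom_on_def by (auto simp: h'.hom_minus h'.hom_mult simp flip: to_ac_diff to_ac_mult)
  then obtain \<psi> where "field_hom \<psi>" "\<And>a. a \<in> range to_ac \<Longrightarrow> \<psi> a = h' (of_ac a)"
    by (rule hom_extend[OF subfld_range[OF to_ac_hom] _ alg_closure_alg_over]) (rule that)
  thus thesis using that[of \<psi>] h'(2) by simp
qed

text \<open>\<open>p\<close> already splits into linear factors over the algebraically closed
  source, so its image has no roots outside the range.\<close>

lemma hom_range_roots:
  fixes \<Psi> :: "'e::alg_closed_field \<Rightarrow> 'f::field"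
  assumes "field_hom \<Psi>" and p: "p \<noteq> 0" "poly (map_poly \<Psi> p) y = 0"
  obtains x where "poly p x = 0" "y = \<Psi> x"
proof -
  interpret field_hom \<Psi> by fact
  interpret mp: map_poly_idom_hom \<Psi> ..
  obtain A where A: "p = smult (lead_coeff p) (\<Prod>x\<in>#A. [:-x,1:])" using alg_closed_imp_factorization[OF p(1)] by blast
  have m: "map_poly \<Psi> (\<Prod>x\<in>#A. [:-x,1:]) = (\<Prod>x\<in>#A. [:- \<Psi> x,1:])"
    by (induction A) (simp_all add: mp.hom_mult map_poly_pCons_hom hom_uminus del: mult_pCons_left)
  have "lead_coeff p \<noteq> 0" using p by simp
  hence "poly (\<Prod>x\<in>#A. [:- \<Psi> x,1:]) y = 0" using p(2) unfolding A[THEN arg_cong, of "map_poly \<Psi>"] map_poly_hom_smult m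
    by simp
  hence "\<exists>x\<in>#A. y = \<Psi> x" by (induction A) auto
  then obtain x where x: "x \<in># A" "y = \<Psi> x" by blast
  have "poly (\<Prod>x\<in>#A. [:-x,1:]) x = 0" using x(1) by (induction A) auto
  hence "poly p x = 0" by (subst A) simp
  thus thesis using x that by blast
qed

lemma minimal_polynomial_type:
  fixes h :: "'f::field \<Rightarrow> 'e::field"
  assumes h: "field_hom h" and x: "alg_over (range h) x"
  obtains p where "irreducible p" "lead_coeff p = 1" "poly (map_poly h p) x = 0"
    "\<And>g. poly (map_poly h g) x = 0 \<Longrightarrow> p dvd g"
proof -
  interpret field_hom h by fact
  interpret mp: map_poly_inj_idom_hom h ..
  obtain m where m: "m \<in> polys (range h)" "lead_coeff m = 1" "poly m x = 0" "degree m > 0"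
    "\<And>g. g \<in> polys (range h) \<Longrightarrow> poly g x = 0 \<Longrightarrow> \<exists>s\<in>polys (range h). g = m * s"
    using minimal_polynomial[OF subfld_range[OF h] x] by metis
  obtain p where p: "m = map_poly h p" using m(1) polys_range[OF h] by blast
  have dvd: "p dvd g" if g: "poly (map_poly h g) x = 0" for g
  proof -
    obtain s where s: "s \<in> polys (range h)" "map_poly h g = m * s"
      using m(5)[of "map_poly h g"] g polys_range[OF h] by blast
    obtain s' where s': "s = map_poly h s'" using s(1) polys_range[OF h] by blast
    have "map_poly h g = map_poly h (p * s')" using s(2) unfolding p s' by (simp only: mp.hom_mult)
    hence "g = p * s'" by simp
    thus ?thesis by simp
  qed
  have p0: "p \<noteq> 0" using m(4) p by auto
  have dp: "degree p > 0" using m(4) p by simp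
  show thesis
  proof (rule that[OF _ _ _ dvd])
    show "poly (map_poly h p) x = 0" using m(3) p by simp
    have "h (lead_coeff p) = 1" using m(2) unfolding p by simp
    thus "lead_coeff p = 1" by simp
    show "irreducible p"
    proof (rule Factorial_Ring.irreducibleI)
      show "p \<noteq> 0" by fact
      show "\<not> p dvd 1" using dvd_imp_degree_le[of p 1] dp by auto
      fix A B assume AB: "p = A * B"
      have nz: "A \<noteq> 0" "B \<noteq> 0" using AB p0 by auto
      have deg: "degree p = degree A + degree B" unfolding AB using nz by (rule degree_mult_eq)
      have "poly (map_poly h A) x * poly (map_poly h B) x = 0" using m(3) unfolding p AB mp.hom_mult by simp
      hence "p dvd A \<or> p dvd B" using dvd by auto
      hence "degree A = 0 \<or> degree B = 0" using dvd_imp_degree_le[of p A] dvd_imp_degree_le[of p B] nz deg by auto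
      thus "A dvd 1 \<or> B dvd 1" using nz by (metis is_unit_triv degree_0_id pCons_0_0)
    qed
  qed
qed

text \<open>An irreducible polynomial is associated to the minimal polynomial of each of its roots,
  so no polynomial over the base field can tell two roots apart.\<close>

lemma irreducible_conjugate:
  fixes h :: "'f::field \<Rightarrow> 'e::field"
  assumes h: "field_hom h" and g: "irreducible g" and x: "poly (map_poly h g) x = 0" and y: "poly (map_poly h g) y = 0"
    and p: "p \<in> polys (range h)" "poly p x = 0"
  shows "poly p y = 0"
proof -
  interpret field_hom h by fact
  interpret mp: map_poly_inj_idom_hom h ..
  have "g \<noteq> 0" using g by auto
  hence "alg_over (range h) x" using x polys_range[OF h] unfolding alg_over_def
    by (intro bexI[of _ "map_poly h g"]) auto
  then obtain m where m: "irreducible m" "poly (map_poly h m) x = 0" "\<And>f. poly (map_poly h f) x = 0 \<Longrightarrow> m dvd f"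
    using minimal_polynomial_type[OF h] by metis
  have "\<not> m dvd 1" by (rule Factorial_Ring.irreducible_not_unit[OF m(1)])
  hence "g dvd m" using Factorial_Ring.irreducibleD'[OF g m(3)[OF x]] by blast
  moreover obtain p' where p': "p = map_poly h p'" using p(1) polys_range[OF h] by blast
  moreover have "m dvd p'" using m(3) p(2) p' by blast
  ultimately have "map_poly h g dvd p" using mp.hom_dvd[of g p'] dvd_trans by blast
  thus "poly p y = 0" using y by (auto elim!: dvdE)
qed

text \<open>A polynomial annihilating \<open>y\<close> confines the question to a finite root set,
  which an injective map into itself exhausts.\<close>

lemma homs_over_surj:
  assumes s: "\<sigma> \<in> homs_over F" and alg: "\<And>x. alg_over F x"
  shows "bij \<sigma>" and "inv_into UNIV \<sigma> \<in> homs_over F"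
proof -
  interpret field_hom \<sigma> using s by (simp add: homs_over_def)
  have "y \<in> range \<sigma>" for y
  proof -
    obtain p where p: "p \<in> polys F" "p \<noteq> 0" "poly p y = 0" using alg[of y] by (auto simp: alg_over_def)
    have "\<sigma> ` {x. poly p x = 0} \<subseteq> {x. poly p x = 0}" using homs_over_root[OF s p(1)] by auto
    moreover have "card (\<sigma> ` {x. poly p x = 0}) = card {x. poly p x = 0}" by (rule card_image) (auto simp: inj_on_def)
    ultimately have "\<sigma> ` {x. poly p x = 0} = {x. poly p x = 0}"
      using poly_roots_finite[OF p(2)] by (metis card_subset_eq)
    thus ?thesis using p(3) by blast
  qed
  thus b: "bij \<sigma>" unfolding bij_def by (auto simp: inj_def)
  have i: "\<sigma> (inv_into UNIV \<sigma> x) = x" for x using b by (simp add: bij_is_surj surj_f_inv_f)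
  have "field_hom (inv_into UNIV \<sigma>)"
  proof
    show "inv_into UNIV \<sigma> 0 = 0" "inv_into UNIV \<sigma> 1 = 1" using inv_f_f[of 0] inv_f_f[of 1] by simp_all
    show "inv_into UNIV \<sigma> (x + y) = inv_into UNIV \<sigma> x + inv_into UNIV \<sigma> y" "inv_into UNIV \<sigma> (x * y) = inv_into UNIV \<sigma> x * inv_into UNIV \<sigma> y" for x y
      using inv_f_f[of "inv_into UNIV \<sigma> x + inv_into UNIV \<sigma> y"] inv_f_f[of "inv_into UNIV \<sigma> x * inv_into UNIV \<sigma> y"] by (simp_all add: hom_add hom_mult i)
  qed
  moreover have "inv_into UNIV \<sigma> a = a" if "a \<in> F" for a using s that inv_f_f[of a] by (auto simp: homs_over_def)
  ultimately show "inv_into UNIV \<sigma> \<in> homs_over F" by (auto simp: homs_over_def)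
qed

lemma homs_over_comp: "\<sigma> \<in> homs_over F \<Longrightarrow> \<tau> \<in> homs_over F \<Longrightarrow> \<sigma> \<circ> \<tau> \<in> homs_over F"
proof -
  assume a: "\<sigma> \<in> homs_over F" "\<tau> \<in> homs_over F"
  interpret s: field_hom \<sigma> using a by (simp add: homs_over_def)
  interpret t: field_hom \<tau> using a by (simp add: homs_over_def)
  have "field_hom (\<sigma> \<circ> \<tau>)" by unfold_locales (auto simp: s.hom_add s.hom_mult t.hom_add t.hom_mult)
  thus ?thesis using a by (auto simp: homs_over_def)
qed

text \<open>The Taylor expansion of \<open>p\<close> at \<open>c\<close>, a power series in the
  local parameter \<open>X - c\<close>.\<close>

definition expand :: "'w::field \<Rightarrow> 'w poly \<Rightarrow> 'w fps" where
  "expand c p = fps_of_poly (pcompose p [:c,1:])"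

lemma expand_hom: "idom_hom (expand c)"
  by unfold_locales (auto simp: expand_def pcompose_add pcompose_mult fps_of_poly_add fps_of_poly_mult pcompose_1)

lemma expand_eq_0: "expand c p = 0 \<Longrightarrow> p = 0"
proof -
  assume "expand c p = 0"
  hence "pcompose p [:c,1:] = 0" unfolding expand_def by (metis fps_of_poly_0 fps_of_poly_eq_iff)
  thus "p = 0" by (rule pcompose_eq_0) simp
qed

lemma expand_nth_0: "expand c p $ 0 = poly p c"
  by (simp add: expand_def poly_0_coeff_0[symmetric] poly_pcompose)

lemma expand_nth_1: "expand c p $ 1 = poly (pderiv p) c"
proof -
  have "expand c p $ 1 = poly (pderiv (pcompose p [:c,1:])) 0"
    by (simp add: expand_def poly_0_coeff_0 coeff_pderiv)
  thus ?thesis by (simp add: pderiv_pcompose poly_pcompose pderiv_pCons)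
qed

text \<open>For \<open>'b = 'w poly\<close> this embeds the polynomial ring in the algebraic closure
  of the rational function field, where the roots of \<open>f\<close> live.\<close>

abbreviation incl :: "'b::idom \<Rightarrow> 'b fract alg_closure" where
  "incl b \<equiv> to_ac (to_fract b)"

lemma incl_hom: "idom_hom (incl :: 'b::idom \<Rightarrow> _)"
  by unfold_locales auto

text \<open>Extends the expansion at \<open>c\<close> to the algebraic closures of the rational
  functions and of the Laurent series. Such an embedding amounts to a place of the algebraic closure
  above the point \<open>c\<close>.\<close>

lemma place_hom:
  fixes c :: "'w::field"
  obtains \<Psi> :: "'w poly fract alg_closure \<Rightarrow> 'w fps fract alg_closure"
  where "field_hom \<Psi>" "\<And>p. \<Psi> (incl p) = incl (expand c p)"
proof -
  interpret e: idom_hom "expand c" by (rule expand_hom)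
  show thesis
  proof (rule alg_closure_fract_hom_extend[of "\<lambda>p. incl (expand c p)"])
    show "idom_hom (\<lambda>p. incl (expand c p))" by unfold_locales (auto simp: e.hom_add e.hom_mult)
    show "p = 0" if "incl (expand c p) = 0" for p using that expand_eq_0[of c p] by simp
    fix \<psi> :: "'w poly fract alg_closure \<Rightarrow> 'w fps fract alg_closure"
    assume "field_hom \<psi>" "\<And>p. \<psi> (incl p) = incl (expand c p)"
    thus thesis by (rule that)
  qed
qed

lemma to_ac_fractE:
  fixes x :: "'b::idom fract"
  obtains a b where "b \<noteq> 0" "to_ac x = incl a / incl b"
  by (cases x) (auto simp: Fract_conv_to_fract)

text \<open>Over the Laurent series at \<open>c\<close> the polynomial is an irreducible
  \<open>g\<close> of degree \<open>k\<close> times linear factors. An endomorphism there moving one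
  root of \<open>g\<close> to another fixes the roots of the linear factors and, by normality,
  preserves the range of \<open>\<Psi>\<close>; pulled back along \<open>\<Psi>\<close> it is the
  required \<open>\<sigma>\<close>, classically an element of the decomposition group.\<close>

theorem place_transitive:
  fixes f :: "'w::field poly poly" and c :: 'w
  defines "R \<equiv> {x. poly (map_poly incl f) x = 0}"
  assumes lc: "lead_coeff f = 1" and R: "card R = degree f"
    and S: "finite S" "0 \<notin> S" "card S + k = degree f" "k > 0"
    and fc: "map_poly (\<lambda>p. poly p c) f = monom 1 k * (\<Prod>e\<in>S. [:-e,1:])"
    and e: "poly (pderiv (coeff f 0)) c \<noteq> 0"
  obtains A where "A \<subseteq> R" "card A = k"
    "\<And>x y. x \<in> A \<Longrightarrow> y \<in> A \<Longrightarrow> \<exists>\<sigma>\<in>homs_over (range to_ac). \<sigma> x = y \<and> (\<forall>z\<in>R-A. \<sigma> z = z)"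
proof -
  obtain \<Psi> :: "'w poly fract alg_closure \<Rightarrow> 'w fps fract alg_closure"
    where P: "field_hom \<Psi>" "\<And>p. \<Psi> (incl p) = incl (expand c p)" using place_hom[of c] by blast
  interpret \<Psi>: field_hom \<Psi> by fact
  interpret e: idom_hom "expand c" by (rule expand_hom)
  interpret i: idom_hom "incl :: 'w fps \<Rightarrow> _" by (rule incl_hom)
  interpret mi: map_poly_idom_hom "incl :: 'w fps \<Rightarrow> _" ..
  define f' where "f' = map_poly (expand c) f"
  have deg: "degree f' = degree f" unfolding f'_def by (rule degree_map_poly) (auto dest: expand_eq_0)
  have "coeff f' (degree f) = 1" using lc by (simp add: f'_def)
  hence lc': "lead_coeff f' = 1" using deg by simp
  have red': "red f' = monom 1 k * (\<Prod>e\<in>S. [:-e,1:])"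
    unfolding f'_def fc[symmetric] by (rule poly_eqI) (simp add: coeff_map_poly expand_nth_0)
  have "coeff f' 0 $ 1 \<noteq> 0" unfolding f'_def using e expand_nth_1[of c "coeff f 0"] by (simp add: coeff_map_poly)
  from fps_factorization[OF lc' S(1,2,4) red' this] obtain g T where
    gT: "f' = g * (\<Prod>t\<in>T. [:-t,1:])" "finite T" "card T = card S" "degree g = k" "irreducible (fract_poly g)"
    by blast
  define R' where "R' = {x. poly (map_poly incl f') x = 0}"
  have f'0: "map_poly incl f' \<noteq> 0"
  proof
    assume "map_poly incl f' = 0"
    hence "coeff (map_poly incl f') (degree f') = 0" by simp
    thus False using lc' by simp
  qed
  have mapf: "map_poly \<Psi> (map_poly incl f) = map_poly incl f'"
    by (rule poly_eqI) (simp add: f'_def coeff_map_poly P)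
  have "\<Psi> x \<in> R'" if "x \<in> R" for x
    using that unfolding R_def R'_def mem_Collect_eq mapf[symmetric] by simp
  hence sub: "\<Psi> ` R \<subseteq> R'" by auto
  have gr: "map_poly incl g = map_poly to_ac (fract_poly g)"
    by (simp add: map_poly_map_poly o_def)
  have R'g: "poly (map_poly incl g) y = 0 \<or> y \<in> incl ` T" if "y \<in> R'" for y
  proof -
    have "map_poly incl (\<Prod>t\<in>T. [:-t,1:]) = (\<Prod>t\<in>T. [:-incl t,1:])"
      by (simp add: mi.hom_prod map_poly_pCons_0)
    hence "map_poly incl f' = map_poly incl g * (\<Prod>t\<in>T. [:-incl t,1:])" unfolding gT(1) by (simp add: mi.hom_mult)
    thus ?thesis using that gT(2) by (auto simp: R'_def poly_prod)
  qed
  \<comment> \<open>\<open>A\<close> consists of the roots whose images are roots of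
    \<open>g\<close>. At most \<open>k\<close> roots go there and at most
    \<open>degree f - k\<close> go to \<open>T\<close>; since \<open>card R = degree f\<close>, both
    bounds are attained.\<close>
  define A where "A = {x\<in>R. poly (map_poly incl g) (\<Psi> x) = 0}"
  have finR: "finite R" using R S by (metis card.infinite add_is_0 not_gr_zero)
  have "card (R - A) \<le> card T"
  proof -
    have "\<Psi> ` (R - A) \<subseteq> incl ` T" using sub R'g by (auto simp: A_def)
    hence "card (\<Psi> ` (R - A)) \<le> card (incl ` T)" using gT(2) by (intro card_mono) auto
    moreover have "card (\<Psi> ` (R - A)) = card (R - A)" by (rule card_image) (auto simp: inj_on_def)
    ultimately show ?thesis using card_image_le[OF gT(2), of incl] by linarith
  qed
  moreover have "card A \<le> k"
  proof -
    have g0: "map_poly incl g \<noteq> 0" unfolding gr using gT(5) by auto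
    have "\<Psi> ` A \<subseteq> {y. poly (map_poly incl g) y = 0}" by (auto simp: A_def)
    hence "card (\<Psi> ` A) \<le> card {y. poly (map_poly incl g) y = 0}" by (intro card_mono poly_roots_finite g0)
    also have "\<dots> \<le> degree (map_poly incl g)" by (rule card_poly_roots_bound[OF g0])
    also have "\<dots> \<le> k" using degree_map_poly_le[of incl g] gT(4) by simp
    also have "card (\<Psi> ` A) = card A" by (rule card_image) (auto simp: inj_on_def)
    finally show ?thesis .
  qed
  moreover have "card R = card A + card (R - A)"
    using finR card_Diff_subset[of A R] card_mono[of R A] finite_subset[of A R] by (auto simp: A_def)
  ultimately have cardA: "card A = k" using R S gT(3) by linarith
  have trans: "\<exists>\<sigma>\<in>homs_over (range to_ac). \<sigma> x = y \<and> (\<forall>z\<in>R-A. \<sigma> z = z)" if xy: "x \<in> A" "y \<in> A" for x y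
  proof -
    obtain \<eta> where eta: "\<eta> \<in> homs_over (range to_ac)" "\<eta> (\<Psi> x) = \<Psi> y"
    proof (rule conjugate_hom[OF subfld_range[OF to_ac_hom] alg_closure_alg_over, of "\<Psi> x" "\<Psi> y"])
      show "poly p (\<Psi> y) = 0" if "p \<in> polys (range to_ac)" "poly p (\<Psi> x) = 0" for p
        using irreducible_conjugate[OF to_ac_hom gT(5) _ _ that] xy by (auto simp: A_def gr)
    qed
    interpret \<eta>: field_hom \<eta> using eta by (simp add: homs_over_def)
    have fixi: "\<eta> (incl u) = incl u" for u using eta by (auto simp: homs_over_def)
    have fixb: "\<eta> (\<Psi> (to_ac u)) = \<Psi> (to_ac u)" for u
    proof -
      obtain a b where "b \<noteq> 0" "to_ac u = incl a / incl b" by (rule to_ac_fractE)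
      thus ?thesis by (simp add: \<Psi>.hom_div \<eta>.hom_div P fixi)
    qed
    \<comment> \<open>The element \<open>u\<close> is algebraic over the rational functions, whose
      image is fixed by \<open>\<eta>\<close>; so \<open>\<eta> (\<Psi> u)\<close> is a root of the
      same transported polynomial, and all roots of that come from the source.\<close>
    have "\<exists>v. \<Psi> v = \<eta> (\<Psi> u)" for u
    proof -
      obtain p :: "'w poly fract poly" where p: "p \<noteq> 0" "poly (map_poly to_ac p) u = 0" by (rule alg_closure_algebraic)
      have 1: "map_poly \<Psi> (map_poly to_ac p) = map_poly \<eta> (map_poly \<Psi> (map_poly to_ac p))"
        by (rule poly_eqI) (simp add: coeff_map_poly fixb)
      have "poly (map_poly \<Psi> (map_poly to_ac p)) (\<eta> (\<Psi> u)) = \<eta> (\<Psi> (poly (map_poly to_ac p) u))"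
        by (subst 1) simp
      hence "poly (map_poly \<Psi> (map_poly to_ac p)) (\<eta> (\<Psi> u)) = 0" using p(2) by simp
      moreover have "map_poly to_ac p \<noteq> 0" using p(1) by (metis map_poly_eq_0_iff to_ac_0 to_ac_eq_0_iff)
      ultimately show ?thesis using hom_range_roots[OF P(1)] by metis
    qed
    then obtain \<sigma> where s: "\<And>u. \<Psi> (\<sigma> u) = \<eta> (\<Psi> u)" by metis
    have "field_hom \<sigma>"
    proof
      show "\<sigma> 0 = 0" using s[of 0] by simp
      show "\<sigma> 1 = 1" using s[of 1] by simp
      show "\<sigma> (u + v) = \<sigma> u + \<sigma> v" for u v
        using s[of "u + v"] s[of u] s[of v] by (metis \<Psi>.hom_add \<eta>.hom_add \<Psi>.eq_iff)
      show "\<sigma> (u * v) = \<sigma> u * \<sigma> v" for u v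
        using s[of "u * v"] s[of u] s[of v] by (metis \<Psi>.hom_mult \<eta>.hom_mult \<Psi>.eq_iff)
    qed
    moreover have "\<sigma> (to_ac u) = to_ac u" for u using s[of "to_ac u"] fixb[of u] by simp
    ultimately have "\<sigma> \<in> homs_over (range to_ac)" by (auto simp: homs_over_def)
    moreover have "\<sigma> x = y" using s[of x] eta(2) by simp
    moreover have "\<sigma> z = z" if "z \<in> R - A" for z
    proof -
      have "\<Psi> z \<in> incl ` T" using that sub R'g by (auto simp: A_def)
      hence "\<eta> (\<Psi> z) = \<Psi> z" using fixi by auto
      thus ?thesis using s[of z] by simp
    qed
    ultimately show ?thesis by blast
  qed
  show thesis by (rule that[of A]) (use cardA trans in \<open>auto simp: A_def\<close>)
qed

section \<open>Generating the symmetric group\<close>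

text \<open>\<open>A n\<close> is all of \<open>R\<close> and gives transitivity;
  \<open>A (n - 1)\<close> omits one point \<open>p\<close>, whose stabilizer is transitive on the
  rest, so the action is doubly transitive; on \<open>A 2\<close> there is a transposition.
  Conjugation then yields all transpositions, and these generate the permutations of
  \<open>R\<close>.\<close>

theorem symmetric_action:
  assumes alg: "\<And>x. alg_over F x" and R: "finite R" "card R = n"
    and A: "\<And>k. k \<in> {1..n} \<Longrightarrow> A k \<subseteq> R \<and> card (A k) = k"
    and tr: "\<And>k x y. k \<in> {1..n} \<Longrightarrow> x \<in> A k \<Longrightarrow> y \<in> A k \<Longrightarrow>
      \<exists>\<sigma>\<in>homs_over F. \<sigma> x = y \<and> (\<forall>z\<in>R - A k. \<sigma> z = z)"
    and stab: "\<And>\<sigma> x. \<sigma> \<in> homs_over F \<Longrightarrow> x \<in> R \<Longrightarrow> \<sigma> x \<in> R"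
    and \<pi>: "\<pi> permutes R"
  shows "\<exists>\<sigma>\<in>homs_over F. \<forall>x\<in>R. \<sigma> x = \<pi> x"
proof -
  have idh: "id \<in> homs_over F" by (auto simp: homs_over_def id_def simp flip: hom_on_UNIV) (auto simp: hom_on_def)
  have inj: "\<sigma> x = \<sigma> y \<longleftrightarrow> x = y" if "\<sigma> \<in> homs_over F" for \<sigma> x y
    using that field_hom_inj by (auto simp: homs_over_def)
  have hinv: "inv_into UNIV \<sigma> \<in> homs_over F" "\<sigma> (inv_into UNIV \<sigma> x) = x" "inv_into UNIV \<sigma> (\<sigma> x) = x" if "\<sigma> \<in> homs_over F" for \<sigma> x
    using homs_over_surj[OF that alg] by (auto simp: bij_def surj_f_inv_f)
  have swp: "\<exists>\<sigma>\<in>homs_over F. \<forall>x\<in>R. \<sigma> x = Transposition.transpose a b x" if ab: "a \<in> R" "b \<in> R" for a b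
  proof (cases "a = b")
    case True
    thus ?thesis using idh by (intro bexI[of _ id]) auto
  next
    case False
    have "card {a, b} \<le> card R" using ab by (intro card_mono R) auto
    hence n: "n \<ge> 2" using False R by simp
    have trR: "\<exists>\<sigma>\<in>homs_over F. \<sigma> x = y" if "x \<in> R" "y \<in> R" for x y
    proof -
      have "A n = R" using A[of n] n R by (metis card_subset_eq atLeastAtMost_iff le_refl one_le_numeral order_trans)
      thus ?thesis using tr[of n x y] that n by auto
    qed
    have A1: "A (n - 1) \<subseteq> R" "card (A (n - 1)) = n - 1" using A[of "n - 1"] n by auto
    have "card (R - A (n - 1)) = 1" using A1 R n finite_subset[OF A1(1) R(1)] by (subst card_Diff_subset) auto
    then obtain p where p: "R - A (n - 1) = {p}" by (auto simp: card_Suc_eq numeral_eq_Suc elim: card_1_singletonE)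
    have A2: "A 2 \<subseteq> R" "card (A 2) = 2" using A[of 2] n by auto
    then obtain x y where xy: "A 2 = {x, y}" "x \<noteq> y" by (auto simp: card_2_iff)
    obtain \<tau> where t: "\<tau> \<in> homs_over F" "\<tau> x = y" "\<forall>z\<in>R - {x, y}. \<tau> z = z" using tr[of 2 x y] n xy by auto
    have ty: "\<tau> y = x"
    proof -
      have "\<tau> y \<in> R" using stab[OF t(1)] xy A2 by auto
      moreover have "\<tau> y \<noteq> y" using inj[OF t(1), of x y] t(2) xy by auto
      moreover have "\<tau> y = z \<Longrightarrow> z \<in> R - {x,y} \<Longrightarrow> False" for z using t(3) inj[OF t(1), of y z] by auto
      ultimately show ?thesis by auto
    qed
    obtain g1 where g1: "g1 \<in> homs_over F" "g1 x = p" using trR[of x p] xy A2 p by auto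
    obtain g2 where g2: "g2 \<in> homs_over F" "g2 a = p" using trR[of a p] ab p by auto
    have g12: "g1 y \<in> A (n - 1)" "g2 b \<in> A (n - 1)"
    proof -
      have "g1 y \<noteq> p" using inj[OF g1(1), of x y] g1 xy by auto
      moreover have "g1 y \<in> R" using stab[OF g1(1)] xy A2 by auto
      ultimately show "g1 y \<in> A (n - 1)" using p by blast
      have "g2 b \<noteq> p" using inj[OF g2(1), of a b] g2 False by auto
      moreover have "g2 b \<in> R" using stab[OF g2(1)] ab by auto
      ultimately show "g2 b \<in> A (n - 1)" using p by blast
    qed
    obtain h where h: "h \<in> homs_over F" "h (g1 y) = g2 b" "h p = p"
    proof -
      have "n - 1 \<in> {1..n}" using n by auto
      from tr[OF this g12] show ?thesis using that p by auto
    qed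
    \<comment> \<open>\<open>g1\<close> and \<open>g2\<close> bring \<open>x\<close> and
      \<open>a\<close> to the point \<open>p\<close>, while \<open>h\<close> fixes \<open>p\<close>
      and adjusts the second member; so \<open>g\<close> carries the pair \<open>x\<close>,
      \<open>y\<close> to \<open>a\<close>, \<open>b\<close>.\<close>
    define g where "g = inv_into UNIV g2 \<circ> (h \<circ> g1)"
    have g: "g \<in> homs_over F" unfolding g_def by (intro homs_over_comp hinv g2 g1 h)
    have gx: "g x = a" "g y = b" using g1 g2 h hinv(3)[OF g2(1)] by (auto simp: g_def) metis
    define \<sigma> where "\<sigma> = g \<circ> (\<tau> \<circ> inv_into UNIV g)"
    have "\<sigma> \<in> homs_over F" unfolding \<sigma>_def by (intro homs_over_comp hinv g t)
    moreover have "\<sigma> z = Transposition.transpose a b z" if z: "z \<in> R" for z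
    proof -
      have ia: "inv_into UNIV g a = x" "inv_into UNIV g b = y" using gx hinv(3)[OF g] by metis+
      consider "z = a" | "z = b" | "z \<noteq> a" "z \<noteq> b" by blast
      thus ?thesis
      proof cases
        case 3
        have "inv_into UNIV g z \<noteq> x" "inv_into UNIV g z \<noteq> y" using 3 gx hinv(2)[OF g, of z] by auto
        moreover have "inv_into UNIV g z \<in> R" using stab[OF hinv(1)[OF g] z] .
        ultimately have "\<tau> (inv_into UNIV g z) = inv_into UNIV g z" using t(3) by auto
        thus ?thesis using 3 hinv(2)[OF g] by (simp add: \<sigma>_def)
      qed (use ia t(2) ty gx in \<open>auto simp: \<sigma>_def\<close>)
    qed
    ultimately show ?thesis by blast
  qed
  show ?thesis using \<pi> R(1)
  proof (induction rule: permutes_induct)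
    case id
    show ?case using idh by (intro bexI[of _ id]) auto
  next
    case (swap a b p)
    obtain \<sigma> where s: "\<sigma> \<in> homs_over F" "\<forall>x\<in>R. \<sigma> x = Transposition.transpose a b x"
      using swp[OF swap.hyps(1,2)] by blast
    obtain \<tau> where t: "\<tau> \<in> homs_over F" "\<forall>x\<in>R. \<tau> x = p x" using swap.IH by blast
    show ?case
    proof (intro bexI[of _ "\<sigma> \<circ> \<tau>"] ballI homs_over_comp s t)
      fix x assume "x \<in> R"
      moreover hence "p x \<in> R" using swap.hyps by (simp add: permutes_in_image)
      ultimately show "(\<sigma> \<circ> \<tau>) x = (Transposition.transpose a b \<circ> p) x" using s t by simp
    qed
  qed
qed

section \<open>Specialization of the variable X\<close>

abbreviation ev :: "'w::comm_semiring_1 \<Rightarrow> 'w poly poly \<Rightarrow> 'w poly" where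
  "ev x \<equiv> map_poly (\<lambda>p. poly p x)"

lemma ev_mult: "ev x (p * q) = ev x p * ev (x::'w::idom) q"
  and ev_pderiv: "ev x (pderiv p) = pderiv (ev x p)"
  and ev_add: "ev x (p + q) = ev x p + ev x q"
proof -
  interpret mp: map_poly_idom_hom "\<lambda>p. poly p x" ..
  show "ev x (p * q) = ev x p * ev x q"
    "ev x (pderiv p) = pderiv (ev x p)" "ev x (p + q) = ev x p + ev x q"
    by (simp_all add: mp.hom_mult poly_hom.map_poly_pderiv mp.hom_add)
qed

lemma degree_ev: "lead_coeff f = 1 \<Longrightarrow> degree (ev x f) = degree f" "lead_coeff f = 1 \<Longrightarrow> lead_coeff (ev x f) = 1"
proof -
  assume l: "lead_coeff f = 1"
  show d: "degree (ev x f) = degree f" by (rule map_poly_degree_eq) (use l in simp)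
  show "lead_coeff (ev x f) = 1" unfolding d using l by (simp add: coeff_map_poly)
qed

text \<open>Each of the \<open>degree f\<close> distinct roots of \<open>ev c f\<close> lifts by
  Hensel to a power series root. These lifts come from different elements of \<open>R\<close>, so
  counting shows that they account for all of \<open>R\<close>: every root of \<open>f\<close>
  becomes a power series, and its constant term is its specialization.\<close>

theorem place_unramified:
  fixes f :: "'w::alg_closed_field poly poly" and c :: 'w
  defines "R \<equiv> {x. poly (map_poly incl f) x = 0}" and "S \<equiv> {s. poly (ev c f) s = 0}"
  assumes lc: "lead_coeff f = 1" and S: "card S = degree f"
  obtains \<Psi> :: "'w poly fract alg_closure \<Rightarrow> 'w fps fract alg_closure" and r
  where "field_hom \<Psi>" "\<And>p. \<Psi> (incl p) = incl (expand c p)" "\<And>x. x \<in> R \<Longrightarrow> \<Psi> x = incl (r x)"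
    "bij_betw (\<lambda>x. r x $ 0) R S"
proof -
  obtain \<Psi> :: "'w poly fract alg_closure \<Rightarrow> 'w fps fract alg_closure"
    where P: "field_hom \<Psi>" "\<And>p. \<Psi> (incl p) = incl (expand c p)" using place_hom[of c] by blast
  interpret \<Psi>: field_hom \<Psi> by fact
  interpret i: idom_hom "incl :: 'w fps \<Rightarrow> _" by (rule incl_hom)
  interpret e: idom_hom "expand c" by (rule expand_hom)
  define f' where "f' = map_poly (expand c) f"
  have mapf: "map_poly \<Psi> (map_poly incl f) = map_poly incl f'"
    by (rule poly_eqI) (simp add: f'_def coeff_map_poly P)
  have red': "red f' = ev c f" unfolding f'_def by (rule poly_eqI) (simp add: coeff_map_poly expand_nth_0)
  have fc0: "ev c f \<noteq> 0" using degree_ev(2)[OF lc, of c] by (metis leading_coeff_0_iff zero_neq_one)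
  have f0: "map_poly incl f \<noteq> 0"
  proof
    assume "map_poly incl f = 0"
    hence "coeff (map_poly incl f) (degree f) = 0" by simp
    thus False using lc by (simp add: coeff_map_poly)
  qed
  have finS: "finite S" unfolding S_def by (rule poly_roots_finite[OF fc0])
  have finR: "finite R" unfolding R_def by (rule poly_roots_finite[OF f0])
  obtain q where q: "ev c f = (\<Prod>a\<in>S. [:-a,1:]) * q"
    using prod_linear_dvd[OF finS, of "ev c f"] by (auto simp: S_def)
  have q0: "q \<noteq> 0" using fc0 q by auto
  have degS: "degree (\<Prod>a\<in>S. [:-a,1:]) = card S" by (subst degree_prod_eq_sum_degree) auto
  have "(\<Prod>a\<in>S. [:-a,1:]) \<noteq> 0" using finS by auto
  hence "degree (ev c f) = card S + degree q" unfolding q using q0 degS by (simp add: degree_mult_eq)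
  hence "degree q = 0" using degree_ev(1)[OF lc] S by simp
  then obtain u where u: "q = [:u:]" by (metis degree_0_id)
  have u0: "u \<noteq> 0" using q0 u by auto
  have evf: "ev c f = smult u (\<Prod>a\<in>S. [:-a,1:])" using q u by simp
  have root: "\<exists>x t. x \<in> R \<and> \<Psi> x = incl t \<and> t $ 0 = s" if s: "s \<in> S" for s
  proof -
    have "poly (red f') s = 0" using s red' by (simp add: S_def)
    moreover have "poly (pderiv (red f')) s \<noteq> 0"
    proof -
      have "(\<Prod>a\<in>S. [:-a,1:]) = [:-s,1:] * (\<Prod>a\<in>S-{s}. [:-a,1:])" by (rule prod.remove[OF finS s])
      hence "poly (pderiv (\<Prod>a\<in>S. [:-a,1:])) s = poly (\<Prod>a\<in>S-{s}. [:-a,1:]) s" by (metis poly_pderiv_linear_mult)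
      also have "\<dots> \<noteq> 0" using finS by (auto simp: poly_prod)
      finally show ?thesis unfolding red' evf using u0 by (simp add: pderiv_smult)
    qed
    ultimately obtain t where t: "t $ 0 = s" "poly f' t = 0" by (rule fps_hensel)
    have "poly (map_poly \<Psi> (map_poly incl f)) (incl t) = 0" unfolding mapf using t(2) by simp
    then obtain x where "poly (map_poly incl f) x = 0" "incl t = \<Psi> x" using hom_range_roots[OF P(1) f0] by metis
    thus ?thesis using t by (auto simp: R_def intro!: exI[of _ x] exI[of _ t])
  qed
  have "\<forall>s. \<exists>x t. s \<in> S \<longrightarrow> x \<in> R \<and> \<Psi> x = incl t \<and> t $ 0 = s" using root by blast
  then obtain g t where gt: "\<And>s. s \<in> S \<Longrightarrow> g s \<in> R \<and> \<Psi> (g s) = incl (t s) \<and> t s $ 0 = s" by metis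
  have injg: "inj_on g S"
  proof (rule inj_onI)
    fix a b assume ab: "a \<in> S" "b \<in> S" "g a = g b"
    hence "incl (t a) = incl (t b)" using gt by metis
    hence "t a = t b" by simp
    thus "a = b" using gt ab by metis
  qed
  have "card R \<le> degree f"
    unfolding R_def using card_poly_roots_bound[OF f0] degree_map_poly_le[of incl f] by linarith
  hence "g ` S = R" using card_seteq[OF finR, of "g ` S"] gt card_image[OF injg] S by auto
  hence bg: "bij_betw g S R" using injg by (simp add: bij_betw_def)
  define h where "h = the_inv_into S g"
  have bh: "bij_betw h R S" unfolding h_def by (rule bij_betw_the_inv_into[OF bg])
  have gh: "g (h x) = x" if "x \<in> R" for x unfolding h_def using f_the_inv_into_f_bij_betw[OF bg that] .
  have hS: "h x \<in> S" if "x \<in> R" for x using bh that by (auto simp: bij_betw_def)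
  show thesis
  proof (rule that[OF P])
    show "\<Psi> x = incl (t (h x))" if "x \<in> R" for x using gt[OF hS[OF that]] gh[OF that] by simp
    have "t (h x) $ 0 = h x" if "x \<in> R" for x using gt[OF hS[OF that]] by simp
    thus "bij_betw (\<lambda>x. t (h x) $ 0) R S" using bh bij_betw_cong[of R "\<lambda>x. t (h x) $ 0" h S] by blast
  qed
qed

text \<open>The field \<open>M(X)\<close>, inside the algebraic closure of the rational functions
  over the ambient constants.\<close>

definition fracs :: "'w::field set \<Rightarrow> 'w poly fract alg_closure set" where
  "fracs M = {incl p / incl q | p q. p \<in> polys M \<and> q \<in> polys M \<and> q \<noteq> 0}"

lemma fracsI: "p \<in> polys M \<Longrightarrow> q \<in> polys M \<Longrightarrow> q \<noteq> 0 \<Longrightarrow> x = incl p / incl q \<Longrightarrow> x \<in> fracs M"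
  unfolding fracs_def by blast

lemma fracsE:
  assumes "x \<in> fracs M"
  obtains p q where "p \<in> polys M" "q \<in> polys M" "q \<noteq> 0" "x = incl p / incl q"
  using assms unfolding fracs_def mem_Collect_eq by (elim exE conjE) (rule that)

lemma incl_fracs: "subfld M \<Longrightarrow> p \<in> polys M \<Longrightarrow> incl p \<in> fracs M"
  by (rule fracsI[of p _ 1]) (simp_all add: polys_1)

lemma incl_simps: "incl (p * q) = incl p * incl q" "incl (p + q) = incl p + incl q" "incl (p - q) = incl p - incl q"
  by simp_all

lemma subfld_fracs:
  assumes M: "subfld M"
  shows "subfld (fracs M)"
proof (rule subfldI)
  show "1 \<in> fracs M" using incl_fracs[OF M polys_1[OF M]] by simp
  fix x y assume "x \<in> fracs M" "y \<in> fracs M"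
  then have xy_in: "x \<in> fracs M" "y \<in> fracs M" by simp_all
  obtain p q where x: "p \<in> polys M" "q \<in> polys M" "q \<noteq> 0" "x = incl p / incl q" using xy_in(1) by (rule fracsE)
  obtain p' q' where y: "p' \<in> polys M" "q' \<in> polys M" "q' \<noteq> 0" "y = incl p' / incl q'" using xy_in(2) by (rule fracsE)
  note xy = x y
  have nz: "incl q \<noteq> 0" "incl q' \<noteq> 0" using xy(3,7) by simp_all
  show "x - y \<in> fracs M"
  proof (rule fracsI)
    show "x - y = incl (p * q' - p' * q) / incl (q * q')"
      unfolding xy(4,8) by (simp only: diff_frac_eq[OF nz] incl_simps)
  qed (use xy in \<open>auto intro!: polys_diff[OF M] polys_mult[OF M]\<close>)
  show "x * y \<in> fracs M"
  proof (rule fracsI)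
    show "x * y = incl (p * p') / incl (q * q')"
      unfolding xy(4,8) by (simp only: times_divide_times_eq incl_simps)
  qed (use xy in \<open>auto intro!: polys_mult[OF M]\<close>)
next
  fix x assume x: "x \<in> fracs M" "x \<noteq> 0"
  then obtain p q where pq: "p \<in> polys M" "q \<in> polys M" "q \<noteq> 0" "x = incl p / incl q" by (elim fracsE)
  have "p \<noteq> 0" using x(2) pq(4) by auto
  moreover have "inverse x = incl q / incl p" unfolding pq(4) by (rule inverse_divide)
  ultimately show "inverse x \<in> fracs M" using pq by (intro fracsI[of q M p])
qed

lemma subfld_UNIV: "subfld UNIV"
  by (auto simp: subfld_def)

lemma fracs_UNIV: "(fracs UNIV :: 'w::field poly fract alg_closure set) = range to_ac"
proof (intro equalityI subsetI)
  fix x :: "'w poly fract alg_closure" assume "x \<in> fracs UNIV"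
  then obtain p q where "p \<in> polys UNIV" "q \<in> polys UNIV" "q \<noteq> 0" and x: "x = incl p / incl q" by (rule fracsE)
  from x have "x = to_ac (to_fract p / to_fract q)" by (simp only: to_ac_divide)
  thus "x \<in> range to_ac" by blast
next
  fix x :: "'w poly fract alg_closure" assume "x \<in> range to_ac"
  then obtain u where u: "x = to_ac u" by blast
  obtain a b where "b \<noteq> 0" "to_ac u = incl a / incl b" by (rule to_ac_fractE)
  thus "x \<in> fracs UNIV" unfolding u by (intro fracsI[of a _ b]) (auto simp: polys_def)
qed

lemma clear_denominators:
  assumes M: "subfld M" and P: "P \<in> polys (fracs M)"
  shows "\<exists>D g. D \<in> polys M \<and> D \<noteq> 0 \<and> (\<forall>i. coeff g i \<in> polys M) \<and> map_poly incl g = smult (incl D) P"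
  using P
proof (induction P)
  case 0
  show ?case by (intro exI[of _ 1] exI[of _ 0]) (simp add: polys_1[OF M] polys_0[OF M])
next
  case (pCons a P)
  have "P \<in> polys (fracs M)" using polysD[OF pCons.prems, of "Suc _"] by (auto intro: polysI)
  then obtain D g where Dg: "D \<in> polys M" "D \<noteq> 0" "\<forall>i. coeff g i \<in> polys M" "map_poly incl g = smult (incl D) P"
    using pCons.IH by blast
  have "a \<in> fracs M" using polysD[OF pCons.prems, of 0] by simp
  then obtain p q where pq: "p \<in> polys M" "q \<in> polys M" "q \<noteq> 0" "a = incl p / incl q" by (elim fracsE)
  interpret i: idom_hom "incl :: 'a poly \<Rightarrow> _" by (rule incl_hom)
  have qa: "incl q * a = incl p" using pq(3) unfolding pq(4) by simp
  have "map_poly incl (pCons (D * p) (smult q g)) = pCons (incl D * incl p) (smult (incl q) (map_poly incl g))"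
    by (simp add: map_poly_pCons_0 i.map_poly_hom_smult)
  also have "\<dots> = smult (incl (D * q)) (pCons a P)"
    unfolding Dg(4) qa[symmetric] by (simp add: mult_ac)
  finally have "map_poly incl (pCons (D * p) (smult q g)) = smult (incl (D * q)) (pCons a P)" .
  moreover have "D * q \<in> polys M" "D * q \<noteq> 0" using Dg pq polys_mult[OF M] by auto
  moreover have "\<forall>i. coeff (pCons (D * p) (smult q g)) i \<in> polys M"
    using Dg pq polys_mult[OF M] by (auto simp: coeff_pCons split: nat.split)
  ultimately show ?case by blast
qed

lemma map_poly_incl_inj: "map_poly incl p = map_poly incl q \<Longrightarrow> p = q"
proof (rule poly_eqI)
  fix i assume "map_poly incl p = map_poly incl q"
  hence "coeff (map_poly incl p) i = coeff (map_poly incl q) i" by simp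
  thus "coeff p i = coeff q i" by (simp add: coeff_map_poly)
qed

lemma map_poly_incl_mult: "map_poly incl (p * q) = map_poly incl p * map_poly incl (q :: 'b::idom poly)"
  and map_poly_incl_add: "map_poly incl (p + q) = map_poly incl p + map_poly incl q"
  and map_poly_incl_smult: "map_poly incl (smult c p) = smult (incl c) (map_poly incl p)"
  and map_poly_incl_pderiv: "map_poly incl (pderiv p) = pderiv (map_poly incl p)"
proof -
  interpret i: idom_hom "incl :: 'b \<Rightarrow> _" by (rule incl_hom)
  interpret mp: map_poly_idom_hom "incl :: 'b \<Rightarrow> _" ..
  show "map_poly incl (p * q) = map_poly incl p * map_poly incl q"
    "map_poly incl (p + q) = map_poly incl p + map_poly incl q"
    "map_poly incl (smult c p) = smult (incl c) (map_poly incl p)"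
    "map_poly incl (pderiv p) = pderiv (map_poly incl p)"
    by (simp_all only: mp.hom_mult mp.hom_add i.map_poly_hom_smult i.map_poly_pderiv)
qed

text \<open>A substitute for the discriminant without resultants: a Bezout identity between
  \<open>f\<close> and its derivative over the rational functions, with denominators cleared, writes
  a nonzero polynomial in \<open>X\<close> alone as a combination of the two. It vanishes wherever a
  specialization has a multiple root.\<close>

lemma discriminant:
  fixes f :: "'w::field poly poly"
  assumes sf: "\<And>x. poly (map_poly incl f) x = 0 \<Longrightarrow> poly (pderiv (map_poly incl f)) x \<noteq> 0" and f: "f \<noteq> 0"
  obtains D where "D \<noteq> 0" "\<And>x y. poly (ev x f) y = 0 \<Longrightarrow> poly (pderiv (ev x f)) y = 0 \<Longrightarrow> poly D x = 0"
proof -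
  note U = subfld_UNIV[where 'a='w]
  note F = subfld_fracs[OF U]
  define P where "P = map_poly incl f"
  define Q where "Q = map_poly incl (pderiv f)"
  have PQ: "P \<in> polys (fracs UNIV)" "Q \<in> polys (fracs UNIV)"
    unfolding P_def Q_def by (auto intro!: polysI simp: coeff_map_poly fracs_UNIV)
  define I where "I = {a * P + b * Q | a b. a \<in> polys (fracs UNIV) \<and> b \<in> polys (fracs UNIV)}"
  have I: "a * P + b * Q \<in> I" if "a \<in> polys (fracs UNIV)" "b \<in> polys (fracs UNIV)" for a b
    using that by (auto simp: I_def)
  have PI: "P \<in> I" and QI: "Q \<in> I" using I[of 1 0] I[of 0 1] polys_0[OF F] polys_1[OF F] by auto
  have "P \<noteq> 0" using f map_poly_incl_inj[of f 0] by (auto simp: P_def)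
  then obtain d where d: "d \<in> I" "lead_coeff d = 1" "\<And>h. h \<in> I \<Longrightarrow> \<exists>s\<in>polys (fracs UNIV). h = d * s"
  proof (rule_tac polys_principal[OF F, of I P])
    show "I \<subseteq> polys (fracs UNIV)" using PQ by (auto simp: I_def intro!: polys_add[OF F] polys_mult[OF F])
    show "u - v \<in> I" if uv: "u \<in> I" "v \<in> I" for u v
    proof -
      obtain a b where u: "u = a * P + b * Q" "a \<in> polys (fracs UNIV)" "b \<in> polys (fracs UNIV)"
        using uv(1) by (auto simp: I_def)
      obtain a' b' where v: "v = a' * P + b' * Q" "a' \<in> polys (fracs UNIV)" "b' \<in> polys (fracs UNIV)"
        using uv(2) by (auto simp: I_def)
      have "(a - a') * P + (b - b') * Q \<in> I" using u v by (intro I polys_diff[OF F])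
      thus ?thesis using u v by (simp add: algebra_simps)
    qed
    show "u * v \<in> I" if uv: "u \<in> I" "v \<in> polys (fracs UNIV)" for u v
    proof -
      obtain a b where u: "u = a * P + b * Q" "a \<in> polys (fracs UNIV)" "b \<in> polys (fracs UNIV)"
        using uv(1) by (auto simp: I_def)
      have "(a * v) * P + (b * v) * Q \<in> I" using u uv by (intro I polys_mult[OF F])
      thus ?thesis using u by (simp add: algebra_simps)
    qed
  qed (use PI in auto)
  have "degree d = 0"
  proof (rule ccontr)
    assume "degree d \<noteq> 0"
    then obtain x where x: "poly d x = 0" using alg_closed_imp_poly_has_root[of d] by auto
    obtain s where "P = d * s" using d(3)[OF PI] by blast
    hence "poly P x = 0" using x by simp
    moreover obtain t where "Q = d * t" using d(3)[OF QI] by blast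
    hence "poly Q x = 0" using x by simp
    ultimately show False using sf[of x] by (simp add: P_def Q_def map_poly_incl_pderiv)
  qed
  hence "d = 1" using d(2) by (metis degree_0_id one_pCons)
  then obtain a b where ab: "1 = a * P + b * Q" "a \<in> polys (fracs UNIV)" "b \<in> polys (fracs UNIV)"
    using d(1) by (auto simp: I_def)
  obtain Da a' where a': "Da \<noteq> 0" "map_poly incl a' = smult (incl Da) a" using clear_denominators[OF U ab(2)] by blast
  obtain Db b' where b': "Db \<noteq> 0" "map_poly incl b' = smult (incl Db) b" using clear_denominators[OF U ab(3)] by blast
  have "map_poly incl (smult Db a' * f + smult Da b' * pderiv f) =
      smult (incl Db) (smult (incl Da) a) * P + smult (incl Da) (smult (incl Db) b) * Q"
    by (simp only: map_poly_incl_add map_poly_incl_mult map_poly_incl_smult a' b' P_def Q_def)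
  also have "\<dots> = smult (incl Da * incl Db) (a * P + b * Q)"
    by (simp add: smult_add_right mult.commute)
  also have "\<dots> = map_poly incl [:Da * Db:]" unfolding ab(1)[symmetric] by (simp add: map_poly_pCons_0)
  finally have eq: "smult Db a' * f + smult Da b' * pderiv f = [:Da * Db:]" by (rule map_poly_incl_inj)
  show thesis
  proof
    show "Da * Db \<noteq> 0" using a' b' by simp
    fix x y assume xy: "poly (ev x f) y = 0" "poly (pderiv (ev x f)) y = 0"
    have "ev x [:Da * Db:] = ev x (smult Db a') * ev x f + ev x (smult Da b') * pderiv (ev x f)"
      unfolding eq[symmetric] by (simp only: ev_add ev_mult ev_pderiv)
    hence "poly (ev x [:Da * Db:]) y = 0" using xy by simp
    thus "poly (Da * Db) x = 0" by (simp add: map_poly_pCons_0)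
  qed
qed

text \<open>Constants are algebraic over \<open>M\<close>, hence over \<open>M(X)\<close>, and a
  rational function lies in the field generated over \<open>M(X)\<close> by its finitely many
  coefficients. Transitivity does the rest.\<close>

lemma alg_over_fracs:
  fixes M :: "'w::field set"
  assumes M: "subfld M" and alg: "\<And>a. alg_over M a"
  shows "alg_over (fracs M) e"
proof -
  note F = subfld_fracs[OF M]
  have const: "alg_over (fracs M) (incl [:a:])" for a
  proof -
    obtain p where p: "p \<in> polys M" "p \<noteq> 0" "poly p a = 0" using alg[of a] by (auto simp: alg_over_def)
    have k: "[:1::'w:] = 1" "\<And>x y::'w. [:x + y:] = [:x:] + [:y:]" "\<And>x y::'w. [:x * y:] = [:x:] * [:y:]" by simp_all
    interpret k: idom_hom "\<lambda>a::'w. incl [:a:]" by unfold_locales (simp_all only: k incl_simps, simp_all)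
    have "map_poly (\<lambda>a. incl [:a:]) p \<in> polys (fracs M)"
      by (intro polysI) (simp add: coeff_map_poly incl_fracs[OF M] polys_const[OF M] polysD[OF p(1)])
    moreover have "poly (map_poly (\<lambda>a. incl [:a:]) p) (incl [:a:]) = 0" using p(3) by (simp only: k.poly_map_poly) simp
    moreover have "map_poly (\<lambda>a. incl [:a:]) p \<noteq> 0"
    proof
      assume "map_poly (\<lambda>a. incl [:a:]) p = 0"
      hence "coeff (map_poly (\<lambda>a. incl [:a:]) p) (degree p) = 0" by simp
      thus False using p(2) by (simp add: coeff_map_poly)
    qed
    ultimately show ?thesis unfolding alg_over_def by blast
  qed
  have X: "incl [:0,1:] \<in> fracs M"
    by (intro incl_fracs[OF M] polys_pCons[OF M] polys_0[OF M] subfld_0[OF M] subfld_1[OF M])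
  have pol: "incl p \<in> L" if L: "subfld L" "fracs M \<subseteq> L" and c: "\<And>i. incl [:coeff p i:] \<in> L" for p L
    using c
  proof (induction p)
    case 0
    show ?case using subfld_0[OF L(1)] by simp
  next
    case (pCons a p)
    have "incl [:a:] \<in> L" using pCons.prems[of 0] by simp
    moreover have "incl p \<in> L" by (rule pCons.IH) (use pCons.prems[of "Suc _"] in simp)
    moreover have "pCons a p = [:a:] + [:0,1:] * p" by simp
    hence "incl (pCons a p) = incl [:a:] + incl [:0,1:] * incl p" by (simp only: incl_simps)
    moreover have "incl [:0,1:] \<in> L" using X L(2) by blast
    ultimately show ?case by (metis subfld_add[OF L(1)] subfld_mult[OF L(1)])
  qed
  show ?thesis
  proof (rule alg_over_trans[OF F _ alg_closure_alg_over])
    fix x :: "'w poly fract alg_closure" assume "x \<in> range to_ac"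
    then obtain u where u: "x = to_ac u" by blast
    obtain a b where ab: "b \<noteq> 0" "to_ac u = incl a / incl b" by (rule to_ac_fractE)
    define B where "B = (\<lambda>i. incl [:coeff a i:]) ` {..degree a} \<union> (\<lambda>i. incl [:coeff b i:]) ` {..degree b}"
    note G = subfld_gen_fld[of "fracs M" B]
    have c0: "incl [:coeff r i:] \<in> gen_fld (fracs M) B" if "(\<lambda>i. incl [:coeff r i:]) ` {..degree r} \<subseteq> B" for r i
    proof (cases "i \<le> degree r")
      case True
      thus ?thesis using that gen_fld_gens[of B "fracs M"] by blast
    next
      case False
      hence "coeff r i = 0" by (intro coeff_eq_0) simp
      thus ?thesis using subfld_0[OF G] by simp
    qed
    have "incl [:coeff a i:] \<in> gen_fld (fracs M) B" "incl [:coeff b i:] \<in> gen_fld (fracs M) B" for i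
      by (rule c0, simp add: B_def)+
    hence "incl a \<in> gen_fld (fracs M) B" "incl b \<in> gen_fld (fracs M) B" using pol[OF G gen_fld_base] by blast+
    hence "x \<in> gen_fld (fracs M) B" unfolding u ab(2) by (rule subfld_divide[OF G])
    hence "alg_over (gen_fld (fracs M) B) x" by (rule alg_over_base[OF G])
    thus "alg_over (fracs M) x" by (rule alg_over_gen_fld_trans[of B, rotated 3]) (use F const in \<open>auto simp: B_def\<close>)
  qed
qed

section \<open>A Galois resolvent twisted by a separable polynomial\<close>

lemma induced_permutation:
  fixes t :: "nat \<Rightarrow> 'x"
  assumes t: "inj_on t {..<n}" and st: "\<And>i. i < n \<Longrightarrow> \<sigma> (t i) \<in> t ` {..<n}" and inj: "inj \<sigma>"
  obtains \<alpha> where "\<alpha> permutes {..<n}" "\<And>i. i < n \<Longrightarrow> \<sigma> (t i) = t (\<alpha> i)"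
proof -
  have "\<forall>i. \<exists>j. i < n \<longrightarrow> j < n \<and> \<sigma> (t i) = t j" using st by blast
  then obtain a where a: "\<And>i. i < n \<Longrightarrow> a i < n \<and> \<sigma> (t i) = t (a i)" by metis
  define \<alpha> where "\<alpha> i = (if i < n then a i else i)" for i
  have "inj_on \<alpha> {..<n}"
  proof (rule inj_onI)
    fix i j assume ij: "i \<in> {..<n}" "j \<in> {..<n}" "\<alpha> i = \<alpha> j"
    hence "\<sigma> (t i) = \<sigma> (t j)" using a by (auto simp: \<alpha>_def)
    hence "t i = t j" using inj by (simp add: inj_eq)
    thus "i = j" using t ij by (auto dest: inj_onD)
  qed
  moreover have "\<alpha> ` {..<n} \<subseteq> {..<n}" using a by (auto simp: \<alpha>_def)
  ultimately have "bij_betw \<alpha> {..<n} {..<n}" by (simp add: bij_betw_def endo_inj_surj)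
  hence "\<alpha> permutes {..<n}" by (rule bij_imp_permutes) (simp add: \<alpha>_def)
  thus thesis using that[of \<alpha>] a by (simp add: \<alpha>_def)
qed

lemma permuted_sum:
  assumes \<alpha>: "\<alpha> permutes {..<n}"
  shows "(\<Sum>i<n. a i * b (\<alpha> i)) = (\<Sum>i<n. a (inv_into UNIV \<alpha> i) * b i)"
proof -
  have "(\<Sum>i<n. a (inv_into UNIV \<alpha> i) * b i) = sum ((\<lambda>i. a (inv_into UNIV \<alpha> i) * b i) \<circ> \<alpha>) {..<n}"
    by (rule sum.permute[OF \<alpha>])
  thus ?thesis using permutes_inverses[OF \<alpha>] by simp
qed

lemma prod_linear_subleading:
  fixes S :: "'a::idom set"
  assumes "finite S" "S \<noteq> {}"
  shows "coeff (\<Prod>x\<in>S. [:-x,1:]) (card S - 1) = - (\<Sum>x\<in>S. x) \<and> coeff (\<Prod>x\<in>S. [:-x,1:]) (card S) = 1"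
  using assms
proof (induction S rule: finite_ne_induct)
  case (insert a S)
  have S: "card S \<ge> 1" using insert.hyps by (simp add: Suc_leI card_gt_0_iff)
  have d: "degree (\<Prod>x\<in>S. [:-x,1:]) = card S" by (subst degree_prod_eq_sum_degree) auto
  hence top: "coeff (\<Prod>x\<in>S. [:-x,1:]) (Suc (card S)) = 0" by (intro coeff_eq_0) simp
  have "coeff ([:-a,1:] * p) (Suc k) = coeff p k - a * coeff p (Suc k)" for p and k by simp
  moreover have "(\<Prod>x\<in>insert a S. [:-x,1:]) = [:-a,1:] * (\<Prod>x\<in>S. [:-x,1:])"
    using insert.hyps by (simp del: mult_pCons_left)
  moreover obtain m where "card S = Suc m" using S by (cases "card S") auto
  ultimately show ?case using insert.IH insert.hyps top by (simp del: mult_pCons_left)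
qed auto

lemma polys_range_to_ac: "map_poly incl A \<in> polys (range to_ac)"
  by (rule polysI) (simp add: coeff_map_poly)

text \<open>\<open>\<theta>_sep\<close> and \<open>\<theta>_conj\<close> together say that
  \<open>\<theta>\<close> lists the roots of a separable polynomial irreducible over
  \<open>M\<close>, expressed through conjugacy. \<open>full\<close> is full symmetric monodromy
  over the algebraically closed constants. \<open>trace\<close> says that the roots of
  \<open>f\<close> have nonzero sum, which separates the twisted sums in
  \<open>z_inj\<close>.\<close>

locale twisted_cover =
  fixes M :: "'w::alg_closed_field set" and n :: nat and \<theta> :: "nat \<Rightarrow> 'w" and f :: "'w poly poly"
  assumes M: "subfld M" and alg: "\<And>a. alg_over M a"
    and \<theta>_inj: "inj_on \<theta> {..<n}"
    and \<theta>_sep: "\<exists>p\<in>polys M. rsquarefree p \<and> {a. poly p a = 0} = \<theta> ` {..<n}"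
    and \<theta>_conj: "\<And>i j h. i < n \<Longrightarrow> j < n \<Longrightarrow> h \<in> polys M \<Longrightarrow> poly h (\<theta> i) = 0 \<Longrightarrow> poly h (\<theta> j) = 0"
    and f_monic: "lead_coeff f = 1" and f_deg: "degree f = n" and f_coeff: "\<And>i. coeff f i \<in> polys M"
    and card_roots: "card {x. poly (map_poly incl f) x = 0} = n"
    and full: "\<And>\<pi>. \<pi> permutes {x. poly (map_poly incl f) x = 0} \<Longrightarrow>
      \<exists>\<sigma>\<in>homs_over (range to_ac). \<forall>x. poly (map_poly incl f) x = 0 \<longrightarrow> \<sigma> x = \<pi> x"
    and trace: "n \<ge> 2 \<Longrightarrow> coeff f (n - 1) \<noteq> 0"
begin

definition R where "R = {x. poly (map_poly incl f) x = 0}"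

definition r :: "nat \<Rightarrow> 'w poly fract alg_closure" where "r = (SOME r. bij_betw r {..<n} R)"

definition C :: "'w \<Rightarrow> 'w poly fract alg_closure" where "C a = incl [:a:]"

definition Perm :: "(nat \<Rightarrow> nat) set" where "Perm = {\<tau>. \<tau> permutes {..<n}}"

definition z :: "(nat \<Rightarrow> nat) \<Rightarrow> 'w poly fract alg_closure" where
  "z \<tau> = (\<Sum>i<n. C (\<theta> (\<tau> i)) * r i)"

definition resolvent where "resolvent = (\<Prod>\<tau>\<in>Perm. [:- z \<tau>, 1:])"

lemma map_f_nz: "map_poly incl f \<noteq> 0"
proof
  assume "map_poly incl f = 0"
  hence "coeff (map_poly incl f) (degree f) = 0" by simp
  thus False using f_monic by (simp add: coeff_map_poly)
qed

lemma map_f_deg: "degree (map_poly incl f) = n" "lead_coeff (map_poly incl f) = 1"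
proof -
  show d: "degree (map_poly incl f) = n" unfolding f_deg[symmetric]
    by (rule map_poly_degree_eq) (use f_monic in simp)
  show "lead_coeff (map_poly incl f) = 1" unfolding d using f_monic f_deg by (simp add: coeff_map_poly)
qed

lemma finite_R: "finite R"
  unfolding R_def by (rule poly_roots_finite[OF map_f_nz])

lemma r_bij: "bij_betw r {..<n} R"
proof -
  have "\<exists>r. bij_betw r {..<n} R"
    using ex_bij_betw_nat_finite[OF finite_R] card_roots by (simp add: R_def atLeast0LessThan)
  thus ?thesis unfolding r_def by (rule someI_ex)
qed

lemma r_inj: "inj_on r {..<n}" and r_range: "r ` {..<n} = R"
  using r_bij by (auto simp: bij_betw_def)

lemma finite_Perm: "finite Perm" and Perm_id: "id \<in> Perm"
  by (auto simp: Perm_def finite_permutations permutes_id)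

lemma Perm_lt: "\<tau> \<in> Perm \<Longrightarrow> i < n \<Longrightarrow> \<tau> i < n"
  using permutes_in_image[of \<tau> "{..<n}" i] by (simp add: Perm_def)

lemma map_f_split: "map_poly incl f = (\<Prod>x\<in>R. [:-x,1:])"
proof -
  have dvd: "(\<Prod>x\<in>R. [:-x,1:]) dvd map_poly incl f"
    by (rule prod_linear_dvd[OF finite_R]) (simp add: R_def)
  then obtain q where q: "map_poly incl f = (\<Prod>x\<in>R. [:-x,1:]) * q" by (rule dvdE)
  have lR: "lead_coeff (\<Prod>x\<in>R. [:-x,1:]) = 1" by (simp add: lead_coeff_prod)
  have dR: "degree (\<Prod>x\<in>R. [:-x,1:]) = n" using card_roots by (subst degree_prod_eq_sum_degree) (auto simp: R_def)
  have "q \<noteq> 0" "(\<Prod>x\<in>R. [:-x,1:]) \<noteq> 0" using q map_f_nz by auto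
  hence "degree (map_poly incl f) = n + degree q" unfolding q using dR by (simp add: degree_mult_eq)
  hence "degree q = 0" using map_f_deg(1) by simp
  moreover have "lead_coeff (map_poly incl f) = lead_coeff q" unfolding q using lR by (simp add: lead_coeff_mult)
  ultimately have "q = 1" using map_f_deg(2) by (metis degree_0_id one_pCons)
  thus ?thesis using q by simp
qed

lemma map_f_rsquarefree: "rsquarefree (map_poly incl f)"
  unfolding map_f_split by (rule rsquarefree_prod_linear[OF finite_R])

lemma hom_exists:
  assumes "\<alpha> permutes {..<n}"
  obtains \<sigma> where "\<sigma> \<in> homs_over (range to_ac)" "\<And>i. i < n \<Longrightarrow> \<sigma> (r i) = r (\<alpha> i)"
proof -
  define \<pi> where "\<pi> x = (if x \<in> R then r (\<alpha> (the_inv_into {..<n} r x)) else x)" for x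
  have ti: "the_inv_into {..<n} r (r i) = i" if "i < n" for i using the_inv_into_f_f[OF r_inj] that by simp
  have \<alpha>n: "\<alpha> i < n" if "i < n" for i using permutes_in_image[OF assms, of i] that by simp
  have "inj_on \<pi> R"
  proof (rule inj_onI)
    fix x y assume xy: "x \<in> R" "y \<in> R" "\<pi> x = \<pi> y"
    from xy(1,2) have "x \<in> r ` {..<n}" "y \<in> r ` {..<n}" by (simp_all only: r_range)
    then obtain i j where ij: "i < n" "j < n" "x = r i" "y = r j" by auto
    have "r (\<alpha> i) = r (\<alpha> j)" using xy ij ti by (simp add: \<pi>_def)
    hence "\<alpha> i = \<alpha> j" using r_inj \<alpha>n ij by (auto dest: inj_onD)
    thus "x = y" using ij permutes_inj[OF assms] by (simp add: inj_eq)
  qed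
  moreover have "\<pi> ` R \<subseteq> R"
  proof
    fix y assume "y \<in> \<pi> ` R"
    hence "y \<in> \<pi> ` r ` {..<n}" by (simp only: r_range)
    then obtain i where i: "i < n" "y = \<pi> (r i)" by auto
    hence "r i \<in> R" "r (\<alpha> i) \<in> R" using r_range \<alpha>n by auto
    thus "y \<in> R" using i ti by (simp add: \<pi>_def)
  qed
  ultimately have "bij_betw \<pi> R R" using finite_R by (simp add: bij_betw_def endo_inj_surj)
  hence "\<pi> permutes R" by (rule bij_imp_permutes) (simp add: \<pi>_def)
  from full[OF this[unfolded R_def]] obtain \<sigma> where
    s': "\<sigma> \<in> homs_over (range to_ac)" "\<forall>x. poly (map_poly incl f) x = 0 \<longrightarrow> \<sigma> x = \<pi> x" by (rule bexE)
  hence s: "\<sigma> \<in> homs_over (range to_ac)" "\<And>x. x \<in> R \<Longrightarrow> \<sigma> x = \<pi> x" by (simp_all add: R_def)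
  have "\<sigma> (r i) = r (\<alpha> i)" if "i < n" for i
  proof -
    have "r i \<in> R" using r_range that by auto
    thus ?thesis using s(2) ti[OF that] by (simp add: \<pi>_def)
  qed
  with s(1) show thesis by (rule that)
qed

lemma C_hom: "field_hom C"
proof -
  have k: "[:x + y:] = [:x:] + [:y:]" "[:x * y:] = [:x:] * [:y:]" "[:1::'w:] = 1" for x y :: 'w
    by simp_all
  show ?thesis by unfold_locales (simp_all only: C_def k incl_simps, simp_all)
qed

lemma C_fixed: "\<sigma> \<in> homs_over (range to_ac) \<Longrightarrow> \<sigma> (C a) = C a"
  by (simp add: C_def homs_over_def)

lemma z_hom:
  assumes s: "\<sigma> \<in> homs_over (range to_ac)" and \<alpha>: "\<alpha> permutes {..<n}" "\<And>i. i < n \<Longrightarrow> \<sigma> (r i) = r (\<alpha> i)"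
  shows "\<sigma> (z \<tau>) = z (\<tau> \<circ> inv_into UNIV \<alpha>)"
proof -
  interpret field_hom \<sigma> using s by (simp add: homs_over_def)
  have "\<sigma> (z \<tau>) = (\<Sum>i<n. C (\<theta> (\<tau> i)) * r (\<alpha> i))"
    unfolding z_def hom_sum hom_mult using C_fixed[OF s] \<alpha>(2) by (intro sum.cong) auto
  also have "\<dots> = z (\<tau> \<circ> inv_into UNIV \<alpha>)" unfolding z_def by (subst permuted_sum[OF \<alpha>(1)]) simp
  finally show ?thesis .
qed

lemma sum_R_nz: "n \<ge> 2 \<Longrightarrow> (\<Sum>i<n. r i) \<noteq> 0"
proof
  assume n: "n \<ge> 2" and z: "(\<Sum>i<n. r i) = 0"
  have "card R = n" using card_roots by (simp add: R_def)
  hence "coeff (map_poly incl f) (n - 1) = - (\<Sum>x\<in>R. x)"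
    unfolding map_f_split using prod_linear_subleading[OF finite_R] n by fastforce
  also have "(\<Sum>x\<in>R. x) = (\<Sum>i<n. r i)" using sum.reindex_bij_betw[OF r_bij, of "\<lambda>x. x"] by simp
  finally have "coeff f (n - 1) = 0" using z by (simp add: coeff_map_poly)
  with trace[OF n] show False by simp
qed

text \<open>From \<open>z \<tau> = z \<tau>'\<close> comes a relation between the roots with
  constant coefficients \<open>c i\<close>. Swapping \<open>r a\<close> and \<open>r b\<close> and
  subtracting leaves \<open>(c a - c b) * (r b - r a) = 0\<close>, so all \<open>c i\<close> agree;
  their common value is nonzero, hence the sum of the roots would vanish.\<close>

lemma z_inj: "inj_on z Perm"
proof (rule inj_onI, rule ccontr)
  fix \<tau> \<tau>' assume P: "\<tau> \<in> Perm" "\<tau>' \<in> Perm" "z \<tau> = z \<tau>'" "\<tau> \<noteq> \<tau>'"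
  define c where "c i = C (\<theta> (\<tau> i)) - C (\<theta> (\<tau>' i))" for i
  have c0: "(\<Sum>i<n. c i * r i) = 0"
    using P(3) unfolding z_def c_def left_diff_distrib sum_subtractf by (simp only: right_minus_eq)
  have eq: "c a = c b" if ab: "a < n" "b < n" for a b
  proof (cases "a = b")
    case False
    define t where "t = Transposition.transpose a b"
    have t: "t permutes {..<n}" unfolding t_def using ab by (intro permutes_swap_id) auto
    obtain \<sigma> where s: "\<sigma> \<in> homs_over (range to_ac)" "\<And>i. i < n \<Longrightarrow> \<sigma> (r i) = r (t i)"
      using hom_exists[OF t] by blast
    interpret field_hom \<sigma> using s by (simp add: homs_over_def)
    have "\<sigma> (c i) = c i" for i unfolding c_def hom_minus using C_fixed[OF s(1)] by simp
    hence "\<sigma> (\<Sum>i<n. c i * r i) = (\<Sum>i<n. c i * r (t i))" unfolding hom_sum hom_mult using s(2) by (intro sum.cong) auto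
    hence "(\<Sum>i<n. c i * r (t i)) = 0" unfolding c0 by simp
    hence "(\<Sum>i<n. c i * (r (t i) - r i)) = 0" unfolding right_diff_distrib sum_subtractf c0 by simp
    also have "(\<Sum>i<n. c i * (r (t i) - r i)) = (\<Sum>i\<in>{a,b}. c i * (r (t i) - r i))"
      using ab by (intro sum.mono_neutral_right) (auto simp: t_def transpose_def)
    also have "\<dots> = (c a - c b) * (r b - r a)" using False by (simp add: t_def algebra_simps)
    finally have "c a = c b \<or> r b = r a" by simp
    moreover have "r b \<noteq> r a" using inj_on_eq_iff[OF r_inj, of b a] ab False by simp
    ultimately show ?thesis by blast
  qed simp
  have "\<exists>i. \<tau> i \<noteq> \<tau>' i" using P(4) by auto
  then obtain a where a: "\<tau> a \<noteq> \<tau>' a" by blast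
  have an: "a < n"
  proof (rule ccontr)
    assume "\<not> a < n"
    hence "\<tau> a = a" "\<tau>' a = a"
      using P(1,2) permutes_not_in[of \<tau> "{..<n}" a] permutes_not_in[of \<tau>' "{..<n}" a] by (simp_all add: Perm_def)
    with a show False by simp
  qed
  have tn: "\<tau> a < n" "\<tau>' a < n" by (rule Perm_lt[OF P(1) an], rule Perm_lt[OF P(2) an])
  hence n: "n \<ge> 2" using a by auto
  have "\<theta> (\<tau> a) \<noteq> \<theta> (\<tau>' a)" using a tn inj_on_eq_iff[OF \<theta>_inj, of "\<tau> a" "\<tau>' a"] by simp
  hence ca: "c a \<noteq> 0" unfolding c_def using field_hom_inj[OF C_hom] by simp
  have "(\<Sum>i<n. c a * r i) = (\<Sum>i<n. c i * r i)" by (intro sum.cong refl) (use eq[OF an] in simp)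
  hence "c a * (\<Sum>i<n. r i) = 0" unfolding c0 by (simp only: sum_distrib_left)
  thus False using ca sum_R_nz[OF n] by simp
qed

text \<open>Over the algebraically closed constants only the \<open>r i\<close> move, and
  renumbering them by \<open>\<alpha>\<close> turns \<open>\<tau>\<close> into
  \<open>\<tau> o \<alpha>^-1\<close>; so the \<open>z \<tau>\<close> form a single orbit. The
  irreducibility of the resolvent rests on this.\<close>

lemma z_roots:
  assumes h: "h \<in> polys (range to_ac)" "\<tau> \<in> Perm" "poly h (z \<tau>) = 0" and \<tau>': "\<tau>' \<in> Perm"
  shows "poly h (z \<tau>') = 0"
proof -
  define \<alpha> where "\<alpha> = inv_into UNIV \<tau>' \<circ> \<tau>"
  have p: "\<tau> permutes {..<n}" "\<tau>' permutes {..<n}" using assms by (auto simp: Perm_def)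
  have \<alpha>: "\<alpha> permutes {..<n}" unfolding \<alpha>_def by (intro permutes_compose permutes_inv p)
  have t: "\<tau> x = \<tau>' (\<alpha> x)" for x using permutes_inverses(1)[OF p(2)] by (simp add: \<alpha>_def)
  have "\<tau> \<circ> inv_into UNIV \<alpha> = \<tau>'" using permutes_inverses(1)[OF \<alpha>] by (simp add: fun_eq_iff t)
  moreover obtain \<sigma> where s: "\<sigma> \<in> homs_over (range to_ac)" "\<And>i. i < n \<Longrightarrow> \<sigma> (r i) = r (\<alpha> i)"
    using hom_exists[OF \<alpha>] by blast
  ultimately have "\<sigma> (z \<tau>) = z \<tau>'" using z_hom[OF s(1) \<alpha> s(2)] by simp
  thus ?thesis using homs_over_root[OF s(1) h(1), of "z \<tau>"] h(3) by simp
qed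

lemma degree_resolvent: "degree resolvent = card Perm" "lead_coeff resolvent = 1"
  unfolding resolvent_def by (subst degree_prod_eq_sum_degree) (auto simp: lead_coeff_prod)

lemma resolvent_alt: "resolvent = (\<Prod>y\<in>z ` Perm. [:-y,1:])"
  unfolding resolvent_def using z_inj by (simp add: prod.reindex)

lemma resolvent_rsquarefree: "rsquarefree resolvent"
  unfolding resolvent_alt using finite_Perm by (intro rsquarefree_prod_linear) auto

lemma resolvent_root: "poly resolvent (z \<tau>) = 0" if "\<tau> \<in> Perm"
  unfolding resolvent_def poly_prod using finite_Perm that by auto

text \<open>An endomorphism over \<open>M(X)\<close> may move the constants too: it permutes the
  \<open>r i\<close> by some \<open>\<alpha>\<close> and the \<open>\<theta> i\<close> by some
  \<open>\<beta>\<close>, hence sends \<open>z \<tau>\<close> to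
  \<open>z (\<beta> o \<tau> o \<alpha>^-1)\<close>. The set of twisted sums is preserved, so the
  coefficients are fixed.\<close>

lemma resolvent_coeffs: "resolvent \<in> polys (fracs M)"
proof -
  note F = subfld_fracs[OF M]
  define A where "A = C ` \<theta> ` {..<n} \<union> R"
  note G = subfld_gen_fld[of "fracs M" A]
  have A: "finite A" using finite_R by (simp add: A_def)
  have Cpoly: "C a \<in> fracs M" if "a \<in> M" for a unfolding C_def using that by (intro incl_fracs M polys_const)
  from \<theta>_sep obtain p where p: "p \<in> polys M" "rsquarefree p" "{a. poly p a = 0} = \<theta> ` {..<n}" by (elim bexE conjE)
  interpret C: field_hom C by (rule C_hom)
  define p' where "p' = map_poly C p"
  have p': "p' \<in> polys (fracs M)" unfolding p'_def by (intro polysI) (simp add: Cpoly polysD[OF p(1)])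
  have p_split: "p = smult (lead_coeff p) (\<Prod>a\<in>\<theta> ` {..<n}. [:-a,1:])" using rsquarefree_split(1)[OF p(2)] p(3) by simp
  have lp: "lead_coeff p \<noteq> 0" using p(2) by (auto simp: rsquarefree_def)
  have "p' = smult (C (lead_coeff p)) (map_poly C (\<Prod>a\<in>\<theta> ` {..<n}. [:-a,1:]))"
    unfolding p'_def C.map_poly_hom_smult[symmetric] by (rule arg_cong[OF p_split])
  also have "map_poly C (\<Prod>a\<in>\<theta> ` {..<n}. [:-a,1:]) = (\<Prod>a\<in>\<theta> ` {..<n}. [:-C a,1:])"
    by (rule map_poly_prod_linear[OF C_hom])
  also have "\<dots> = (\<Prod>a\<in>C ` \<theta> ` {..<n}. [:-a,1:])"
    by (subst prod.reindex[of C]) (auto simp: inj_on_def)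
  finally have p'_split: "p' = smult (C (lead_coeff p)) (\<Prod>a\<in>C ` \<theta> ` {..<n}. [:-a,1:])" .
  have p'_root: "poly p' x = 0 \<longleftrightarrow> x \<in> C ` \<theta> ` {..<n}" for x unfolding p'_split using lp by (auto simp: poly_prod)
  have "rsquarefree p'"
  proof -
    have "p' dvd (\<Prod>a\<in>C ` \<theta> ` {..<n}. [:-a,1:])" unfolding p'_split using lp by (intro smult_dvd) auto
    thus ?thesis using rsquarefree_dvd rsquarefree_prod_linear[of "C ` \<theta> ` {..<n}"] by blast
  qed
  hence sepC: "sep_over (fracs M) x" if "x \<in> C ` \<theta> ` {..<n}" for x
    unfolding sep_over_def by (intro bexI[OF _ p'] conjI) (simp_all only: p'_root that)
  have f': "map_poly incl f \<in> polys (fracs M)"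
    by (intro polysI) (simp add: coeff_map_poly incl_fracs[OF M f_coeff])
  have sepR: "sep_over (fracs M) x" if "x \<in> R" for x
    unfolding sep_over_def by (intro bexI[OF _ f'] conjI map_f_rsquarefree) (use that in \<open>simp add: R_def\<close>)
  have zG: "z \<tau> \<in> gen_fld (fracs M) A" if "\<tau> \<in> Perm" for \<tau>
    unfolding z_def
  proof (intro subfld_sum[OF G] subfld_mult[OF G])
    fix i assume i: "i \<in> {..<n}"
    hence "\<tau> i < n" using Perm_lt[OF that] by simp
    thus "C (\<theta> (\<tau> i)) \<in> gen_fld (fracs M) A" using gen_fld_gens[of A "fracs M"] by (auto simp: A_def)
    show "r i \<in> gen_fld (fracs M) A" using i r_range gen_fld_gens[of A "fracs M"] by (auto simp: A_def)
  qed
  have RG: "resolvent \<in> polys (gen_fld (fracs M) A)" unfolding resolvent_def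
    using zG by (intro polys_prod[OF G] polys_pCons[OF G] subfld_uminus[OF G] polys_0[OF G] subfld_1[OF G]) auto
  show ?thesis
  proof (rule polysI)
    fix k
    show "coeff resolvent k \<in> fracs M"
    proof (rule fixed_gen_fld[OF A F alg_over_fracs[OF M alg]])
      show "coeff resolvent k \<in> gen_fld (fracs M) A" by (rule polysD[OF RG])
      show "sep_over (fracs M) a" if "a \<in> A" for a using that sepC sepR by (auto simp: A_def)
      fix \<sigma> assume s: "\<sigma> \<in> homs_over (fracs M)"
      interpret field_hom \<sigma> using s by (simp add: homs_over_def)
      have inj: "inj \<sigma>" by (auto simp: inj_def)
      obtain \<alpha> where \<alpha>: "\<alpha> permutes {..<n}" "\<And>i. i < n \<Longrightarrow> \<sigma> (r i) = r (\<alpha> i)"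
      proof (rule induced_permutation[OF r_inj _ inj])
        fix i assume "i < n"
        hence "r i \<in> R" using r_range by auto
        thus "\<sigma> (r i) \<in> r ` {..<n}" using homs_over_root[OF s f'] r_range by (simp add: R_def)
      qed blast
      have Cinj: "inj_on (\<lambda>i. C (\<theta> i)) {..<n}" using \<theta>_inj by (auto simp: inj_on_def)
      obtain \<beta> where \<beta>: "\<beta> permutes {..<n}" "\<And>i. i < n \<Longrightarrow> \<sigma> (C (\<theta> i)) = C (\<theta> (\<beta> i))"
      proof (rule induced_permutation[OF Cinj _ inj])
        fix i assume "i < n"
        hence "poly p' (C (\<theta> i)) = 0" using p'_root by auto
        hence "poly p' (\<sigma> (C (\<theta> i))) = 0" using homs_over_root[OF s p'] by simp
        thus "\<sigma> (C (\<theta> i)) \<in> (\<lambda>i. C (\<theta> i)) ` {..<n}" using p'_root by auto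
      qed blast
      define \<Phi> where "\<Phi> \<tau> = \<beta> \<circ> \<tau> \<circ> inv_into UNIV \<alpha>" for \<tau>
      have ia: "inv_into UNIV \<alpha> permutes {..<n}" by (rule permutes_inv[OF \<alpha>(1)])
      have zs: "\<sigma> (z \<tau>) = z (\<Phi> \<tau>)" if "\<tau> \<in> Perm" for \<tau>
      proof -
        have "\<tau> i < n" if "i < n" for i using Perm_lt[OF \<open>\<tau> \<in> Perm\<close> that] .
        hence "\<sigma> (z \<tau>) = (\<Sum>i<n. C (\<theta> (\<beta> (\<tau> i))) * r (\<alpha> i))"
          unfolding z_def hom_sum hom_mult using \<alpha>(2) \<beta>(2) by (intro sum.cong) auto
        also have "\<dots> = z (\<Phi> \<tau>)" unfolding z_def \<Phi>_def by (subst permuted_sum[OF \<alpha>(1)]) simp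
        finally show ?thesis .
      qed
      have \<Phi>P: "\<Phi> \<tau> \<in> Perm" if "\<tau> \<in> Perm" for \<tau>
        using that unfolding Perm_def \<Phi>_def by (auto intro!: permutes_compose ia \<beta>(1))
      have "inj_on \<sigma> (z ` Perm)" by (auto simp: inj_on_def)
      moreover have "\<sigma> ` (z ` Perm) = z ` Perm"
      proof (rule card_subset_eq)
        show "\<sigma> ` z ` Perm \<subseteq> z ` Perm" using zs \<Phi>P by auto
        show "card (\<sigma> ` z ` Perm) = card (z ` Perm)" by (rule card_image) (auto simp: inj_on_def)
      qed (use finite_Perm in simp)
      moreover have "map_poly \<sigma> resolvent = (\<Prod>y\<in>z ` Perm. [:- \<sigma> y,1:])"
        unfolding resolvent_alt by (rule map_poly_prod_linear) unfold_locales
      ultimately have "map_poly \<sigma> resolvent = resolvent"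
        unfolding resolvent_alt using prod.reindex[of \<sigma> "z ` Perm" "\<lambda>y. [:-y,1:]"] by simp
      thus "\<sigma> (coeff resolvent k) = coeff resolvent k" by (metis coeff_map_poly_hom)
    qed
  qed
qed

end

section \<open>Irreducibility of the resolvent and its specializations\<close>

lemma smult_cancel: "(a::'a::field) \<noteq> 0 \<Longrightarrow> smult a p = smult a q \<Longrightarrow> p = q"
proof -
  assume "a \<noteq> 0" "smult a p = smult a q"
  hence "smult (inverse a) (smult a p) = smult (inverse a) (smult a q)" by simp
  thus "p = q" using \<open>a \<noteq> 0\<close> by simp
qed

context twisted_cover
begin

text \<open>Taking the common denominator of least degree makes the coefficients coprime over the
  algebraic closure: the minimal polynomial over \<open>M\<close> of a common root could be cancelled.\<close>

lemma primitive_resolvent: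
  obtains D g where "D \<in> polys M" "D \<noteq> 0" "\<And>i. coeff g i \<in> polys M"
    "map_poly incl g = smult (incl D) resolvent" "\<And>c. \<exists>i. poly (coeff g i) c \<noteq> 0"
proof -
  define Q where "Q D g \<longleftrightarrow> D \<in> polys M \<and> D \<noteq> 0 \<and> (\<forall>i. coeff g i \<in> polys M) \<and>
    map_poly incl g = smult (incl D) resolvent" for D g
  have "\<exists>D g. Q D g" unfolding Q_def by (rule clear_denominators[OF M resolvent_coeffs])
  then obtain D0 g0 where "Q D0 g0" by blast
  hence "case (D0, g0) of (D, g) \<Rightarrow> Q D g" by simp
  from ex_has_least_nat[of "\<lambda>(D, g). Q D g", OF this, of "\<lambda>(D, g). degree D"]
  obtain D g where Dg: "Q D g" and least: "\<And>D' g'. Q D' g' \<Longrightarrow> degree D \<le> degree D'" by auto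
  note q = Dg[unfolded Q_def]
  have inclD: "coeff g (degree resolvent) = D"
  proof -
    have "coeff (map_poly incl g) (degree resolvent) = incl D" using q degree_resolvent by simp
    thus ?thesis by (simp add: coeff_map_poly)
  qed
  have "\<exists>i. poly (coeff g i) c \<noteq> 0" for c
  proof (rule ccontr)
    assume "\<not> (\<exists>i. poly (coeff g i) c \<noteq> 0)"
    hence c: "poly (coeff g i) c = 0" for i by blast
    obtain \<mu> where m: "\<mu> \<in> polys M" "lead_coeff \<mu> = 1" "poly \<mu> c = 0" "degree \<mu> > 0"
      "\<And>h. h \<in> polys M \<Longrightarrow> poly h c = 0 \<Longrightarrow> \<exists>s\<in>polys M. h = \<mu> * s"
      using minimal_polynomial[OF M alg[of c]] by blast
    have m0: "\<mu> \<noteq> 0" using m(4) by auto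
    define g' where "g' = map_poly (\<lambda>p. p div \<mu>) g"
    have g': "coeff g i = \<mu> * coeff g' i \<and> coeff g' i \<in> polys M" for i
    proof -
      obtain s where s: "s \<in> polys M" "coeff g i = \<mu> * s" using m(5)[OF _ c] q by blast
      have "coeff g' i = s" using s(2) m0 by (simp add: g'_def coeff_map_poly)
      thus ?thesis using s by simp
    qed
    define D' where "D' = coeff g' (degree resolvent)"
    have D': "D = \<mu> * D'" using g'[of "degree resolvent"] inclD by (simp add: D'_def)
    have nz: "D' \<noteq> 0" using D' q by auto
    have "g = smult \<mu> g'" by (rule poly_eqI) (use g' in simp)
    hence "smult (incl \<mu>) (map_poly incl g') = smult (incl \<mu>) (smult (incl D') resolvent)"
      using q unfolding D' by (simp add: map_poly_incl_smult)
    moreover have "incl \<mu> \<noteq> 0" using m0 by simp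
    ultimately have "map_poly incl g' = smult (incl D') resolvent" by (rule smult_cancel[rotated])
    moreover have "D' \<in> polys M" using g' by (simp add: D'_def)
    ultimately have "Q D' g'" unfolding Q_def using nz g' by blast
    hence "degree D \<le> degree D'" by (rule least)
    moreover have "degree D = degree \<mu> + degree D'" unfolding D' using m0 nz by (rule degree_mult_eq)
    ultimately show False using m(4) by simp
  qed
  thus thesis using that q by blast
qed

text \<open>A factor vanishing at \<open>z id\<close> vanishes at all conjugates and has full degree
  in \<open>Y\<close>, so the other factor depends on \<open>X\<close> alone; a root of it would be
  a common zero of all coefficients of \<open>g\<close>. As the constants are algebraically closed,
  this is absolute irreducibility. The derivative is nonzero because the resolvent is
  squarefree.\<close>

lemma resolvent_irreducible:
  assumes D: "D \<noteq> 0" and g: "map_poly incl g = smult (incl D) resolvent" and c: "\<And>c. \<exists>i. poly (coeff g i) c \<noteq> 0"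
  shows "irreducible g" "pderiv g \<noteq> 0"
proof -
  have cP: "card Perm \<ge> 1" using finite_Perm Perm_id by (metis card_0_eq empty_iff less_one not_le)
  have dinc: "degree (map_poly incl p) = degree p" for p :: "'w poly poly"
    by (rule degree_map_poly) auto
  have deg: "degree g = card Perm" using arg_cong[OF g, of degree] D by (simp add: dinc degree_resolvent)
  have g0: "g \<noteq> 0" using deg cP by auto
  have const: "B dvd 1" if AB: "g = A * B" and A: "poly (map_poly incl A) (z id) = 0" for A B
  proof -
    have nz: "A \<noteq> 0" "B \<noteq> 0" using AB g0 by auto
    have "z ` Perm \<subseteq> {x. poly (map_poly incl A) x = 0}"
      using z_roots[OF polys_range_to_ac Perm_id A] by auto
    moreover have A0: "map_poly incl A \<noteq> 0" using map_poly_incl_inj[of A 0] nz by auto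
    ultimately have "card (z ` Perm) \<le> degree (map_poly incl A)"
      using card_mono[OF poly_roots_finite[OF A0]] card_poly_roots_bound[OF A0] order_trans by blast
    hence "card Perm \<le> degree A" using z_inj by (simp add: card_image dinc)
    moreover have "degree g = degree A + degree B" unfolding AB using nz by (rule degree_mult_eq)
    ultimately have "degree B = 0" using deg by simp
    then obtain b where b: "B = [:b:]" by (metis degree_0_id)
    have "degree b = 0"
    proof (rule ccontr)
      assume "degree b \<noteq> 0"
      then obtain x where "poly b x = 0" using alg_closed_imp_poly_has_root[of b] by auto
      hence "poly (coeff g i) x = 0" for i unfolding AB b by simp
      thus False using c[of x] by simp
    qed
    then obtain u where u: "b = [:u:]" by (metis degree_0_id)
    have "u \<noteq> 0" using nz b u by auto
    thus ?thesis unfolding b u by (simp add: is_unit_const_poly_iff)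
  qed
  show "irreducible g"
  proof (rule Factorial_Ring.irreducibleI)
    show "g \<noteq> 0" by (rule g0)
    show "\<not> g dvd 1" using dvd_imp_degree_le[of g 1] deg cP by auto
    fix A B assume AB: "g = A * B"
    have "poly (map_poly incl g) (z id) = 0" unfolding g using resolvent_root[OF Perm_id] by simp
    hence "poly (map_poly incl A) (z id) = 0 \<or> poly (map_poly incl B) (z id) = 0"
      unfolding AB map_poly_incl_mult by simp
    thus "A dvd 1 \<or> B dvd 1" using const[OF AB] const[of B A] AB by (auto simp: mult.commute)
  qed
  have "resolvent \<noteq> 0" using degree_resolvent(2) by auto
  hence "poly (pderiv resolvent) (z id) \<noteq> 0"
    using resolvent_rsquarefree resolvent_root[OF Perm_id] rsquarefree_iff_pderiv by blast
  show "pderiv g \<noteq> 0"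
  proof
    assume "pderiv g = 0"
    hence "pderiv (map_poly incl g) = 0" by (simp flip: map_poly_incl_pderiv)
    hence "smult (incl D) (pderiv resolvent) = 0" unfolding g by (simp only: pderiv_smult)
    hence "pderiv resolvent = 0" using D by simp
    with \<open>poly (pderiv resolvent) (z id) \<noteq> 0\<close> show False by simp
  qed
qed

text \<open>At a point where \<open>f\<close> keeps \<open>n\<close> distinct roots these are power
  series by \<open>place_unramified\<close>; taking constant terms in the factorization of the
  resolvent replaces each \<open>r i\<close> by the specialized root
  \<open>\<rho> i\<close>.\<close>

lemma resolvent_specialization:
  assumes g: "map_poly incl g = smult (incl D) resolvent" and x: "card {s. poly (ev x f) s = 0} = n"
  obtains \<rho> where "bij_betw \<rho> {..<n} {s. poly (ev x f) s = 0}"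
    "ev x g = smult (poly D x) (\<Prod>\<tau>\<in>Perm. [:- (\<Sum>i<n. \<theta> (\<tau> i) * \<rho> i), 1:])"
proof -
  have card: "card {s. poly (ev x f) s = 0} = degree f" using x f_deg by simp
  obtain \<Psi> rr where P: "field_hom \<Psi>" "\<And>p. \<Psi> (incl p) = incl (expand x p)"
    "\<And>y. y \<in> {x. poly (map_poly incl f) x = 0} \<Longrightarrow> \<Psi> y = incl (rr y)"
    "bij_betw (\<lambda>y. rr y $ 0) {x. poly (map_poly incl f) x = 0} {s. poly (ev x f) s = 0}"
    by (rule place_unramified[OF f_monic card]) (rule that)
  interpret \<Psi>: field_hom \<Psi> by fact
  interpret mp: map_poly_idom_hom \<Psi> ..
  interpret e: idom_hom "expand x" by (rule expand_hom)
  interpret i: idom_hom "incl :: 'w fps \<Rightarrow> _" by (rule incl_hom)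
  interpret mi: map_poly_idom_hom "incl :: 'w fps \<Rightarrow> _" ..
  define \<rho> where "\<rho> i = rr (r i) $ 0" for i
  have bij: "bij_betw \<rho> {..<n} {s. poly (ev x f) s = 0}"
    using bij_betw_trans[OF r_bij P(4)[folded R_def]] unfolding o_def \<rho>_def[abs_def] .
  have Pr: "\<Psi> (r i) = incl (rr (r i))" if "i < n" for i
  proof -
    have "r i \<in> R" using r_range that by auto
    thus ?thesis using P(3) by (simp add: R_def)
  qed
  have ec: "expand x [:a:] = fps_const a" for a by (simp add: expand_def pcompose_pCons fps_of_poly_const)
  define w where "w \<tau> = (\<Sum>i<n. fps_const (\<theta> (\<tau> i)) * rr (r i))" for \<tau>
  have Pz: "\<Psi> (z \<tau>) = incl (w \<tau>)" for \<tau>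
  proof -
    have "\<Psi> (z \<tau>) = (\<Sum>i<n. \<Psi> (C (\<theta> (\<tau> i))) * \<Psi> (r i))" unfolding z_def by (simp add: \<Psi>.hom_sum \<Psi>.hom_mult)
    also have "\<dots> = (\<Sum>i<n. incl (fps_const (\<theta> (\<tau> i))) * incl (rr (r i)))"
      by (intro sum.cong) (simp_all add: C_def P(2) ec Pr)
    also have "\<dots> = incl (w \<tau>)" unfolding w_def by (simp only: i.hom_sum i.hom_mult)
    finally show ?thesis .
  qed
  define g' where "g' = map_poly (expand x) g"
  have "map_poly incl g' = map_poly \<Psi> (map_poly incl g)"
    by (rule poly_eqI) (simp add: g'_def coeff_map_poly P)
  also have "\<dots> = smult (incl (expand x D)) (map_poly \<Psi> resolvent)"
    unfolding g \<Psi>.map_poly_hom_smult P(2) ..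
  also have "map_poly \<Psi> resolvent = (\<Prod>\<tau>\<in>Perm. [:- incl (w \<tau>), 1:])"
    unfolding resolvent_def map_poly_prod_linear[OF P(1)] Pz ..
  also have "\<dots> = map_poly incl (\<Prod>\<tau>\<in>Perm. [:- w \<tau>, 1:])"
    by (simp add: mi.hom_prod map_poly_pCons_0)
  also have "smult (incl (expand x D)) \<dots> = map_poly incl (smult (expand x D) (\<Prod>\<tau>\<in>Perm. [:- w \<tau>, 1:]))"
    by (simp only: map_poly_incl_smult)
  finally have eq: "g' = smult (expand x D) (\<Prod>\<tau>\<in>Perm. [:- w \<tau>, 1:])" by (rule map_poly_incl_inj)
  have "ev x g = red g'" unfolding g'_def by (rule poly_eqI) (simp add: coeff_map_poly expand_nth_0)
  also have "\<dots> = red [:expand x D:] * (\<Prod>\<tau>\<in>Perm. red [:- w \<tau>, 1:])"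
    unfolding eq red_prod[symmetric] red_mult[symmetric] by simp
  also have "red [:expand x D:] = [:poly D x:]" by (simp add: map_poly_pCons_0 expand_nth_0)
  also have "(\<Prod>\<tau>\<in>Perm. red [:- w \<tau>, 1:]) = (\<Prod>\<tau>\<in>Perm. [:- (\<Sum>i<n. \<theta> (\<tau> i) * \<rho> i), 1:])"
    by (intro prod.cong refl) (simp add: map_poly_pCons_0 w_def fps_sum_nth \<rho>_def)
  finally have "ev x g = smult (poly D x) (\<Prod>\<tau>\<in>Perm. [:- (\<Sum>i<n. \<theta> (\<tau> i) * \<rho> i), 1:])" by simp
  with bij show thesis by (rule that)
qed

text \<open>An endomorphism over \<open>M\<close> fixes the simple root \<open>y\<close>, which is
  the twisted sum of exactly one \<open>\<tau>\<close>, so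
  \<open>\<beta> o \<tau> o \<alpha>^-1 = \<tau>\<close>: it permutes the \<open>\<rho> i\<close> as
  it permutes the \<open>\<theta> j\<close>, up to the renumbering \<open>\<tau>\<close>. Moving a
  root of \<open>h1\<close> to a root of \<open>h2\<close> in this way makes the latter a double
  root of the product.\<close>

lemma specialization_irreducible:
  assumes g: "map_poly incl g = smult (incl D) resolvent" and x: "x \<in> M" "card {s. poly (ev x f) s = 0} = n"
    and D: "poly D x \<noteq> 0" and y: "y \<in> M" "poly (ev x g) y = 0" "poly (pderiv (ev x g)) y \<noteq> 0"
    and h: "h1 \<in> polys M" "h2 \<in> polys M" "ev x f = h1 * h2"
  shows "degree h1 = 0 \<or> degree h2 = 0"
proof (rule ccontr)
  assume nd: "\<not> (degree h1 = 0 \<or> degree h2 = 0)"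
  define S where "S = {s. poly (ev x f) s = 0}"
  obtain \<rho> where \<rho>: "bij_betw \<rho> {..<n} S"
    and eg: "ev x g = smult (poly D x) (\<Prod>\<tau>\<in>Perm. [:- (\<Sum>i<n. \<theta> (\<tau> i) * \<rho> i), 1:])"
    by (rule resolvent_specialization[OF g x(2), folded S_def]) (rule that)
  have \<rho>_inj: "inj_on \<rho> {..<n}" and \<rho>_range: "\<rho> ` {..<n} = S" using \<rho> by (auto simp: bij_betw_def)
  define \<zeta> where "\<zeta> \<tau> = (\<Sum>i<n. \<theta> (\<tau> i) * \<rho> i)" for \<tau>
  have eg': "ev x g = smult (poly D x) (\<Prod>\<tau>\<in>Perm. [:- \<zeta> \<tau>, 1:])" unfolding eg \<zeta>_def ..
  obtain \<tau> where \<tau>: "\<tau> \<in> Perm" "y = \<zeta> \<tau>"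
    using y(2) D finite_Perm unfolding eg' by (auto simp: poly_prod)
  \<comment> \<open>Two permutations with the same sum would make \<open>y\<close> a multiple root
    of \<open>ev x g\<close>.\<close>
  have uniq: "\<tau>' = \<tau>" if t: "\<tau>' \<in> Perm" "y = \<zeta> \<tau>'" for \<tau>'
  proof (rule ccontr)
    assume ne: "\<tau>' \<noteq> \<tau>"
    have "(\<Prod>\<tau>\<in>Perm. [:- \<zeta> \<tau>, 1:]) = [:- y, 1:] * (\<Prod>\<tau>\<in>Perm - {\<tau>}. [:- \<zeta> \<tau>, 1:])"
      unfolding \<tau>(2) by (rule prod.remove[OF finite_Perm \<tau>(1)])
    hence "poly (pderiv (\<Prod>\<tau>\<in>Perm. [:- \<zeta> \<tau>, 1:])) y = poly (\<Prod>\<tau>\<in>Perm - {\<tau>}. [:- \<zeta> \<tau>, 1:]) y"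
      by (metis poly_pderiv_linear_mult)
    also have "\<dots> = 0" using finite_Perm t ne by (auto simp: poly_prod)
    finally show False using y(3) unfolding eg' by (simp add: pderiv_smult)
  qed
  obtain a where a: "poly h1 a = 0" using alg_closed_imp_poly_has_root[of h1] nd by auto
  obtain b where b: "poly h2 b = 0" using alg_closed_imp_poly_has_root[of h2] nd by auto
  have "a \<in> S" "b \<in> S" using a b h(3) by (auto simp: S_def)
  then obtain i j where ij: "i < n" "j < n" "a = \<rho> i" "b = \<rho> j" using \<rho>_range by auto
  \<comment> \<open>The endomorphism is chosen by its effect on the \<open>\<theta>\<close> alone;
    the equation between \<open>\<alpha>\<close>, \<open>\<beta>\<close> and \<open>\<tau>\<close>
    will force it to send \<open>a\<close> to \<open>b\<close>.\<close>
  obtain \<sigma> where s: "\<sigma> \<in> homs_over M" "\<sigma> (\<theta> (\<tau> i)) = \<theta> (\<tau> j)"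
    using conjugate_hom[OF M alg, of "\<theta> (\<tau> i)" "\<theta> (\<tau> j)"] \<theta>_conj[OF Perm_lt[OF \<tau>(1) ij(1)] Perm_lt[OF \<tau>(1) ij(2)]]
    by blast
  interpret field_hom \<sigma> using s by (simp add: homs_over_def)
  have inj: "inj \<sigma>" by (auto simp: inj_def)
  have fx: "ev x f \<in> polys M" by (rule polysI) (simp add: coeff_map_poly poly_in_subfld[OF M f_coeff x(1)])
  obtain \<alpha> where \<alpha>: "\<alpha> permutes {..<n}" "\<And>i. i < n \<Longrightarrow> \<sigma> (\<rho> i) = \<rho> (\<alpha> i)"
  proof (rule induced_permutation[OF \<rho>_inj _ inj])
    fix i assume "i < n"
    hence "\<rho> i \<in> S" using \<rho>_range by auto
    thus "\<sigma> (\<rho> i) \<in> \<rho> ` {..<n}" unfolding \<rho>_range using homs_over_root[OF s(1) fx] by (simp add: S_def)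
  qed blast
  obtain p where p: "p \<in> polys M" "rsquarefree p" "{a. poly p a = 0} = \<theta> ` {..<n}" using \<theta>_sep by blast
  obtain \<beta> where \<beta>: "\<beta> permutes {..<n}" "\<And>i. i < n \<Longrightarrow> \<sigma> (\<theta> i) = \<theta> (\<beta> i)"
  proof (rule induced_permutation[OF \<theta>_inj _ inj])
    fix i assume "i < n"
    hence "poly p (\<theta> i) = 0" using p(3) by auto
    hence "poly p (\<sigma> (\<theta> i)) = 0" using homs_over_root[OF s(1) p(1)] by simp
    thus "\<sigma> (\<theta> i) \<in> \<theta> ` {..<n}" using p(3) by auto
  qed blast
  define \<tau>' where "\<tau>' = \<beta> \<circ> \<tau> \<circ> inv_into UNIV \<alpha>"
  have tp: "\<tau> permutes {..<n}" using \<tau>(1) by (simp add: Perm_def)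
  have "\<tau>' \<in> Perm" unfolding Perm_def \<tau>'_def mem_Collect_eq
    by (intro permutes_compose permutes_inv \<alpha>(1) \<beta>(1) tp)
  moreover have "y = \<zeta> \<tau>'"
  proof -
    have "y = \<sigma> y" using s(1) y(1) by (simp add: homs_over_def)
    also have "\<dots> = (\<Sum>i<n. \<sigma> (\<theta> (\<tau> i)) * \<sigma> (\<rho> i))" unfolding \<tau>(2) \<zeta>_def by (simp add: hom_sum hom_mult)
    also have "\<dots> = (\<Sum>i<n. \<theta> (\<beta> (\<tau> i)) * \<rho> (\<alpha> i))"
      using \<alpha>(2) \<beta>(2) Perm_lt[OF \<tau>(1)] by (intro sum.cong) auto
    also have "\<dots> = \<zeta> \<tau>'" unfolding \<zeta>_def \<tau>'_def by (subst permuted_sum[OF \<alpha>(1)]) simp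
    finally show ?thesis .
  qed
  ultimately have "\<tau>' = \<tau>" by (rule uniq)
  hence "\<tau>' (\<alpha> i) = \<tau> (\<alpha> i)" by simp
  hence bt: "\<beta> (\<tau> i) = \<tau> (\<alpha> i)" unfolding \<tau>'_def using permutes_inverses[OF \<alpha>(1)] by simp
  have "\<theta> (\<beta> (\<tau> i)) = \<theta> (\<tau> j)" using \<beta>(2)[OF Perm_lt[OF \<tau>(1) ij(1)]] s(2) by simp
  moreover have "\<beta> (\<tau> i) < n"
    using permutes_in_image[OF \<beta>(1), of "\<tau> i"] Perm_lt[OF \<tau>(1) ij(1)] by simp
  ultimately have "\<beta> (\<tau> i) = \<tau> j" using \<theta>_inj Perm_lt[OF \<tau>(1) ij(2)] by (auto dest: inj_onD)
  hence "\<alpha> i = j" using bt permutes_inj[OF tp] by (simp add: inj_eq)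
  hence "\<sigma> a = b" using \<alpha>(2)[OF ij(1)] ij by simp
  hence h1b: "poly h1 b = 0" using homs_over_root[OF s(1) h(1), of a] a by simp
  have "card S = degree (ev x f)" using x(2) degree_ev(1)[OF f_monic] f_deg by (simp add: S_def)
  have evnz: "ev x f \<noteq> 0" using degree_ev(2)[OF f_monic, of x] by (metis leading_coeff_0_iff zero_neq_one)
  obtain q1 where q1: "h1 = [:-b,1:] * q1" using h1b by (metis dvdE poly_eq_0_iff_dvd)
  obtain q2 where q2: "h2 = [:-b,1:] * q2" using b by (metis dvdE poly_eq_0_iff_dvd)
  define u where "u = [:-b,1:] * (q1 * q2)"
  have ef: "ev x f = [:-b,1:] * u" unfolding h(3) q1 q2 u_def by (simp only: mult_ac)
  have u0: "u \<noteq> 0" using ef evnz by auto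
  have "S \<subseteq> {s. poly u s = 0}" unfolding S_def ef by (auto simp: u_def)
  hence "card S \<le> card {s. poly u s = 0}" by (rule card_mono[OF poly_roots_finite[OF u0]])
  also have "\<dots> \<le> degree u" by (rule card_poly_roots_bound[OF u0])
  also have "\<dots> < degree (ev x f)" unfolding ef using u0 by (subst degree_mult_eq) auto
  finally show False using \<open>card S = degree (ev x f)\<close> by simp
qed

text \<open>\<open>B\<close> collects the zeros of the leading coefficient \<open>D\<close> and of
  the discriminants of \<open>f\<close> and \<open>g\<close>. That no specialization of
  \<open>g\<close> vanishes identically comes from primitivity and bounds the number of points above
  each \<open>x\<close>.\<close>

theorem specialization:
  obtains g B where "\<And>i. coeff g i \<in> polys M" "irreducible g" "pderiv g \<noteq> 0" "finite B"
    "\<And>x. ev x g \<noteq> 0"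
    "\<And>x y h1 h2. x \<in> M \<Longrightarrow> x \<notin> B \<Longrightarrow> y \<in> M \<Longrightarrow> poly (ev x g) y = 0 \<Longrightarrow>
      h1 \<in> polys M \<Longrightarrow> h2 \<in> polys M \<Longrightarrow> ev x f = h1 * h2 \<Longrightarrow> degree h1 = 0 \<or> degree h2 = 0"
    "\<And>x. x \<notin> B \<Longrightarrow> rsquarefree (ev x f)"
proof -
  obtain D g where Dg: "D \<in> polys M" "D \<noteq> 0" "\<And>i. coeff g i \<in> polys M"
    "map_poly incl g = smult (incl D) resolvent" "\<And>c. \<exists>i. poly (coeff g i) c \<noteq> 0"
    by (rule primitive_resolvent) (rule that)
  note irr = resolvent_irreducible[OF Dg(2,4,5)]
  have f0: "f \<noteq> 0" using f_monic by auto
  have g0: "g \<noteq> 0" using irr(2) by auto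
  obtain D1 where D1: "D1 \<noteq> 0" "\<And>x y. poly (ev x f) y = 0 \<Longrightarrow> poly (pderiv (ev x f)) y = 0 \<Longrightarrow> poly D1 x = 0"
  proof (rule discriminant[OF _ f0])
    show "poly (pderiv (map_poly incl f)) x \<noteq> 0" if "poly (map_poly incl f) x = 0" for x
      using map_f_rsquarefree[unfolded rsquarefree_iff_pderiv[OF map_f_nz]] that by simp
    fix D assume "D \<noteq> 0" "\<And>x y. poly (ev x f) y = 0 \<Longrightarrow> poly (pderiv (ev x f)) y = 0 \<Longrightarrow> poly D x = 0"
    thus thesis by (rule that)
  qed
  obtain D2 where D2: "D2 \<noteq> 0" "\<And>x y. poly (ev x g) y = 0 \<Longrightarrow> poly (pderiv (ev x g)) y = 0 \<Longrightarrow> poly D2 x = 0"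
  proof (rule discriminant[OF _ g0])
    have r0: "resolvent \<noteq> 0" using degree_resolvent(2) by auto
    show "poly (pderiv (map_poly incl g)) x \<noteq> 0" if "poly (map_poly incl g) x = 0" for x
      using resolvent_rsquarefree[unfolded rsquarefree_iff_pderiv[OF r0]] that Dg(2)
      unfolding Dg(4) pderiv_smult by simp
    fix D assume "D \<noteq> 0" "\<And>x y. poly (ev x g) y = 0 \<Longrightarrow> poly (pderiv (ev x g)) y = 0 \<Longrightarrow> poly D x = 0"
    thus thesis by (rule that)
  qed
  define B where "B = {x. poly (D * D1 * D2) x = 0}"
  have "D * D1 * D2 \<noteq> 0" using Dg(2) D1(1) D2(1) by simp
  hence B: "finite B" unfolding B_def by (rule poly_roots_finite)
  have sqf: "rsquarefree (ev x f)" if "x \<notin> B" for x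
  proof (subst rsquarefree_iff_pderiv)
    show "ev x f \<noteq> 0" using degree_ev(2)[OF f_monic, of x] by (metis leading_coeff_0_iff zero_neq_one)
    show "\<forall>a. poly (ev x f) a = 0 \<longrightarrow> poly (pderiv (ev x f)) a \<noteq> 0" using D1(2)[of x] that by (auto simp: B_def)
  qed
  have card: "card {s. poly (ev x f) s = 0} = n" if "x \<notin> B" for x
    using rsquarefree_split(2)[OF sqf[OF that]] degree_ev(1)[OF f_monic] f_deg by simp
  show thesis
  proof (rule that[OF Dg(3) irr B _ _ sqf])
    show "ev x g \<noteq> 0" for x
    proof -
      obtain i where "poly (coeff g i) x \<noteq> 0" using Dg(5)[of x] by blast
      hence "coeff (ev x g) i \<noteq> coeff 0 i" by (simp add: coeff_map_poly)
      thus ?thesis by metis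
    qed
    fix x y h1 h2
    assume xy: "x \<in> M" "x \<notin> B" "y \<in> M" "poly (ev x g) y = 0" and h: "h1 \<in> polys M" "h2 \<in> polys M" "ev x f = h1 * h2"
    show "degree h1 = 0 \<or> degree h2 = 0"
    proof (rule specialization_irreducible[OF Dg(4) xy(1) card[OF xy(2)] _ xy(3,4) _ h])
      show "poly D x \<noteq> 0" using xy(2) by (auto simp: B_def)
      show "poly (pderiv (ev x g)) y \<noteq> 0" using D2(2)[OF xy(4)] xy(2) by (auto simp: B_def)
    qed
  qed
qed

end

section \<open>Pencils and interpolation\<close>

text \<open>Up to sign conventions, this is the characteristic polynomial of a rank one perturbation of
  the diagonal matrix with entries \<open>d i\<close>.\<close>

definition pencil :: "nat \<Rightarrow> (nat \<Rightarrow> 'a::comm_ring_1) \<Rightarrow> (nat \<Rightarrow> 'a) \<Rightarrow> 'a poly" where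
  "pencil n d w = (\<Prod>i<n. [:- d i, 1:]) - (\<Sum>i<n. smult (w i) (\<Prod>j\<in>{..<n}-{i}. [:- d j, 1:]))"

lemma pencil_hom:
  assumes "idom_hom h"
  shows "map_poly h (pencil n d w) = pencil n (\<lambda>i. h (d i)) (\<lambda>i. h (w i))"
proof -
  interpret idom_hom h by fact
  interpret mp: map_poly_idom_hom h ..
  show ?thesis unfolding pencil_def
    by (simp add: mp.hom_minus mp.hom_prod mp.hom_sum map_poly_hom_smult map_poly_pCons_0 hom_uminus)
qed

lemma pencil_at:
  assumes "i < n"
  shows "poly (pencil n d w) (d i) = - w i * (\<Prod>j\<in>{..<n}-{i}. (d i - d j :: 'a::comm_ring_1))"
proof -
  have z: "(\<Prod>j\<in>{..<n}-{k}. d i - d j) = 0" if "k \<noteq> i" for k using assms that by (intro prod_zero) auto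
  have "(\<Sum>k<n. w k * (\<Prod>j\<in>{..<n}-{k}. d i - d j)) = (\<Sum>k\<in>{i}. w k * (\<Prod>j\<in>{..<n}-{k}. d i - d j))"
    using assms z by (intro sum.mono_neutral_right) auto
  moreover have "(\<Prod>j<n. d i - d j) = 0" using assms by (intro prod_zero) auto
  ultimately show ?thesis unfolding pencil_def by (simp add: poly_prod poly_sum)
qed

lemma degree_pencil:
  fixes d :: "nat \<Rightarrow> 'a::idom"
  assumes n: "n \<ge> 1"
  shows "degree (pencil n d w) = n" "lead_coeff (pencil n d w) = 1"
proof -
  have dP: "degree (\<Prod>i\<in>I. [:- d i, 1:]) = card I" "lead_coeff (\<Prod>i\<in>I. [:- d i, 1:]) = 1" for I
    by (subst degree_prod_eq_sum_degree) (auto simp: lead_coeff_prod)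
  have "degree (\<Sum>i<n. smult (w i) (\<Prod>j\<in>{..<n}-{i}. [:- d j, 1:])) \<le> n - 1"
  proof (rule degree_sum_le)
    fix i assume "i \<in> {..<n}"
    hence "card ({..<n} - {i}) = n - 1" by simp
    thus "degree (smult (w i) (\<Prod>j\<in>{..<n}-{i}. [:- d j, 1:])) \<le> n - 1" using dP(1)[of "{..<n}-{i}"] by simp
  qed simp
  hence lt: "degree (\<Sum>i<n. smult (w i) (\<Prod>j\<in>{..<n}-{i}. [:- d j, 1:])) < n" using n by linarith
  hence lt': "degree (- (\<Sum>i<n. smult (w i) (\<Prod>j\<in>{..<n}-{i}. [:- d j, 1:]))) < degree (\<Prod>i<n. [:- d i, 1:])"
    using dP(1)[of "{..<n}"] by simp
  have eq: "pencil n d w = (\<Prod>i<n. [:- d i, 1:]) + - (\<Sum>i<n. smult (w i) (\<Prod>j\<in>{..<n}-{i}. [:- d j, 1:]))"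
    by (simp add: pencil_def)
  show "degree (pencil n d w) = n" unfolding eq using degree_add_eq_left[OF lt'] dP(1)[of "{..<n}"] by simp
  show "lead_coeff (pencil n d w) = 1" unfolding eq using lead_coeff_add_le[OF lt'] dP(2)[of "{..<n}"] by simp
qed

text \<open>Monic polynomials of degree \<open>n\<close> are determined by their values at the
  \<open>n\<close> points \<open>d i\<close>. Read backwards, every monic polynomial of degree
  \<open>n\<close> is a pencil for suitable weights, which is how prescribed degenerations are
  produced.\<close>

lemma pencil_eqI:
  fixes d :: "nat \<Rightarrow> 'a::field"
  assumes n: "n \<ge> 1" and d: "inj_on d {..<n}" and p: "degree p = n" "lead_coeff p = 1"
    and at: "\<And>i. i < n \<Longrightarrow> poly p (d i) = - w i * (\<Prod>j\<in>{..<n}-{i}. d i - d j)"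
  shows "pencil n d w = p"
proof (rule ccontr)
  assume "pencil n d w \<noteq> p"
  hence nz: "pencil n d w - p \<noteq> 0" by simp
  have "degree (pencil n d w - p) \<le> n" 
    using degree_diff_le[of "pencil n d w" n p] degree_pencil(1)[OF n, of d w] p(1) by simp
  moreover have "coeff (pencil n d w - p) n = 0" using degree_pencil[OF n, of d w] p by simp
  ultimately have lt: "degree (pencil n d w - p) < n" using nz by (metis leading_coeff_0_iff le_neq_implies_less)
  have "d ` {..<n} \<subseteq> {x. poly (pencil n d w - p) x = 0}" using at pencil_at[of _ n d w] by auto
  hence "card (d ` {..<n}) \<le> card {x. poly (pencil n d w - p) x = 0}" by (rule card_mono[OF poly_roots_finite[OF nz]])
  also have "\<dots> \<le> degree (pencil n d w - p)" by (rule card_poly_roots_bound[OF nz])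
  finally show False using lt d by (simp add: card_image)
qed

text \<open>Greedy choice, each new element avoiding finitely many translates of \<open>T\<close>.
  It provides shifts of a polynomial such that no chosen root is a root of another shift.\<close>

lemma spread_sequence:
  assumes K: "subfld K" "infinite K" and T: "finite T"
  shows "\<exists>l. (\<forall>k<m::nat. l k \<in> K) \<and> (\<forall>i<m. \<forall>k<m. i \<noteq> k \<longrightarrow> l i - l k \<notin> (T :: 'a::field set))"
proof (induction m)
  case (Suc m)
  then obtain l where l: "\<forall>k<m. l k \<in> K" "\<forall>i<m. \<forall>k<m. i \<noteq> k \<longrightarrow> l i - l k \<notin> T" by blast
  define B where "B = (\<Union>k<m. (\<lambda>t. l k + t) ` T \<union> (\<lambda>t. l k - t) ` T)"
  have "finite B" using T by (auto simp: B_def)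
  then obtain x where x: "x \<in> K" "x \<notin> B" using K(2) by (meson finite_subset subsetI)
  have xk: "x - l k \<notin> T" "l k - x \<notin> T" if "k < m" for k
  proof -
    have "x \<notin> (\<lambda>t. l k + t) ` T" "x \<notin> (\<lambda>t. l k - t) ` T" using x(2) that by (auto simp: B_def)
    thus "x - l k \<notin> T" "l k - x \<notin> T" by (auto simp: image_iff algebra_simps)
  qed
  show ?case
    by (rule exI[of _ "l(m := x)"]) (use l x xk in \<open>auto simp: less_Suc_eq\<close>)
qed auto

text \<open>The values may lie outside \<open>K\<close>, where a polynomial over \<open>K\<close>
  can take them only at points outside \<open>K\<close>. All of them lie in \<open>K(b)\<close> for
  a primitive element \<open>b\<close>, and the points are the translates
  \<open>c k = b + l k\<close>; Chinese remaindering with the shifted polynomials \<open>M k\<close>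
  gives the \<open>v i\<close>. \<open>Q\<close> vanishes simply at all points and allows
  derivatives to be changed without changing values.\<close>

lemma interpolation:
  fixes s :: "nat \<Rightarrow> nat \<Rightarrow> 'u::alg_closed_field"
  assumes K: "subfld K" "infinite K" and alg: "\<And>x::'u. alg_over K x"
    and s: "\<And>i k. i < n \<Longrightarrow> k < m \<Longrightarrow> sep_over K (s i k)"
  obtains c v Q where "\<And>i. i < n \<Longrightarrow> v i \<in> polys K" "Q \<in> polys K"
    "\<And>i k. i < n \<Longrightarrow> k < m \<Longrightarrow> poly (v i) (c k) = s i k"
    "\<And>k. k < m \<Longrightarrow> poly Q (c k) = 0" "\<And>k. k < m \<Longrightarrow> poly (pderiv Q) (c k) \<noteq> 0"
proof -
  define A where "A = (\<lambda>(i, k). s i k) ` ({..<n} \<times> {..<m})"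
  have A: "finite A" "\<And>a. a \<in> A \<Longrightarrow> sep_over K a" using s by (auto simp: A_def)
  obtain b where b: "b \<in> gen_fld K A" "A \<subseteq> adj K b" using primitive_element[OF A(1) K alg A(2)] by blast
  have sb: "sep_over K b" by (rule sep_over_gen_fld[OF A(1) K(1) alg A(2) b(1)])
  then obtain \<mu> where m: "\<mu> \<in> polys K" "rsquarefree \<mu>" "poly \<mu> b = 0" by (auto simp: sep_over_def)
  have m0: "\<mu> \<noteq> 0" using m(2) by (simp add: rsquarefree_def)
  have m': "poly (pderiv \<mu>) b \<noteq> 0" using m(2,3) rsquarefree_iff_pderiv[OF m0] by blast
  have "\<forall>i k. \<exists>h. i < n \<longrightarrow> k < m \<longrightarrow> h \<in> polys K \<and> s i k = poly h b"
    using b(2) by (force simp: A_def adj_def)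
  then obtain h where h: "\<And>i k. i < n \<Longrightarrow> k < m \<Longrightarrow> h i k \<in> polys K" "\<And>i k. i < n \<Longrightarrow> k < m \<Longrightarrow> s i k = poly (h i k) b"
    by metis
  \<comment> \<open>\<open>c i\<close> will be a root of \<open>M k\<close> exactly if
    \<open>l i - l k\<close> lies in \<open>T\<close>.\<close>
  define T where "T = (\<lambda>x. x - b) ` {x. poly \<mu> x = 0}"
  have "finite T" unfolding T_def using poly_roots_finite[OF m0] by simp
  then obtain l where l: "\<And>k. k < m \<Longrightarrow> l k \<in> K" "\<And>i k. i < m \<Longrightarrow> k < m \<Longrightarrow> i \<noteq> k \<Longrightarrow> l i - l k \<notin> T"
    using spread_sequence[OF K] by metis
  define c where "c k = b + l k" for k
  define sh where "sh k = [:- l k, 1:]" for k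
  have shK: "sh k \<in> polys K" if "k < m" for k unfolding sh_def
    using l(1)[OF that] by (intro polys_pCons[OF K(1)] polys_0[OF K(1)] subfld_uminus[OF K(1)] subfld_1[OF K(1)])
  define M where "M k = pcompose \<mu> (sh k)" for k
  have MK: "M k \<in> polys K" if "k < m" for k unfolding M_def by (intro polys_pcompose[OF K(1)] m shK that)
  have Mc: "poly (M k) (c i) = poly \<mu> (b + (l i - l k))" for i k
    by (simp add: M_def poly_pcompose sh_def c_def algebra_simps)
  have M0: "poly (M k) (c k) = 0" for k using m(3) by (simp add: Mc)
  have M1: "poly (M k) (c i) \<noteq> 0" if "i < m" "k < m" "i \<noteq> k" for i k
  proof
    assume "poly (M k) (c i) = 0"
    hence "poly \<mu> (b + (l i - l k)) = 0" by (simp add: Mc)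
    hence "l i - l k \<in> T" unfolding T_def by (intro image_eqI[of _ _ "b + (l i - l k)"]) auto
    with l(2)[OF that] show False by blast
  qed
  define N where "N k = (\<Prod>j\<in>{..<m}-{k}. M j)" for k
  have NK: "N k \<in> polys K" for k unfolding N_def by (intro polys_prod[OF K(1)]) (auto intro: MK)
  have N1: "poly (N k) (c k) \<noteq> 0" if "k < m" for k unfolding N_def poly_prod using M1 that by simp
  have N0: "poly (N k) (c i) = 0" if "i < m" "i \<noteq> k" for i k
    unfolding N_def poly_prod using M0 that by (intro prod_zero) auto
  \<comment> \<open>\<open>poly (N k) (c k)\<close> is a nonzero element of \<open>K(b)\<close>; its
    inverse, written as a polynomial in \<open>b\<close>, normalizes the interpolation.\<close>
  have "\<exists>q. q \<in> polys K \<and> poly (N k) (c k) * poly q b = 1" if k: "k < m" for k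
  proof -
    have Nb: "poly (pcompose (N k) [:l k, 1:]) b = poly (N k) (c k)" by (simp add: poly_pcompose c_def add.commute)
    have "pcompose (N k) [:l k, 1:] \<in> polys K"
      using l(1)[OF k] by (intro polys_pcompose[OF K(1)] NK polys_pCons[OF K(1)] polys_0[OF K(1)] subfld_1[OF K(1)])
    then obtain q where "q \<in> polys K" "poly (pcompose (N k) [:l k, 1:] * q - 1) b = 0"
      using adj_inverse[OF K(1) alg, of "pcompose (N k) [:l k, 1:]" b] N1[OF k] Nb by auto
    thus ?thesis using Nb by auto
  qed
  then obtain q where q: "\<And>k. k < m \<Longrightarrow> q k \<in> polys K" "\<And>k. k < m \<Longrightarrow> poly (N k) (c k) * poly (q k) b = 1" by metis
  define v where "v i = (\<Sum>k<m. N k * (pcompose (q k) (sh k) * pcompose (h i k) (sh k)))" for i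
  have shc: "poly (sh k) (c k) = b" for k by (simp add: sh_def c_def)
  have vK: "v i \<in> polys K" if "i < n" for i unfolding v_def
    using that q(1) h(1) by (intro polys_sum[OF K(1)] polys_mult[OF K(1)] NK polys_pcompose[OF K(1)] shK) auto
  have vc: "poly (v i) (c k) = s i k" if "i < n" "k < m" for i k
  proof -
    have "poly (v i) (c k) = (\<Sum>j<m. poly (N j) (c k) * (poly (q j) (poly (sh j) (c k)) * poly (h i j) (poly (sh j) (c k))))"
      by (simp add: v_def poly_sum poly_pcompose)
    also have "\<dots> = (\<Sum>j\<in>{k}. poly (N j) (c k) * (poly (q j) (poly (sh j) (c k)) * poly (h i j) (poly (sh j) (c k))))"
      using that by (intro sum.mono_neutral_right) (auto simp: N0)
    also have "\<dots> = s i k" using q(2)[OF that(2)] h(2)[OF that] by (simp add: shc flip: mult.assoc)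
    finally show ?thesis .
  qed
  define Q where "Q = (\<Prod>k<m. M k)"
  have QK: "Q \<in> polys K" unfolding Q_def by (intro polys_prod[OF K(1)]) (auto intro: MK)
  have Q0: "poly Q (c k) = 0" if "k < m" for k unfolding Q_def poly_prod using M0 that by (intro prod_zero) auto
  have Q1: "poly (pderiv Q) (c k) \<noteq> 0" if k: "k < m" for k
  proof -
    have "Q = M k * N k" unfolding Q_def N_def using k by (intro prod.remove) auto
    hence "poly (pderiv Q) (c k) = poly (pderiv (M k)) (c k) * poly (N k) (c k)"
      using M0[of k] by (simp add: pderiv_mult)
    moreover have "poly (pderiv (M k)) (c k) = poly (pderiv \<mu>) b"
      unfolding M_def pderiv_pcompose by (simp add: poly_pcompose shc) (simp add: sh_def pderiv_pCons)
    ultimately show ?thesis using m' N1[OF k] by simp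
  qed
  show thesis by (rule that[OF vK QK vc Q0 Q1])
qed

text \<open>The derivative of \<open>Y^2 - s^2\<close> is \<open>2 Y\<close>, nonzero at the roots
  when 2 and \<open>s\<close> are nonzero.\<close>

lemma sep_over_sqrt:
  fixes s :: "'u::field"
  assumes K: "subfld K" and two: "(2::'u) \<noteq> 0" and s: "s ^ 2 \<in> K" "s \<noteq> 0"
  shows "sep_over K s"
proof -
  define p where "p = [:- (s ^ 2), 0, 1:]"
  have "p \<in> polys K" unfolding p_def
    by (intro polys_pCons[OF K] polys_0[OF K] subfld_uminus[OF K] subfld_0[OF K] subfld_1[OF K] s)
  moreover have p0: "p \<noteq> 0" by (simp add: p_def)
  have "rsquarefree p" unfolding rsquarefree_iff_pderiv[OF p0]
  proof (intro allI impI)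
    fix a assume "poly p a = 0"
    hence "a * a = s * s" by (simp add: p_def power2_eq_square)
    hence "a \<noteq> 0" using s(2) by auto
    moreover have "poly (pderiv p) a = 2 * a" by (simp add: p_def pderiv_pCons)
    ultimately show "poly (pderiv p) a \<noteq> 0" using two by simp
  qed
  moreover have "poly p s = 0" by (simp add: p_def power2_eq_square)
  ultimately show ?thesis by (auto simp: sep_over_def)
qed

text \<open>The pencil of the next lemma degenerates at the points \<open>c k\<close> in such a way that its roots
  are permuted there like those of an Eisenstein polynomial of degree \<open>Suc k\<close>.\<close>

lemma degenerating_pencil:
  fixes a :: "nat \<Rightarrow> 'u::alg_closed_field"
  assumes K: "subfld K" "infinite K" and alg: "\<And>x::'u. alg_over K x" and two: "(2::'u) \<noteq> 0"
    and n: "n \<ge> 1" and a: "\<And>i. i < n \<Longrightarrow> a i \<in> K" "\<And>i. i < n \<Longrightarrow> a i \<noteq> 0"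
  obtains d e v c where "\<And>i. i < n \<Longrightarrow> d i \<in> K" "inj_on d {..<n}"
    "\<And>i. i < n \<Longrightarrow> v i \<in> polys K" "\<And>i. i < n \<Longrightarrow> v i \<noteq> 0"
    "inj_on e {..<n-1}" "\<And>j. j < n - 1 \<Longrightarrow> e j \<noteq> 0" "n \<ge> 2 \<Longrightarrow> (\<Sum>j<n-1. e j) \<noteq> 0"
    "\<And>k. k < n \<Longrightarrow> pencil n d (\<lambda>i. a i * poly (v i) (c k) ^ 2) = monom 1 (Suc k) * (\<Prod>j<n-Suc k. [:- e j, 1:])"
    "\<And>k. k < n \<Longrightarrow> (\<Sum>i<n. a i * (\<Prod>j\<in>{..<n}-{i}. - d j) * (poly (v i) (c k) * poly (pderiv (v i)) (c k))) \<noteq> 0"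
proof -
  have "infinite (K - {0})" using K(2) by simp
  then obtain g :: "nat \<Rightarrow> 'u" where g: "inj g" "range g \<subseteq> K - {0}" by (meson infinite_countable_subset)
  \<comment> \<open>The values forbidden for \<open>e0\<close>: 0, all \<open>d i\<close> and all
    other \<open>e j\<close> (indices below \<open>2 * n\<close>), and the one value for which the
    sum of the \<open>e j\<close> would be 0.\<close>
  define E where "E = insert (- (\<Sum>j\<in>{1..<n-1}. g (n + j))) (insert 0 (g ` {..<2*n}))"
  have "finite E" by (simp add: E_def)
  then obtain e0 where e0: "e0 \<in> K" "e0 \<notin> E" using K(2) by (meson finite_subset subsetI)
  define d where "d = g"
  define e where "e j = (if j = 0 then e0 else g (n + j))" for j
  have gK: "g i \<in> K" "g i \<noteq> 0" for i using g(2) by auto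
  have dK: "d i \<in> K" "d i \<noteq> 0" for i using gK by (simp_all add: d_def)
  have d_inj: "inj_on d {..<n}" unfolding d_def using g(1) by (simp add: inj_on_def)
  have eK: "e j \<in> K" for j using gK e0 by (simp add: e_def)
  have e_nz: "e j \<noteq> 0" for j using gK e0 by (auto simp: e_def E_def)
  have e_inj: "inj_on e {..<n-1}"
  proof (rule inj_onI)
    fix x y assume xy: "x \<in> {..<n-1}" "y \<in> {..<n-1}" "e x = e y"
    have "e0 \<noteq> g (n + j)" if "j < n - 1" for j using e0(2) that by (auto simp: E_def)
    thus "x = y" using xy g(1) by (auto simp: e_def inj_eq split: if_splits)
  qed
  have de: "d i \<noteq> e j" if "i < n" for i j
  proof (cases "j = 0")
    case True
    have "g i \<in> E" using that by (auto simp: E_def)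
    thus ?thesis using e0(2) True by (auto simp: e_def d_def)
  next
    case False
    thus ?thesis using g(1) that by (auto simp: e_def d_def inj_eq)
  qed
  have e_sum: "(\<Sum>j<n-1. e j) \<noteq> 0" if "n \<ge> 2"
  proof -
    have "(\<Sum>j<n-1. e j) = e 0 + (\<Sum>j\<in>{..<n-1}-{0}. e j)" using that by (intro sum.remove) auto
    also have "{..<n-1}-{0} = {1..<n-1}" by auto
    also have "(\<Sum>j\<in>{1..<n-1}. e j) = (\<Sum>j\<in>{1..<n-1}. g (n + j))" by (intro sum.cong) (auto simp: e_def)
    also have "e 0 = e0" by (simp add: e_def)
    finally show ?thesis using e0(2) by (auto simp: E_def add_eq_0_iff2)
  qed
  \<comment> \<open>The prescribed specialization at \<open>c k\<close>: \<open>Suc k\<close> roots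
    meet at 0, and the others stay simple and nonzero.\<close>
  define \<phi> where "\<phi> k = monom 1 (Suc k) * (\<Prod>j<n-Suc k. [:- e j, 1:])" for k
  have \<phi>_deg: "degree (\<phi> k) = n" "lead_coeff (\<phi> k) = 1" if "k < n" for k
  proof -
    have p: "degree (\<Prod>j<n-Suc k. [:- e j, 1:]) = n - Suc k" "(\<Prod>j<n-Suc k. [:- e j, 1:]) \<noteq> 0"
      by (subst degree_prod_eq_sum_degree) auto
    show "degree (\<phi> k) = n" unfolding \<phi>_def using that p by (subst degree_mult_eq) (auto simp: degree_monom_eq)
    show "lead_coeff (\<phi> k) = 1" unfolding \<phi>_def lead_coeff_mult by (simp add: lead_coeff_prod degree_monom_eq)
  qed
  have \<phi>_at: "poly (\<phi> k) (d i) \<in> K" "poly (\<phi> k) (d i) \<noteq> 0" if "i < n" for i k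
  proof -
    have "poly (\<phi> k) (d i) = d i ^ Suc k * (\<Prod>j<n-Suc k. d i - e j)"
      unfolding \<phi>_def by (simp add: poly_monom poly_prod)
    moreover have "d i ^ Suc k * (\<Prod>j<n-Suc k. d i - e j) \<in> K"
      by (intro subfld_mult[OF K(1)] subfld_power[OF K(1)] subfld_prod[OF K(1)] subfld_diff[OF K(1)] dK eK)
    moreover have "d i ^ Suc k * (\<Prod>j<n-Suc k. d i - e j) \<noteq> 0" using dK(2) de[OF that] by simp
    ultimately show "poly (\<phi> k) (d i) \<in> K" "poly (\<phi> k) (d i) \<noteq> 0" by simp_all
  qed
  \<comment> \<open>The value that the square of \<open>v i\<close> must have at \<open>c k\<close>,
    obtained by solving \<open>pencil_at\<close> for the weight.\<close>
  define u where "u i k = - poly (\<phi> k) (d i) / (a i * (\<Prod>j\<in>{..<n}-{i}. d i - d j))" for i k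
  have prod_nz: "(\<Prod>j\<in>{..<n}-{i}. d i - d j) \<noteq> 0" if "i < n" for i
    using d_inj that by (auto dest: inj_onD)
  have u: "u i k \<in> K" "u i k \<noteq> 0" if "i < n" for i k
  proof -
    show "u i k \<in> K" unfolding u_def
      by (intro subfld_divide[OF K(1)] subfld_uminus[OF K(1)] subfld_mult[OF K(1)] subfld_prod[OF K(1)]
          subfld_diff[OF K(1)] dK \<phi>_at a that)
    show "u i k \<noteq> 0" unfolding u_def using \<phi>_at(2)[OF that] a(2)[OF that] prod_nz[OF that] by simp
  qed
  define s where "s i k = (SOME y. y ^ 2 = u i k)" for i k
  have s: "s i k ^ 2 = u i k" for i k
    unfolding s_def using nth_root_exists[of 2 "u i k"] by (rule_tac someI_ex) simp
  have s_nz: "s i k \<noteq> 0" if "i < n" for i k using s[of i k] u(2)[OF that, of k] by auto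
  have "sep_over K (s i k)" if "i < n" "k < n" for i k
    using sep_over_sqrt[OF K(1) two, of "s i k"] s[of i k] u(1)[OF that(1), of k] s_nz[OF that(1)] by simp
  then obtain c v Q where vQ: "\<And>i. i < n \<Longrightarrow> v i \<in> polys K" "Q \<in> polys K"
    "\<And>i k. i < n \<Longrightarrow> k < n \<Longrightarrow> poly (v i) (c k) = s i k"
    "\<And>k. k < n \<Longrightarrow> poly Q (c k) = 0" "\<And>k. k < n \<Longrightarrow> poly (pderiv Q) (c k) \<noteq> 0"
    by (rule interpolation[OF K alg, of n n s]) (assumption | rule that)+
  define b where "b i = a i * (\<Prod>j\<in>{..<n}-{i}. - d j)" for i
  have b_nz: "b i \<noteq> 0" if "i < n" for i unfolding b_def using a(2)[OF that] dK(2) by simp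
  \<comment> \<open>Up to the factor -2, the derivative at \<open>c k\<close> of the constant term
    of the pencil becomes \<open>\<beta> k + t * \<gamma> k\<close> when \<open>t * Q\<close> is
    added to \<open>v 0\<close>. The values at the \<open>c k\<close> do not change, and
    \<open>t\<close> avoids the finitely many zeros of these expressions.\<close>
  define \<beta> where "\<beta> k = (\<Sum>i<n. b i * (s i k * poly (pderiv (v i)) (c k)))" for k
  define \<gamma> where "\<gamma> k = b 0 * (s 0 k * poly (pderiv Q) (c k))" for k
  have \<gamma>: "\<gamma> k \<noteq> 0" if "k < n" for k unfolding \<gamma>_def using b_nz[of 0] s_nz[of 0] vQ(5)[OF that] n by simp
  have "finite ((\<lambda>k. - \<beta> k / \<gamma> k) ` {..<n})" by simp
  then obtain t where t: "t \<in> K" "t \<notin> (\<lambda>k. - \<beta> k / \<gamma> k) ` {..<n}" using K(2) by (meson finite_subset subsetI)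
  define v' where "v' i = (if i = 0 then v 0 + smult t Q else v i)" for i
  have v'K: "v' i \<in> polys K" if "i < n" for i
    unfolding v'_def using vQ(1)[of i] vQ(1)[of 0] vQ(2) t(1) that n
    by (auto intro!: polys_add[OF K(1)] polys_smult[OF K(1)])
  have v'c: "poly (v' i) (c k) = s i k" if "i < n" "k < n" for i k
    using vQ(3)[OF that] vQ(3)[of 0 k] vQ(4)[OF that(2)] that n by (auto simp: v'_def)
  have der: "(\<Sum>i<n. b i * (poly (v' i) (c k) * poly (pderiv (v' i)) (c k))) \<noteq> 0" if k: "k < n" for k
  proof -
    have "(\<Sum>i<n. b i * (poly (v' i) (c k) * poly (pderiv (v' i)) (c k))) =
        (\<Sum>i<n. b i * (s i k * poly (pderiv (v i)) (c k)) + (if i = 0 then t * \<gamma> k else 0))"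
      using v'c k by (intro sum.cong) (auto simp: v'_def \<gamma>_def pderiv_add pderiv_smult algebra_simps)
    also have "\<dots> = \<beta> k + t * \<gamma> k" unfolding sum.distrib \<beta>_def using n by simp
    finally have e: "(\<Sum>i<n. b i * (poly (v' i) (c k) * poly (pderiv (v' i)) (c k))) = \<beta> k + t * \<gamma> k" .
    show ?thesis
    proof
      assume "(\<Sum>i<n. b i * (poly (v' i) (c k) * poly (pderiv (v' i)) (c k))) = 0"
      hence "t = - \<beta> k / \<gamma> k" using e \<gamma>[OF k] by (simp add: field_simps add_eq_0_iff)
      with t(2) k show False by blast
    qed
  qed
  have pen: "pencil n d (\<lambda>i. a i * poly (v' i) (c k) ^ 2) = \<phi> k" if k: "k < n" for k
  proof (rule pencil_eqI[OF n d_inj \<phi>_deg[OF k]])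
    fix i assume i: "i < n"
    have "a i * poly (v' i) (c k) ^ 2 * (\<Prod>j\<in>{..<n}-{i}. d i - d j) = - poly (\<phi> k) (d i)"
      unfolding v'c[OF i k] s u_def using a(2)[OF i] prod_nz[OF i] by (simp add: field_simps)
    thus "poly (\<phi> k) (d i) = - (a i * poly (v' i) (c k) ^ 2) * (\<Prod>j\<in>{..<n}-{i}. d i - d j)" by simp
  qed
  have nz: "v' i \<noteq> 0" if "i < n" for i using v'c[OF that, of 0] s_nz[OF that, of 0] n by auto
  show thesis
    by (rule that[of d v' e c, OF dK(1) d_inj v'K nz e_inj e_nz e_sum pen[unfolded \<phi>_def] der[unfolded b_def]])
qed

section \<open>The monodromy of the pencil\<close>

definition coeffs_in :: "'w::field set \<Rightarrow> 'w poly poly set" where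
  "coeffs_in M = {f. \<forall>i. coeff f i \<in> polys M}"

lemma
  assumes M: "subfld M"
  shows coeffs_in_const: "p \<in> polys M \<Longrightarrow> [:p:] \<in> coeffs_in M"
    and coeffs_in_linear: "p \<in> polys M \<Longrightarrow> [:p, 1:] \<in> coeffs_in M"
    and coeffs_in_mult: "f \<in> coeffs_in M \<Longrightarrow> g \<in> coeffs_in M \<Longrightarrow> f * g \<in> coeffs_in M"
    and coeffs_in_diff: "f \<in> coeffs_in M \<Longrightarrow> g \<in> coeffs_in M \<Longrightarrow> f - g \<in> coeffs_in M"
    and coeffs_in_add: "f \<in> coeffs_in M \<Longrightarrow> g \<in> coeffs_in M \<Longrightarrow> f + g \<in> coeffs_in M"
    and coeffs_in_smult: "p \<in> polys M \<Longrightarrow> f \<in> coeffs_in M \<Longrightarrow> smult p f \<in> coeffs_in M"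
  unfolding coeffs_in_def using polys_0[OF M] polys_1[OF M]
  by (auto simp: coeff_pCons coeff_mult split: nat.split
      intro!: polys_sum[OF M] polys_mult[OF M] polys_diff[OF M] polys_add[OF M])

lemma pencil_coeffs_in:
  assumes M: "subfld M" and "\<And>i. i < n \<Longrightarrow> d i \<in> polys M" "\<And>i. i < n \<Longrightarrow> w i \<in> polys M"
  shows "pencil n d w \<in> coeffs_in M"
proof -
  have lin: "[:- d i, 1:] \<in> coeffs_in M" if "i < n" for i
    using assms that by (intro coeffs_in_linear[OF M] polys_uminus[OF M]) auto
  have one: "1 \<in> coeffs_in M" using coeffs_in_const[OF M polys_1[OF M]] by (simp add: one_pCons)
  have zero: "0 \<in> coeffs_in M" using coeffs_in_const[OF M polys_0[OF M]] by simp
  have pr: "(\<Prod>i\<in>I. [:- d i, 1:]) \<in> coeffs_in M" if "I \<subseteq> {..<n}" for I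
    using that by (induction I rule: infinite_finite_induct) (auto intro: one coeffs_in_mult[OF M] lin simp del: mult_pCons_left)
  have "(\<Sum>i\<in>I. smult (w i) (\<Prod>j\<in>{..<n}-{i}. [:- d j, 1:])) \<in> coeffs_in M" if "I \<subseteq> {..<n}" for I
    using that by (induction I rule: infinite_finite_induct)
      (auto intro: zero intro!: coeffs_in_add[OF M] coeffs_in_smult[OF M] assms pr)
  thus ?thesis unfolding pencil_def using pr by (intro coeffs_in_diff[OF M]) auto
qed

text \<open>At \<open>J (c k)\<close> the transported pencil has \<open>Suc k\<close> roots meeting
  as in \<open>place_transitive\<close>, whose derivative condition is \<open>der\<close> multiplied
  by -2; \<open>symmetric_action\<close> combines these points into the full symmetric
  group.\<close>

theorem pencil_twisted_cover:
  fixes J :: "'u::alg_closed_field \<Rightarrow> 'w::alg_closed_field" and a :: "nat \<Rightarrow> 'u"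
  assumes J: "field_hom J" and M: "subfld M" and algM: "\<And>a. alg_over M a" and two: "(2::'w) \<noteq> 0"
    and n: "n \<ge> 1"
    and \<theta>: "inj_on \<theta> {..<n}" "\<exists>p\<in>polys M. rsquarefree p \<and> {a. poly p a = 0} = \<theta> ` {..<n}"
      "\<And>i j h. i < n \<Longrightarrow> j < n \<Longrightarrow> h \<in> polys M \<Longrightarrow> poly h (\<theta> i) = 0 \<Longrightarrow> poly h (\<theta> j) = 0"
    and d: "\<And>i. i < n \<Longrightarrow> J (d i) \<in> M"
    and v: "\<And>i. i < n \<Longrightarrow> map_poly J (v i) \<in> polys M"
    and a: "\<And>i. i < n \<Longrightarrow> J (a i) \<in> M"
    and e: "inj_on e {..<n-1}" "\<And>j. j < n - 1 \<Longrightarrow> e j \<noteq> 0" "n \<ge> 2 \<Longrightarrow> (\<Sum>j<n-1. e j) \<noteq> 0"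
    and deg: "\<And>k. k < n \<Longrightarrow> pencil n d (\<lambda>i. a i * poly (v i) (c k) ^ 2) = monom 1 (Suc k) * (\<Prod>j<n-Suc k. [:- e j, 1:])"
    and der: "\<And>k. k < n \<Longrightarrow> (\<Sum>i<n. a i * (\<Prod>j\<in>{..<n}-{i}. - d j) * (poly (v i) (c k) * poly (pderiv (v i)) (c k))) \<noteq> 0"
  defines "f \<equiv> pencil n (\<lambda>i. [:J (d i):]) (\<lambda>i. [:J (a i):] * map_poly J (v i) ^ 2)"
  shows "twisted_cover M n \<theta> f"
    and "\<And>x. ev x f = pencil n (\<lambda>i. J (d i)) (\<lambda>i. J (a i) * poly (map_poly J (v i)) x ^ 2)"
proof -
  interpret J: field_hom J by fact
  interpret mJ: map_poly_idom_hom J ..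
  have f_deg: "degree f = n" "lead_coeff f = 1" unfolding f_def using degree_pencil[OF n] by auto
  show evf: "ev x f = pencil n (\<lambda>i. J (d i)) (\<lambda>i. J (a i) * poly (map_poly J (v i)) x ^ 2)" for x
    unfolding f_def by (subst pencil_hom[OF poly_hom.idom_hom_axioms]) simp
  define S where "S k = J ` e ` {..<n - Suc k}" for k
  have e_inj: "inj_on (\<lambda>j. J (e j)) {..<n - Suc k}" for k
    using e(1) by (auto simp: inj_on_def)
  have evc: "ev (J (c k)) f = monom 1 (Suc k) * (\<Prod>x\<in>S k. [:- x, 1:])" if "k < n" for k
  proof -
    have "ev (J (c k)) f = pencil n (\<lambda>i. J (d i)) (\<lambda>i. J (a i * poly (v i) (c k) ^ 2))"
      unfolding evf by (simp add: J.hom_mult J.hom_power)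
    also have "\<dots> = map_poly J (pencil n d (\<lambda>i. a i * poly (v i) (c k) ^ 2))"
      by (rule pencil_hom[symmetric]) unfold_locales
    also have "\<dots> = monom 1 (Suc k) * (\<Prod>j<n-Suc k. [:- J (e j), 1:])"
      unfolding deg[OF that] mJ.hom_mult mJ.hom_prod by (simp add: map_poly_pCons_0 J.hom_uminus)
    also have "(\<Prod>j<n-Suc k. [:- J (e j), 1:]) = (\<Prod>x\<in>S k. [:- x, 1:])"
      unfolding S_def image_image by (subst prod.reindex[OF e_inj]) simp
    finally show ?thesis .
  qed
  have S: "finite (S k)" "0 \<notin> S k" "card (S k) = n - Suc k" for k
  proof -
    show "finite (S k)" "0 \<notin> S k" unfolding S_def using e(2) by auto
    show "card (S k) = n - Suc k" unfolding S_def image_image using card_image[OF e_inj] by simp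
  qed
  \<comment> \<open>At \<open>c 0\<close> only one root reaches 0, so the specialization has
    \<open>n\<close> distinct roots. This point shows both that \<open>f\<close> has
    \<open>n\<close> distinct roots and that their sum is nonzero.\<close>
  define S0 where "S0 = insert 0 (S 0)"
  have S0: "finite S0" "card S0 = n" using S[of 0] n by (auto simp: S0_def)
  have ev0: "ev (J (c 0)) f = (\<Prod>x\<in>S0. [:- x, 1:])"
    using evc[of 0] n S[of 0] by (simp add: S0_def monom_altdef)
  define R where "R = {x. poly (map_poly incl f) x = 0}"
  have cardR: "card R = n"
  proof -
    have "{s. poly (ev (J (c 0)) f) s = 0} = S0" unfolding ev0 using S0(1) by (auto simp: poly_prod)
    hence card: "card {s. poly (ev (J (c 0)) f) s = 0} = degree f" using S0 f_deg by simp
    obtain r where "bij_betw (\<lambda>x. fps_nth (r x) 0) R {s. poly (ev (J (c 0)) f) s = 0}"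
      unfolding R_def using place_unramified[OF f_deg(2) card] by blast
    thus ?thesis using bij_betw_same_card card f_deg by metis
  qed
  have pd: "poly (pderiv (coeff f 0)) (J (c k)) \<noteq> 0" if k: "k < n" for k
  proof -
    define V where "V i = map_poly J (v i)" for i
    define b where "b i = J (a i * (\<Prod>j\<in>{..<n}-{i}. - d j))" for i
    have "coeff f 0 = poly f 0" by (simp add: poly_0_coeff_0)
    also have "\<dots> = [:\<Prod>i<n. - J (d i):] - (\<Sum>i<n. smult (b i) (V i ^ 2))"
    proof -
      have c: "[:\<Prod>i\<in>I. h i:] = (\<Prod>i\<in>I. [:h i:])" for I and h :: "nat \<Rightarrow> 'w"
      proof (induction I rule: infinite_finite_induct)
        case (insert x I)
        have "[:h x * prod h I:] = [:h x:] * [:prod h I:]" by simp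
        thus ?case unfolding insert.IH using insert.hyps by simp
      qed (simp_all add: one_pCons)
      have "[:J (a i):] * V i ^ 2 * (\<Prod>j\<in>{..<n}-{i}. - [:J (d j):]) = smult (b i) (V i ^ 2)" for i
      proof -
        have "(\<Prod>j\<in>{..<n}-{i}. - [:J (d j):]) = [:\<Prod>j\<in>{..<n}-{i}. J (- d j):]" by (simp add: c J.hom_uminus)
        thus ?thesis unfolding b_def by (simp add: J.hom_mult J.hom_prod mult.commute)
      qed
      thus ?thesis unfolding f_def pencil_def V_def[symmetric]
        by (simp add: poly_prod poly_sum c)
    qed
    finally have "pderiv (coeff f 0) = - (\<Sum>i<n. smult (b i) (pderiv (V i ^ 2)))"
      by (simp add: pderiv_diff pderiv_sum pderiv_smult pderiv_pCons)
    hence "poly (pderiv (coeff f 0)) (J (c k)) = - (\<Sum>i<n. b i * (2 * (poly (V i) (J (c k)) * poly (pderiv (V i)) (J (c k)))))"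
      by (simp add: poly_sum power2_eq_square pderiv_mult algebra_simps)
    also have "\<dots> = - 2 * J (\<Sum>i<n. a i * (\<Prod>j\<in>{..<n}-{i}. - d j) * (poly (v i) (c k) * poly (pderiv (v i)) (c k)))"
      unfolding J.hom_sum sum_distrib_left b_def V_def
      by (simp add: J.hom_mult sum_negf algebra_simps flip: J.map_poly_pderiv)
    finally show ?thesis using der[OF k] two by simp
  qed
  have "\<exists>A\<subseteq>R. card A = k \<and> (\<forall>x\<in>A. \<forall>y\<in>A. \<exists>\<sigma>\<in>homs_over (range to_ac). \<sigma> x = y \<and> (\<forall>z\<in>R-A. \<sigma> z = z))"
    if k: "k \<in> {1..n}" for k
  proof -
    obtain k' where k': "k = Suc k'" "k' < n" using k by (cases k) auto
    have cR: "card {x. poly (map_poly incl f) x = 0} = degree f" using cardR f_deg by (simp add: R_def)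
    have cS: "card (S k') + Suc k' = degree f" using S f_deg k' by simp
    obtain A where "A \<subseteq> R" "card A = Suc k'"
      "\<And>x y. x \<in> A \<Longrightarrow> y \<in> A \<Longrightarrow> \<exists>\<sigma>\<in>homs_over (range to_ac). \<sigma> x = y \<and> (\<forall>z\<in>R-A. \<sigma> z = z)"
      by (rule place_transitive[OF f_deg(2) cR S(1,2) cS zero_less_Suc evc[OF k'(2)] pd[OF k'(2)], folded R_def]) (rule that)
    thus ?thesis using k' by blast
  qed
  hence "\<forall>k. \<exists>A. k \<in> {1..n} \<longrightarrow> A \<subseteq> R \<and> card A = k \<and>
      (\<forall>x\<in>A. \<forall>y\<in>A. \<exists>\<sigma>\<in>homs_over (range to_ac). \<sigma> x = y \<and> (\<forall>z\<in>R-A. \<sigma> z = z))" by meson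
  then obtain A where A: "\<forall>k. k \<in> {1..n} \<longrightarrow> A k \<subseteq> R \<and> card (A k) = k \<and>
      (\<forall>x\<in>A k. \<forall>y\<in>A k. \<exists>\<sigma>\<in>homs_over (range to_ac). \<sigma> x = y \<and> (\<forall>z\<in>R-A k. \<sigma> z = z))"
    by (rule choice[THEN exE])
  have finR: "finite R" using cardR n by (intro card_ge_0_finite) simp
  have full: "\<exists>\<sigma>\<in>homs_over (range to_ac). \<forall>x\<in>R. \<sigma> x = \<pi> x" if "\<pi> permutes R" for \<pi>
  proof (rule symmetric_action[OF alg_closure_alg_over finR cardR _ _ _ that])
    show "A k \<subseteq> R \<and> card (A k) = k" if "k \<in> {1..n}" for k using A that by blast
    show "\<exists>\<sigma>\<in>homs_over (range to_ac). \<sigma> x = y \<and> (\<forall>z\<in>R - A k. \<sigma> z = z)"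
      if "k \<in> {1..n}" "x \<in> A k" "y \<in> A k" for k x y using A that by blast
    show "\<sigma> x \<in> R" if "\<sigma> \<in> homs_over (range to_ac)" "x \<in> R" for \<sigma> x
      using homs_over_root[OF that(1) polys_range_to_ac] that(2) by (simp add: R_def)
  qed
  have fM: "f \<in> coeffs_in M" unfolding f_def
    using d v a by (intro pencil_coeffs_in[OF M] polys_const[OF M] polys_mult[OF M] polys_power[OF M])
  have trace: "coeff f (n - 1) \<noteq> 0" if n2: "n \<ge> 2"
  proof
    assume "coeff f (n - 1) = 0"
    hence "coeff (ev (J (c 0)) f) (n - 1) = 0" by (simp add: coeff_map_poly)
    moreover have "S0 \<noteq> {}" by (simp add: S0_def)
    ultimately have "(\<Sum>x\<in>S0. x) = 0" using prod_linear_subleading[OF S0(1)] S0(2) unfolding ev0 by simp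
    also have "(\<Sum>x\<in>S0. x) = (\<Sum>x\<in>S 0. x)" using S[of 0] by (simp add: S0_def)
    also have "\<dots> = J (\<Sum>j<n-1. e j)" unfolding S_def image_image J.hom_sum by (subst sum.reindex[OF e_inj]) simp
    finally show False using e(3)[OF n2] by simp
  qed
  show "twisted_cover M n \<theta> f"
  proof
    show "coeff f i \<in> polys M" for i using fM by (simp add: coeffs_in_def)
    show "card {x. poly (map_poly incl f) x = 0} = n" using cardR by (simp add: R_def)
    show "\<exists>\<sigma>\<in>homs_over (range to_ac). \<forall>x. poly (map_poly incl f) x = 0 \<longrightarrow> \<sigma> x = \<pi> x"
      if "\<pi> permutes {x. poly (map_poly incl f) x = 0}" for \<pi> using full that unfolding R_def by blast
  qed (fact M algM \<theta> f_deg trace)+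
qed

section \<open>Irreducible pencils from PAC extensions\<close>

lemma poly_ev: "poly (ev x g) y = eval2 g x y"
  unfolding eval2_def
proof (induction g)
  case (pCons a g)
  thus ?case by (simp add: map_poly_pCons_0 algebra_simps)
qed simp

lemma irreducible_monic_linear:
  fixes p :: "'a::idom poly"
  assumes "degree p = 1" "lead_coeff p = 1"
  shows "irreducible p"
proof (rule Factorial_Ring.irreducibleI)
  show "p \<noteq> 0" using assms by auto
  show "\<not> p dvd 1" using dvd_imp_degree_le[of p 1] assms(1) by auto
  fix A B assume AB: "p = A * B"
  have nz: "A \<noteq> 0" "B \<noteq> 0" using AB \<open>p \<noteq> 0\<close> by auto
  have lc: "lead_coeff A * lead_coeff B = 1" using assms(2) unfolding AB lead_coeff_mult .
  have "degree A + degree B = 1" using assms(1) nz unfolding AB by (simp add: degree_mult_eq)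
  hence "degree A = 0 \<or> degree B = 0" by auto
  thus "A dvd 1 \<or> B dvd 1"
  proof
    assume "degree A = 0"
    then obtain u where u: "A = [:u:]" by (metis degree_0_id)
    have "u dvd 1" using lc unfolding u by (metis dvd_triv_left coeff_pCons_0 degree_pCons_0)
    thus ?thesis unfolding u by (simp add: is_unit_const_poly_iff)
  next
    assume "degree B = 0"
    then obtain u where u: "B = [:u:]" by (metis degree_0_id)
    have "u dvd 1" using lc unfolding u by (metis dvd_triv_right coeff_pCons_0 degree_pCons_0)
    thus ?thesis unfolding u by (simp add: is_unit_const_poly_iff)
  qed
qed

text \<open>Applied to the line \<open>Y = X\<close>, whose points correspond to the elements of
  \<open>'k\<close>.\<close>

lemma PAC_extension_infinite:
  assumes "PAC_extension (i :: 'k::field \<Rightarrow> 'm::field)"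
  shows "infinite (UNIV :: 'k set)"
proof
  assume fin: "finite (UNIV :: 'k set)"
  define f :: "'m poly poly" where "f = [:- [:0,1:], 1:]"
  have "absolutely_irreducible f" unfolding absolutely_irreducible_def
    by (rule irreducible_monic_linear) (simp_all add: f_def map_poly_pCons_0)
  moreover have "pderiv f \<noteq> 0" by (simp add: f_def pderiv_pCons)
  ultimately have "infinite {(x :: 'k, y :: 'm). eval2 f (i x) y = 0}" using assms by (auto simp: PAC_extension_def)
  moreover have "{(x :: 'k, y :: 'm). eval2 f (i x) y = 0} \<subseteq> (\<lambda>x. (x, i x)) ` UNIV"
    by (auto simp: f_def eval2_def)
  ultimately show False using fin finite_subset by blast
qed

text \<open>The construction takes place in the algebraic closures, with \<open>J\<close> extending
  the embedding \<open>i\<close>. The resolvent has coefficients over \<open>M\<close> and descends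
  to a polynomial \<open>g'\<close> to which the PAC property applies. A point with first coordinate
  outside \<open>Bad\<close> gives the weights; irreducibility passes from \<open>M\<close> down to
  \<open>K\<close>, as a factorization over \<open>K\<close> is one over \<open>M\<close>.\<close>

theorem PAC_pencil:
  fixes i :: "'k::field \<Rightarrow> 'm::field" and p :: "'m poly" and a :: "nat \<Rightarrow> 'k"
  assumes PAC: "PAC_extension i" and two: "(2::'k) \<noteq> 0"
    and p: "irreducible p" "separable_poly p" "degree p = n" and n: "n \<ge> 1"
    and a: "\<And>l. l < n \<Longrightarrow> a l \<noteq> 0"
  obtains d v :: "nat \<Rightarrow> 'k" where "inj_on d {..<n}" "\<And>l. l < n \<Longrightarrow> v l \<noteq> 0"
    "irreducible (pencil n d (\<lambda>l. a l * v l ^ 2))" "separable_poly (pencil n d (\<lambda>l. a l * v l ^ 2))"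
proof -
  have ih: "field_hom i" using PAC by (simp add: PAC_extension_def)
  interpret i: field_hom i by fact
  interpret tk: field_hom "to_ac :: 'k \<Rightarrow> 'k alg_closure" by (rule to_ac_hom)
  interpret tm: field_hom "to_ac :: 'm \<Rightarrow> 'm alg_closure" by (rule to_ac_hom)
  interpret mtm: map_poly_inj_idom_hom "to_ac :: 'm \<Rightarrow> 'm alg_closure" ..
  have "hom_on (range to_ac) (\<lambda>x :: 'k alg_closure. to_ac (i (of_ac x)))"
    unfolding hom_on_def by (auto simp: i.hom_minus i.hom_mult simp flip: to_ac_diff to_ac_mult)
  then obtain J where J: "field_hom J" "\<And>x. x \<in> range to_ac \<Longrightarrow> J x = to_ac (i (of_ac x))"
    by (rule hom_extend[OF subfld_range[OF to_ac_hom] _ alg_closure_alg_over]) (rule that)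
  have Jt: "J (to_ac x) = to_ac (i x)" for x using J(2) by simp
  interpret J: field_hom J by fact
  define K where "K = range (to_ac :: 'k \<Rightarrow> 'k alg_closure)"
  define M where "M = range (to_ac :: 'm \<Rightarrow> 'm alg_closure)"
  have K: "subfld K" unfolding K_def by (rule subfld_range[OF to_ac_hom])
  have M: "subfld M" unfolding M_def by (rule subfld_range[OF to_ac_hom])
  have infK: "infinite K" unfolding K_def using PAC_extension_infinite[OF PAC] finite_imageD[OF _ inj_to_ac] by blast
  have algK: "alg_over K x" for x unfolding K_def by (rule alg_closure_alg_over)
  have algM: "alg_over M x" for x unfolding M_def by (rule alg_closure_alg_over)
  have JM: "J x \<in> M" if "x \<in> K" for x using that Jt by (auto simp: K_def M_def)
  have twoK: "(2 :: 'k alg_closure) \<noteq> 0" using two by (metis to_ac_eq_0_iff to_ac_numeral)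
  have twoM: "(2 :: 'm alg_closure) \<noteq> 0"
  proof -
    have "J 2 = 2" by (rule J.hom_numeral)
    thus ?thesis using twoK J.hom_0_iff[of 2] by metis
  qed
  have aK: "to_ac (a l) \<in> K" "to_ac (a l) \<noteq> 0" if "l < n" for l using a[OF that] by (auto simp: K_def)
  obtain d e v c where D: "\<And>i. i < n \<Longrightarrow> d i \<in> K" "inj_on d {..<n}"
    "\<And>i. i < n \<Longrightarrow> v i \<in> polys K" "\<And>i. i < n \<Longrightarrow> v i \<noteq> 0"
    "inj_on e {..<n-1}" "\<And>j. j < n - 1 \<Longrightarrow> e j \<noteq> 0" "n \<ge> 2 \<Longrightarrow> (\<Sum>j<n-1. e j) \<noteq> 0"
    "\<And>k. k < n \<Longrightarrow> pencil n d (\<lambda>i. to_ac (a i) * poly (v i) (c k) ^ 2) = monom 1 (Suc k) * (\<Prod>j<n-Suc k. [:- e j, 1:])"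
    "\<And>k. k < n \<Longrightarrow> (\<Sum>i<n. to_ac (a i) * (\<Prod>j\<in>{..<n}-{i}. - d j) * (poly (v i) (c k) * poly (pderiv (v i)) (c k))) \<noteq> 0"
    by (rule degenerating_pencil[OF K infK algK twoK n aK]) (assumption | rule that)+
  define P where "P = map_poly to_ac p"
  have PM: "P \<in> polys M" unfolding P_def M_def polys_range_iff by blast
  have Psf: "rsquarefree P" using p(2) by (simp add: separable_poly_def P_def)
  have Pdeg: "degree P = n" using p(3) by (simp add: P_def)
  have "finite {x. poly P x = 0}" using Psf by (intro poly_roots_finite) (simp add: rsquarefree_def)
  then obtain \<theta> where "bij_betw \<theta> {0..<n} {x. poly P x = 0}"
    using ex_bij_betw_nat_finite[of "{x. poly P x = 0}"] rsquarefree_split(2)[OF Psf] Pdeg by metis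
  hence th: "inj_on \<theta> {..<n}" "\<theta> ` {..<n} = {x. poly P x = 0}" by (auto simp: bij_betw_def atLeast0LessThan)
  have th_root: "poly P (\<theta> l) = 0" if "l < n" for l using th(2) that by blast
  have th_conj: "poly h (\<theta> l') = 0" if "l < n" "l' < n" "h \<in> polys M" "poly h (\<theta> l) = 0" for l l' h
    using irreducible_conjugate[OF to_ac_hom p(1) th_root[OF that(1), unfolded P_def] th_root[OF that(2), unfolded P_def]
        that(3)[unfolded M_def] that(4)] .
  have th_sep: "\<exists>p\<in>polys M. rsquarefree p \<and> {a. poly p a = 0} = \<theta> ` {..<n}"
    using PM Psf th(2) by (intro bexI[of _ P]) auto
  have vM: "map_poly J (v l) \<in> polys M" if "l < n" for l
    by (intro polysI) (simp add: JM polysD[OF D(3)[OF that]])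
  define f where "f = pencil n (\<lambda>i. [:J (d i):]) (\<lambda>i. [:J (to_ac (a i)):] * map_poly J (v i) ^ 2)"
  note pen = pencil_twisted_cover[OF J(1) M algM twoM n th(1) th_sep th_conj JM[OF D(1)] vM JM[OF aK(1)] D(5-9), folded f_def]
  interpret twisted_cover M n \<theta> f by (rule pen(1))
  obtain g B where g: "\<And>i. coeff g i \<in> polys M" "irreducible g" "pderiv g \<noteq> 0" "finite B"
    "\<And>x. ev x g \<noteq> 0"
    "\<And>x y h1 h2. x \<in> M \<Longrightarrow> x \<notin> B \<Longrightarrow> y \<in> M \<Longrightarrow> poly (ev x g) y = 0 \<Longrightarrow>
      h1 \<in> polys M \<Longrightarrow> h2 \<in> polys M \<Longrightarrow> ev x f = h1 * h2 \<Longrightarrow> degree h1 = 0 \<or> degree h2 = 0"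
    "\<And>x. x \<notin> B \<Longrightarrow> rsquarefree (ev x f)"
    by (rule specialization) (assumption | rule that)+
  define g' where "g' = map_poly (map_poly of_ac) g"
  have gg: "map_poly (map_poly to_ac) g' = g"
  proof (rule poly_eqI)
    fix l
    obtain q where "coeff g l = map_poly to_ac q" using g(1)[of l] unfolding M_def polys_range_iff by blast
    thus "coeff (map_poly (map_poly to_ac) g') l = coeff g l"
      by (simp add: g'_def coeff_map_poly map_poly_map_poly o_def)
  qed
  have "absolutely_irreducible g'" using g(2) by (simp add: absolutely_irreducible_def gg)
  moreover have "pderiv g' \<noteq> 0"
  proof
    assume "pderiv g' = 0"
    hence "pderiv (map_poly (map_poly to_ac) g') = 0"
      using idom_hom.map_poly_pderiv[OF mtm.idom_hom_axioms, of g'] by simp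
    with g(3) show False by (simp add: gg)
  qed
  ultimately have inf: "infinite {(x :: 'k, y :: 'm). eval2 g' (i x) y = 0}"
    using PAC by (auto simp: PAC_extension_def)
  define \<kappa> where "\<kappa> x = to_ac (i x)" for x
  have \<kappa>: "inj \<kappa>" by (auto simp: \<kappa>_def inj_def)
  have \<kappa>h: "field_hom \<kappa>" unfolding \<kappa>_def by unfold_locales (auto simp: i.hom_add i.hom_mult)
  have ev_g: "map_poly to_ac (ev (i x) g') = ev (\<kappa> x) g" for x
    unfolding gg[symmetric] by (rule poly_eqI) (simp add: coeff_map_poly \<kappa>_def)
  have ev_root: "eval2 g' (i x) y = 0 \<longleftrightarrow> poly (ev (\<kappa> x) g) (to_ac y) = 0" for x y
    unfolding poly_ev[symmetric] ev_g[symmetric] by simp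
  \<comment> \<open>Besides the exceptional set \<open>B\<close>, the zeros of the
    \<open>v l\<close> are excluded, so that the weights stay in the square classes of the
    \<open>a l\<close>.\<close>
  define Bad where "Bad = {x. \<kappa> x \<in> B \<or> (\<exists>l<n. poly (map_poly J (v l)) (\<kappa> x) = 0)}"
  have "finite Bad"
  proof -
    have "Bad \<subseteq> \<kappa> -` (B \<union> (\<Union>l<n. {x. poly (map_poly J (v l)) x = 0}))" by (auto simp: Bad_def)
    moreover have "finite (B \<union> (\<Union>l<n. {x. poly (map_poly J (v l)) x = 0}))"
      using g(4) D(4) by (auto intro!: poly_roots_finite)
    ultimately show ?thesis using finite_vimageI[OF _ \<kappa>] finite_subset by blast
  qed
  \<comment> \<open>Infinitely many points force infinitely many first coordinates only because each
    \<open>x\<close> carries finitely many \<open>y\<close>.\<close>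
  have fin_y: "finite {y. eval2 g' (i x) y = 0}" for x
  proof -
    have "{y. eval2 g' (i x) y = 0} \<subseteq> to_ac -` {z. poly (ev (\<kappa> x) g) z = 0}" by (auto simp: ev_root)
    thus ?thesis using finite_vimageI[OF poly_roots_finite[OF g(5)] inj_to_ac] finite_subset by blast
  qed
  have "\<exists>x y. x \<notin> Bad \<and> eval2 g' (i x) y = 0"
  proof (rule ccontr)
    assume "\<not> (\<exists>x y. x \<notin> Bad \<and> eval2 g' (i x) y = 0)"
    hence "{(x, y). eval2 g' (i x) y = 0} \<subseteq> Sigma Bad (\<lambda>x. {y. eval2 g' (i x) y = 0})" by auto
    moreover have "finite (Sigma Bad (\<lambda>x. {y. eval2 g' (i x) y = 0}))" using \<open>finite Bad\<close> fin_y by (intro finite_SigmaI)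
    ultimately show False using inf finite_subset by blast
  qed
  then obtain x y where xy: "x \<notin> Bad" "eval2 g' (i x) y = 0" by blast
  have "\<forall>l. \<exists>q. l < n \<longrightarrow> v l = map_poly to_ac q" using D(3) unfolding K_def polys_range_iff by blast
  then obtain vk where vk: "\<And>l. l < n \<Longrightarrow> v l = map_poly to_ac (vk l)" by metis
  define v0 where "v0 l = poly (vk l) x" for l
  define d0 where "d0 l = of_ac (d l)" for l
  have d0: "d l = to_ac (d0 l)" if "l < n" for l using D(1)[OF that] by (auto simp: d0_def K_def)
  have Jv: "poly (map_poly J (v l)) (\<kappa> x) = \<kappa> (v0 l)" if "l < n" for l
  proof -
    have "poly (map_poly J (v l)) (J (to_ac x)) = J (poly (v l) (to_ac x))" by simp
    also have "poly (v l) (to_ac x) = to_ac (v0 l)" unfolding vk[OF that] v0_def by simp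
    finally show ?thesis by (simp add: Jt \<kappa>_def)
  qed
  define q where "q = pencil n d0 (\<lambda>l. a l * v0 l ^ 2)"
  have pencil_cong: "pencil n D1 W1 = pencil n D2 W2" if "\<And>l. l < n \<Longrightarrow> D1 l = D2 l" "\<And>l. l < n \<Longrightarrow> W1 l = W2 l"
    for D1 D2 W1 W2 :: "nat \<Rightarrow> 'm alg_closure"
    unfolding pencil_def using that by (intro arg_cong2[where f="(-)"] sum.cong prod.cong arg_cong2[where f=smult]) auto
  interpret \<kappa>: field_hom \<kappa> by fact
  have q_map: "map_poly \<kappa> q = ev (\<kappa> x) f"
  proof -
    have "ev (\<kappa> x) f = pencil n (\<lambda>l. J (d l)) (\<lambda>l. J (to_ac (a l)) * poly (map_poly J (v l)) (\<kappa> x) ^ 2)"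
      by (rule pen(2))
    also have "\<dots> = pencil n (\<lambda>l. \<kappa> (d0 l)) (\<lambda>l. \<kappa> (a l * v0 l ^ 2))"
      by (rule pencil_cong) (simp_all add: d0 Jt Jv \<kappa>.hom_mult \<kappa>.hom_power, simp_all add: \<kappa>_def)
    also have "\<dots> = map_poly \<kappa> q" unfolding q_def by (rule pencil_hom[OF \<kappa>.idom_hom_axioms, symmetric])
    finally show ?thesis by (rule sym)
  qed
  have q_deg: "degree q = n" unfolding q_def by (rule degree_pencil[OF n])
  have kB: "\<kappa> x \<notin> B" using xy(1) by (simp add: Bad_def)
  show thesis
  proof (rule that[of d0 v0])
    show "inj_on d0 {..<n}" using D(2) d0 by (auto simp: inj_on_def)
    show "v0 l \<noteq> 0" if "l < n" for l
    proof
      assume "v0 l = 0"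
      hence "poly (map_poly J (v l)) (\<kappa> x) = 0" using Jv[OF that] by simp
      with xy(1) that show False by (auto simp: Bad_def)
    qed
    have q0: "q \<noteq> 0" using q_deg n by auto
    interpret mk: map_poly_idom_hom \<kappa> ..
    show "irreducible (pencil n d0 (\<lambda>l. a l * v0 l ^ 2))" unfolding q_def[symmetric]
    proof (rule Factorial_Ring.irreducibleI)
      show "q \<noteq> 0" by (rule q0)
      show "\<not> q dvd 1" using dvd_imp_degree_le[of q 1] q_deg n by auto
      fix h1 h2 assume h: "q = h1 * h2"
      have in_M: "map_poly \<kappa> h \<in> polys M" for h by (intro polysI) (simp add: M_def \<kappa>_def)
      have "degree (map_poly \<kappa> h1) = 0 \<or> degree (map_poly \<kappa> h2) = 0"
      proof (rule g(6)[OF _ kB _ _ in_M in_M])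
        show "\<kappa> x \<in> M" "to_ac y \<in> M" by (simp_all add: M_def \<kappa>_def)
        show "poly (ev (\<kappa> x) g) (to_ac y) = 0" using xy(2) ev_root by blast
        show "ev (\<kappa> x) f = map_poly \<kappa> h1 * map_poly \<kappa> h2" unfolding q_map[symmetric] h by (rule mk.hom_mult)
      qed
      hence "degree h1 = 0 \<or> degree h2 = 0" by simp
      thus "h1 dvd 1 \<or> h2 dvd 1" using q0 h by (metis is_unit_triv degree_0_id mult_zero_left mult_zero_right pCons_0_0)
    qed
    \<comment> \<open>A double root in the closure of \<open>'k\<close> would be carried by
      \<open>J\<close> to one in the closure of \<open>'m\<close>.\<close>
    have "rsquarefree (map_poly to_ac q)"
    proof -
      have eq: "map_poly J (map_poly to_ac q) = map_poly \<kappa> q"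
        by (rule poly_eqI) (simp add: coeff_map_poly Jt \<kappa>_def)
      have sf: "rsquarefree (map_poly J (map_poly to_ac q))" unfolding eq q_map by (rule g(7)[OF kB])
      have tq0: "map_poly to_ac q \<noteq> 0" using q0 by (metis map_poly_eq_0_iff to_ac_0 to_ac_eq_0_iff)
      hence Jq0: "map_poly J (map_poly to_ac q) \<noteq> 0" using sf by (simp add: rsquarefree_def)
      show ?thesis unfolding rsquarefree_iff_pderiv[OF tq0]
      proof (intro allI impI notI)
        fix b assume b: "poly (map_poly to_ac q) b = 0" "poly (pderiv (map_poly to_ac q)) b = 0"
        have "poly (map_poly J (map_poly to_ac q)) (J b) = 0" using b(1) by simp
        moreover have "poly (pderiv (map_poly J (map_poly to_ac q))) (J b) = J (poly (pderiv (map_poly to_ac q)) b)"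
          by (simp flip: J.map_poly_pderiv)
        ultimately show False using sf b(2) unfolding rsquarefree_iff_pderiv[OF Jq0] by simp
      qed
    qed
    thus "separable_poly (pencil n d0 (\<lambda>l. a l * v0 l ^ 2))" by (simp add: separable_poly_def q_def)
  qed
qed

section \<open>Simple extensions and their trace\<close>

lemma ring_of_type_algebra_simps:
  "carrier ring_of_type_algebra = UNIV" "(\<otimes>\<^bsub>ring_of_type_algebra\<^esub>) = (*)" "(\<oplus>\<^bsub>ring_of_type_algebra\<^esub>) = (+)"
  "\<one>\<^bsub>ring_of_type_algebra\<^esub> = 1" "\<zero>\<^bsub>ring_of_type_algebra\<^esub> = 0"
  by (simp_all add: ring_of_type_algebra_def)

lemma ring_of_type_algebra_uminus: "\<ominus>\<^bsub>ring_of_type_algebra\<^esub> x = - (x :: 'a::field)"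
proof -
  interpret R: Ring.field "ring_of_type_algebra :: 'a ring" by (rule field_from_type_algebra)
  show ?thesis by (rule R.minus_equality) (simp_all add: ring_of_type_algebra_simps)
qed

lemma ring_of_type_algebra_inv: "x \<noteq> 0 \<Longrightarrow> inv\<^bsub>ring_of_type_algebra\<^esub> x = inverse (x :: 'a::field)"
proof -
  assume "x \<noteq> 0"
  interpret R: Ring.field "ring_of_type_algebra :: 'a ring" by (rule field_from_type_algebra)
  show ?thesis by (rule R.comm_inv_char) (use \<open>x \<noteq> 0\<close> in \<open>simp_all add: ring_of_type_algebra_simps\<close>)
qed

lemma subfield_iff_subfld: "subfield F (ring_of_type_algebra :: 'a::field ring) \<longleftrightarrow> subfld F"
proof
  interpret R: Ring.field "ring_of_type_algebra :: 'a ring" by (rule field_from_type_algebra)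
  assume F: "subfield F (ring_of_type_algebra :: 'a ring)"
  note sr = subfieldE(1)[OF F]
  show "subfld F"
  proof (rule subfldI)
    show "1 \<in> F" using subringE(3)[OF sr] by (simp add: ring_of_type_algebra_simps)
    fix x y assume "x \<in> F" "y \<in> F"
    thus "x - y \<in> F" using subringE(7)[OF sr, of x "- y"] subringE(5)[OF sr, of y]
      by (simp add: ring_of_type_algebra_simps ring_of_type_algebra_uminus)
    show "x * y \<in> F" using subringE(6)[OF sr, of x y] \<open>x \<in> F\<close> \<open>y \<in> F\<close> by (simp add: ring_of_type_algebra_simps)
  next
    fix x assume x: "x \<in> F" "x \<noteq> 0"
    thus "inverse x \<in> F" using R.subfield_m_inv(1)[OF F, of x]
      by (simp add: ring_of_type_algebra_simps ring_of_type_algebra_inv)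
  qed
next
  interpret R: Ring.field "ring_of_type_algebra :: 'a ring" by (rule field_from_type_algebra)
  assume F: "subfld F"
  have "subring F (ring_of_type_algebra :: 'a ring)"
    by (rule R.subringI) (auto simp: ring_of_type_algebra_simps ring_of_type_algebra_uminus
        intro: subfld_1[OF F] subfld_mult[OF F] subfld_add[OF F] subfld_uminus[OF F])
  thus "subfield F (ring_of_type_algebra :: 'a ring)"
    by (rule R.subfieldI') (auto simp: ring_of_type_algebra_simps ring_of_type_algebra_inv intro: subfld_inverse[OF F])
qed

lemma ext_scale_vector_space: "field_hom i \<Longrightarrow> vector_space (ext_scale i)"
proof -
  assume "field_hom i"
  then interpret field_hom i .
  show ?thesis by unfold_locales (simp_all add: ext_scale_def hom_add hom_mult algebra_simps)
qed

lemma lagrange_interpolation: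
  fixes \<beta> :: "nat \<Rightarrow> 'e::field"
  assumes b: "inj_on \<beta> {..<n}" and h: "degree h < n"
  shows "h = (\<Sum>l<n. smult (poly h (\<beta> l) / (\<Prod>m\<in>{..<n}-{l}. \<beta> l - \<beta> m)) (\<Prod>m\<in>{..<n}-{l}. [:- \<beta> m, 1:]))"
proof -
  define D where "D l = (\<Prod>m\<in>{..<n}-{l}. \<beta> l - \<beta> m)" for l
  have D: "D l \<noteq> 0" if "l < n" for l using b that by (auto simp: D_def dest: inj_onD)
  define H where "H = (\<Sum>l<n. smult (poly h (\<beta> l) / D l) (\<Prod>m\<in>{..<n}-{l}. [:- \<beta> m, 1:]))"
  have at: "poly H (\<beta> k) = poly h (\<beta> k)" if k: "k < n" for k
  proof -
    have z: "(\<Prod>m\<in>{..<n}-{l}. \<beta> k - \<beta> m) = 0" if "l \<noteq> k" for l using k that by (intro prod_zero) auto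
    have "poly H (\<beta> k) = (\<Sum>l<n. poly h (\<beta> l) / D l * (\<Prod>m\<in>{..<n}-{l}. \<beta> k - \<beta> m))"
      by (simp add: H_def poly_sum poly_prod)
    also have "\<dots> = (\<Sum>l\<in>{k}. poly h (\<beta> l) / D l * (\<Prod>m\<in>{..<n}-{l}. \<beta> k - \<beta> m))"
      using k z by (intro sum.mono_neutral_right) auto
    also have "\<dots> = poly h (\<beta> k)" using D[OF k] by (simp add: D_def)
    finally show ?thesis .
  qed
  have "degree H \<le> n - 1" unfolding H_def
  proof (rule degree_sum_le)
    fix l assume "l \<in> {..<n}"
    hence "degree (\<Prod>m\<in>{..<n}-{l}. [:- \<beta> m, 1:]) = n - 1" by (subst degree_prod_eq_sum_degree) auto
    thus "degree (smult (poly h (\<beta> l) / D l) (\<Prod>m\<in>{..<n}-{l}. [:- \<beta> m, 1:])) \<le> n - 1"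
      using degree_smult_le[of "poly h (\<beta> l) / D l" "\<Prod>m\<in>{..<n}-{l}. [:- \<beta> m, 1:]"] by linarith
  qed simp
  hence lt: "degree (h - H) < n" using h degree_diff_le[of h "n - 1" H] by linarith
  have "h - H = 0"
  proof (rule ccontr)
    assume nz: "h - H \<noteq> 0"
    have "\<beta> ` {..<n} \<subseteq> {x. poly (h - H) x = 0}" using at by auto
    hence "card (\<beta> ` {..<n}) \<le> card {x. poly (h - H) x = 0}" by (rule card_mono[OF poly_roots_finite[OF nz]])
    also have "\<dots> \<le> degree (h - H)" by (rule card_poly_roots_bound[OF nz])
    finally show False using lt b by (simp add: card_image)
  qed
  hence "h = H" by simp
  thus ?thesis unfolding H_def D_def .
qed

text \<open>Lagrange interpolation of \<open>h\<close>, evaluated at \<open>c\<close> and divided by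
  \<open>\<Prod>l<n. c - \<beta> l\<close>. Later it evaluates the traces of products of basis
  elements.\<close>

lemma lagrange_sum:
  fixes \<beta> :: "nat \<Rightarrow> 'e::field"
  assumes b: "inj_on \<beta> {..<n}" and h: "degree h < n" and c: "\<And>l. l < n \<Longrightarrow> \<beta> l \<noteq> c"
  shows "(\<Sum>l<n. poly h (\<beta> l) / ((\<Prod>m\<in>{..<n}-{l}. \<beta> l - \<beta> m) * (\<beta> l - c))) = - poly h c / (\<Prod>l<n. c - \<beta> l)"
proof -
  define D where "D l = (\<Prod>m\<in>{..<n}-{l}. \<beta> l - \<beta> m)" for l
  define q where "q = (\<Prod>l<n. c - \<beta> l)"
  have q0: "q \<noteq> 0" unfolding q_def using c by auto
  have "poly h c = (\<Sum>l<n. poly h (\<beta> l) / D l * (\<Prod>m\<in>{..<n}-{l}. c - \<beta> m))"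
    by (subst lagrange_interpolation[OF b h]) (simp add: D_def poly_sum poly_prod)
  also have "\<dots> = (\<Sum>l<n. - q * (poly h (\<beta> l) / (D l * (\<beta> l - c))))"
  proof (intro sum.cong refl)
    fix l assume l: "l \<in> {..<n}"
    have "q = (c - \<beta> l) * (\<Prod>m\<in>{..<n}-{l}. c - \<beta> m)" unfolding q_def using l by (intro prod.remove) auto
    moreover have "\<beta> l - c \<noteq> 0" using c l by auto
    ultimately have "(\<Prod>m\<in>{..<n}-{l}. c - \<beta> m) = - q / (\<beta> l - c)" by (simp add: field_simps)
    thus "poly h (\<beta> l) / D l * (\<Prod>m\<in>{..<n}-{l}. c - \<beta> m) = - q * (poly h (\<beta> l) / (D l * (\<beta> l - c)))" by simp
  qed
  also have "\<dots> = - q * (\<Sum>l<n. poly h (\<beta> l) / (D l * (\<beta> l - c)))" by (simp only: sum_distrib_left)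
  finally show "(\<Sum>l<n. poly h (\<beta> l) / ((\<Prod>m\<in>{..<n}-{l}. \<beta> l - \<beta> m) * (\<beta> l - c))) = - poly h c / (\<Prod>l<n. c - \<beta> l)"
    using q0 by (simp add: D_def q_def field_simps)
qed

text \<open>That \<open>\<beta>\<close> lists \<open>n = degree q\<close> distinct roots encodes
  separability. The extension studied is \<open>K(\<beta> 0)\<close>, with its embeddings realized
  inside the algebraic closure.\<close>

locale simple_extension_roots =
  fixes q :: "'k::field poly" and n :: nat and \<beta> :: "nat \<Rightarrow> 'k alg_closure"
  assumes q_irr: "irreducible q" and q_deg: "degree q = n" and q_lead: "lead_coeff q = 1"
    and roots: "bij_betw \<beta> {..<n} {x. poly (map_poly to_ac q) x = 0}"
begin

definition K where "K = range (to_ac :: 'k \<Rightarrow> 'k alg_closure)"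

definition F where "F = adj K (\<beta> 0)"

lemma K: "subfld K" and algK: "alg_over K x"
  unfolding K_def by (rule subfld_range[OF to_ac_hom], rule alg_closure_alg_over)

lemma F: "subfld F" and KF: "K \<subseteq> F" and \<beta>F: "\<beta> 0 \<in> F"
  unfolding F_def by (rule subfld_adj[OF K algK], rule adj_base[OF K], rule adj_gen[OF K])

lemma \<beta>_inj: "inj_on \<beta> {..<n}"
  using roots by (simp add: bij_betw_def)

lemma \<beta>_root: "l < n \<Longrightarrow> poly (map_poly to_ac q) (\<beta> l) = 0"
  using roots by (auto simp: bij_betw_def)

lemma n_pos: "n > 0"
proof (rule ccontr)
  assume "\<not> n > 0"
  hence "degree q = 0" using q_deg by simp
  then obtain c where "q = [:c:]" by (metis degree_0_id)
  moreover have "q \<noteq> 0" using q_irr by auto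
  ultimately have "q dvd 1" by (metis is_unit_triv pCons_0_0)
  thus False using q_irr by (simp add: Factorial_Ring.irreducible_def)
qed

lemma map_q: "map_poly to_ac q = (\<Prod>l<n. [:- \<beta> l, 1:])" "rsquarefree (map_poly to_ac q)"
proof -
  interpret t: field_hom "to_ac :: 'k \<Rightarrow> 'k alg_closure" by (rule to_ac_hom)
  define R where "R = {x. poly (map_poly to_ac q) x = 0}"
  have q0: "map_poly to_ac q \<noteq> 0" using q_lead by (metis leading_coeff_0_iff t.hom_lead_coeff t.hom_one zero_neq_one)
  have R: "finite R" unfolding R_def by (rule poly_roots_finite[OF q0])
  have cR: "card R = n" using bij_betw_same_card[OF roots] by (simp add: R_def)
  have "(\<Prod>x\<in>R. [:-x,1:]) dvd map_poly to_ac q" by (rule prod_linear_dvd[OF R]) (simp add: R_def)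
  then obtain g where g: "map_poly to_ac q = (\<Prod>x\<in>R. [:-x,1:]) * g" by (rule dvdE)
  have nz: "g \<noteq> 0" "(\<Prod>x\<in>R. [:-x,1:]) \<noteq> 0" using q0 g by auto
  have "degree (\<Prod>x\<in>R. [:-x,1:]) = n" using cR by (subst degree_prod_eq_sum_degree) auto
  hence "degree (map_poly to_ac q) = n + degree g" unfolding g using nz by (simp add: degree_mult_eq)
  hence "degree g = 0" using q_deg by simp
  moreover have "lead_coeff (map_poly to_ac q) = lead_coeff g" unfolding g lead_coeff_mult by (simp add: lead_coeff_prod)
  hence "lead_coeff g = 1" using q_lead by simp
  ultimately have "g = 1" by (metis degree_0_id one_pCons)
  hence eq: "map_poly to_ac q = (\<Prod>x\<in>R. [:-x,1:])" using g by simp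
  have "\<beta> ` {..<n} = R" using roots by (simp add: bij_betw_def R_def)
  thus "map_poly to_ac q = (\<Prod>l<n. [:- \<beta> l, 1:])" unfolding eq using prod.reindex[OF \<beta>_inj, of "\<lambda>x. [:-x,1:]"] by simp
  show "rsquarefree (map_poly to_ac q)" unfolding eq by (rule rsquarefree_prod_linear[OF R])
qed

lemma conj_exists: "l < n \<Longrightarrow> \<exists>\<sigma>\<in>homs_over K. \<sigma> (\<beta> 0) = \<beta> l"
proof -
  assume l: "l < n"
  obtain \<sigma> where "\<sigma> \<in> homs_over K" "\<sigma> (\<beta> 0) = \<beta> l"
  proof (rule conjugate_hom[OF K algK, of "\<beta> 0" "\<beta> l"])
    show "poly p (\<beta> l) = 0" if "p \<in> polys K" "poly p (\<beta> 0) = 0" for p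
      using irreducible_conjugate[OF to_ac_hom q_irr \<beta>_root[OF n_pos] \<beta>_root[OF l] that(1)[unfolded K_def] that(2)] .
  qed blast
  thus ?thesis by blast
qed

text \<open>Some endomorphism of the whole closure; on \<open>F\<close> it is the
  \<open>l\<close>-th embedding and does not depend on the choice.\<close>

definition conj :: "nat \<Rightarrow> 'k alg_closure \<Rightarrow> 'k alg_closure" where
  "conj l = (SOME \<sigma>. \<sigma> \<in> homs_over K \<and> \<sigma> (\<beta> 0) = \<beta> l)"

lemma conj: "l < n \<Longrightarrow> conj l \<in> homs_over K" "l < n \<Longrightarrow> conj l (\<beta> 0) = \<beta> l"
proof -
  assume "l < n"
  hence "\<exists>\<sigma>. \<sigma> \<in> homs_over K \<and> \<sigma> (\<beta> 0) = \<beta> l" using conj_exists by blast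
  from someI_ex[OF this] show "conj l \<in> homs_over K" "conj l (\<beta> 0) = \<beta> l" by (simp_all add: conj_def)
qed

lemma conj_hom: "l < n \<Longrightarrow> field_hom (conj l)" and conj_fixed: "l < n \<Longrightarrow> conj l (to_ac c) = to_ac c"
  using conj(1)[of l] by (simp_all add: homs_over_def K_def)

lemma F_poly:
  assumes x: "x \<in> F"
  obtains h :: "'k poly" where "degree h < n" "x = poly (map_poly to_ac h) (\<beta> 0)"
proof -
  interpret t: field_hom "to_ac :: 'k \<Rightarrow> 'k alg_closure" by (rule to_ac_hom)
  interpret mt: map_poly_inj_idom_hom "to_ac :: 'k \<Rightarrow> 'k alg_closure" ..
  obtain p where p: "p \<in> polys K" "x = poly p (\<beta> 0)" using x by (auto simp: F_def adj_def)
  obtain p' where p': "p = map_poly to_ac p'" using p(1) polys_range_iff unfolding K_def by blast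
  define h where "h = p' mod q"
  have q0: "q \<noteq> 0" using q_irr by auto
  have "p' = q * (p' div q) + h" by (simp add: h_def)
  hence "poly p (\<beta> 0) = poly (map_poly to_ac q) (\<beta> 0) * poly (map_poly to_ac (p' div q)) (\<beta> 0) + poly (map_poly to_ac h) (\<beta> 0)"
    unfolding p' by (metis mt.hom_add mt.hom_mult poly_add poly_mult)
  hence "x = poly (map_poly to_ac h) (\<beta> 0)" using p \<beta>_root[OF n_pos] by simp
  moreover have "degree h < n" using degree_mod_less[OF q0, of p'] n_pos q_deg by (auto simp: h_def)
  ultimately show thesis using that by blast
qed

interpretation V: vector_space "ext_scale (to_ac :: 'k \<Rightarrow> 'k alg_closure)"
  by (rule ext_scale_vector_space[OF to_ac_hom])

lemma F_subspace: "V.subspace F"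
proof (rule V.subspaceI)
  show "ext_scale to_ac c x \<in> F" if "x \<in> F" for c x
    unfolding ext_scale_def using KF that by (intro subfld_mult[OF F]) (auto simp: K_def)
qed (use subfld_0[OF F] subfld_add[OF F] in auto)

lemma F_span: "V.span ((\<lambda>k. \<beta> 0 ^ k) ` {..<n}) = F"
proof
  show "V.span ((\<lambda>k. \<beta> 0 ^ k) ` {..<n}) \<subseteq> F"
    by (rule V.span_minimal[OF _ F_subspace]) (auto intro: subfld_power[OF F \<beta>F])
  show "F \<subseteq> V.span ((\<lambda>k. \<beta> 0 ^ k) ` {..<n})"
  proof
    fix x assume "x \<in> F"
    then obtain h where h: "degree h < n" "x = poly (map_poly to_ac h) (\<beta> 0)" by (rule F_poly)
    have "x = (\<Sum>k\<le>degree h. ext_scale to_ac (coeff h k) (\<beta> 0 ^ k))"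
      unfolding h(2) poly_altdef by (simp add: ext_scale_def coeff_map_poly degree_map_poly)
    also have "\<dots> \<in> V.span ((\<lambda>k. \<beta> 0 ^ k) ` {..<n})"
      using h(1) by (intro V.span_sum V.span_scale V.span_base) auto
    finally show "x \<in> V.span ((\<lambda>k. \<beta> 0 ^ k) ` {..<n})" .
  qed
qed

lemma F_field_extension: "field_extension (to_ac :: 'k \<Rightarrow> 'k alg_closure) F"
  unfolding field_extension_def subfield_iff_subfld using to_ac_hom F KF by (simp add: K_def)

lemma F_finite: "finite_extension (to_ac :: 'k \<Rightarrow> 'k alg_closure) F"
  unfolding finite_extension_def using F_field_extension F_span by blast

lemma F_separable: "separable_extension (to_ac :: 'k \<Rightarrow> 'k alg_closure) F"
  unfolding separable_extension_def
proof (intro conjI ballI F_field_extension)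
  fix x assume x: "x \<in> F"
  have "F \<subseteq> gen_fld K {\<beta> 0}" unfolding F_def
    using gen_fld_gens[of "{\<beta> 0}" K] by (intro adj_least subfld_gen_fld gen_fld_base) auto
  moreover have "sep_over K (\<beta> 0)" unfolding sep_over_def K_def
    using \<beta>_root[OF n_pos] map_q(2) polys_range_iff[of "map_poly to_ac q"] by blast
  ultimately have "sep_over K x" using sep_over_gen_fld[of "{\<beta> 0}" K x] K algK x by auto
  then obtain f where f: "f \<in> polys K" "rsquarefree f" "poly f x = 0" by (auto simp: sep_over_def)
  obtain f' where f': "f = map_poly to_ac f'" using f(1) polys_range_iff unfolding K_def by blast
  obtain p where p: "irreducible p" "poly (map_poly to_ac p) x = 0" "p dvd f'"
    using minimal_polynomial_type[OF to_ac_hom alg_closure_alg_over[of x]] f(3) unfolding f' by metis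
  interpret t: field_hom "to_ac :: 'k \<Rightarrow> 'k alg_closure" by (rule to_ac_hom)
  interpret mt: map_poly_inj_idom_hom "to_ac :: 'k \<Rightarrow> 'k alg_closure" ..
  have "map_poly to_ac p dvd f" unfolding f' by (rule mt.hom_dvd[OF p(3)])
  hence "separable_poly p" unfolding separable_poly_def using rsquarefree_dvd f(2) by blast
  with p show "\<exists>p. irreducible p \<and> separable_poly p \<and> poly (map_poly to_ac p) x = 0" by blast
qed

lemma F_basis_finite:
  assumes "\<not> V.dependent B" "B \<subseteq> F"
  shows "finite B" "card B \<le> n"
proof -
  have "B \<subseteq> V.span ((\<lambda>k. \<beta> 0 ^ k) ` {..<n})" using assms F_span by simp
  from V.independent_span_bound[OF _ assms(1) this] have b: "finite B" "card B \<le> card ((\<lambda>k. \<beta> 0 ^ k) ` {..<n})" by auto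
  thus "finite B" "card B \<le> n" using card_image_le[of "{..<n}" "\<lambda>k. \<beta> 0 ^ k"] by auto
qed

text \<open>The basis \<open>B\<close> hidden in \<open>field_trace\<close> is arbitrary. The matrix
  \<open>U\<close> recovers coordinates from conjugates: the coordinate of \<open>y\<close> at
  \<open>b\<close> is \<open>\<Sum>l<n. U b l * conj l y\<close>. In the trace of multiplication by
  \<open>x\<close> this gives \<open>conj l x\<close> times
  \<open>\<Sum>b\<in>B. U b l * conj l b\<close>, and the latter sum is 1.\<close>

theorem field_trace_conj:
  assumes x: "x \<in> F"
  shows "to_ac (field_trace to_ac F x) = (\<Sum>l<n. conj l x)"
proof -
  define B where "B = (SOME B. \<not> V.dependent B \<and> V.span B = F)"
  have "\<exists>B. \<not> V.dependent B \<and> V.span B = F"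
  proof -
    obtain B where "B \<subseteq> F" "\<not> V.dependent B" "F \<subseteq> V.span B" using V.maximal_independent_subset by blast
    moreover have "V.span B \<subseteq> F" by (rule V.span_minimal[OF _ F_subspace]) fact
    ultimately show ?thesis by blast
  qed
  from someI_ex[OF this] have B: "\<not> V.dependent B" "V.span B = F" unfolding B_def by auto
  have BF: "B \<subseteq> F" using B(2) V.span_superset by blast
  have finB: "finite B" by (rule F_basis_finite[OF B(1) BF])
  define rep where "rep = V.representation B"
  have rep_sum: "y = (\<Sum>b\<in>B. to_ac (rep y b) * b)" if "y \<in> F" for y
    using V.sum_representation_eq[OF B(1), of y B] finB that B(2) by (simp add: rep_def ext_scale_def)
  have tr: "field_trace to_ac F x = (\<Sum>b\<in>B. rep (x * b) b)"
    unfolding field_trace_def Let_def B_def rep_def ..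
  define L where "L l = smult (inverse (\<Prod>m\<in>{..<n}-{l}. \<beta> l - \<beta> m)) (\<Prod>m\<in>{..<n}-{l}. [:- \<beta> m, 1:])" for l
  have Ldeg: "coeff (L l) k = 0" if "l < n" "k \<ge> n" for l k
  proof (rule coeff_eq_0)
    have "degree (\<Prod>m\<in>{..<n}-{l}. [:- \<beta> m, 1:]) = n - 1" using that(1) by (subst degree_prod_eq_sum_degree) auto
    hence "degree (L l) \<le> n - 1" unfolding L_def by (simp add: degree_smult_le[THEN le_trans])
    thus "degree (L l) < k" using that n_pos by linarith
  qed
  have Dnz: "(\<Prod>m\<in>{..<n}-{l}. \<beta> l - \<beta> m) \<noteq> 0" if "l < n" for l using \<beta>_inj that by (auto dest: inj_onD)
  have L1: "poly (L l) (\<beta> l) = 1" if "l < n" for l using Dnz[OF that] by (simp add: L_def poly_prod)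
  have power_F: "\<beta> 0 ^ k \<in> F" for k by (rule subfld_power[OF F \<beta>F])
  \<comment> \<open>An element is the value at \<open>\<beta> 0\<close> of the combination of the
    \<open>L l\<close> weighted by its conjugates; the entries of \<open>U\<close> come from the
    coordinates of the powers of \<open>\<beta> 0\<close>.\<close>
  define U where "U b l = (\<Sum>k<n. coeff (L l) k * to_ac (rep (\<beta> 0 ^ k) b))" for b l
  have U1: "(\<Sum>b\<in>B. U b l * conj l b) = 1" if l: "l < n" for l
  proof -
    interpret c: field_hom "conj l" by (rule conj_hom[OF l])
    have pw: "(\<Sum>b\<in>B. to_ac (rep (\<beta> 0 ^ k) b) * conj l b) = \<beta> l ^ k" for k
    proof -
      have "conj l (\<beta> 0 ^ k) = conj l (\<Sum>b\<in>B. to_ac (rep (\<beta> 0 ^ k) b) * b)" using rep_sum[OF power_F] by simp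
      thus ?thesis by (simp add: c.hom_power c.hom_sum c.hom_mult conj_fixed[OF l] conj(2)[OF l])
    qed
    have "(\<Sum>b\<in>B. U b l * conj l b) = (\<Sum>b\<in>B. \<Sum>k<n. coeff (L l) k * (to_ac (rep (\<beta> 0 ^ k) b) * conj l b))"
      by (simp add: U_def sum_distrib_right mult.assoc)
    also have "\<dots> = (\<Sum>k<n. coeff (L l) k * (\<Sum>b\<in>B. to_ac (rep (\<beta> 0 ^ k) b) * conj l b))"
      unfolding sum_distrib_left by (rule sum.swap)
    also have "\<dots> = (\<Sum>k<n. coeff (L l) k * \<beta> l ^ k)" by (simp only: pw)
    also have "\<dots> = poly (L l) (\<beta> l)"
      unfolding poly_altdef
      by (rule sum.mono_neutral_cong) (use Ldeg[OF l] in \<open>auto intro: coeff_eq_0 simp: not_le\<close>)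
    finally show ?thesis using L1[OF l] by simp
  qed
  have U2: "(\<Sum>l<n. U b l * conj l b') = (if b' = b then 1 else 0)" if b: "b \<in> B" "b' \<in> B" for b b'
  proof -
    obtain h where h: "degree h < n" "b' = poly (map_poly to_ac h) (\<beta> 0)" using F_poly[of b'] BF b by blast
    define H where "H = map_poly to_ac h"
    have HK: "H \<in> polys K" unfolding H_def K_def using polys_range_iff by blast
    have Hdeg: "degree H < n" using h(1) degree_map_poly_le[of to_ac h] by (simp add: H_def)
    have cb: "conj l b' = poly H (\<beta> l)" if "l < n" for l
      using homs_over_poly[OF conj(1)[OF that] HK, of "\<beta> 0"] conj(2)[OF that] h(2) by (simp add: H_def)
    have "H = (\<Sum>l<n. smult (poly H (\<beta> l) / (\<Prod>m\<in>{..<n}-{l}. \<beta> l - \<beta> m)) (\<Prod>m\<in>{..<n}-{l}. [:- \<beta> m, 1:]))"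
      by (rule lagrange_interpolation[OF \<beta>_inj Hdeg])
    also have "\<dots> = (\<Sum>l<n. smult (conj l b') (L l))" by (intro sum.cong) (auto simp: L_def cb field_simps)
    finally have Hc: "coeff H k = (\<Sum>l<n. coeff (L l) k * conj l b')" for k by (simp add: coeff_sum mult.commute)
    have "(\<Sum>l<n. U b l * conj l b') = (\<Sum>l<n. \<Sum>k<n. coeff (L l) k * conj l b' * to_ac (rep (\<beta> 0 ^ k) b))"
      by (simp add: U_def sum_distrib_left mult_ac)
    also have "\<dots> = (\<Sum>k<n. coeff H k * to_ac (rep (\<beta> 0 ^ k) b))"
      unfolding Hc sum_distrib_right by (rule sum.swap)
    also have "\<dots> = to_ac (\<Sum>k<n. coeff h k * rep (\<beta> 0 ^ k) b)" by (simp add: H_def coeff_map_poly to_ac_sum)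
    also have "(\<Sum>k<n. coeff h k * rep (\<beta> 0 ^ k) b) = rep b' b"
    proof -
      have "b' = (\<Sum>k\<le>degree h. ext_scale to_ac (coeff h k) (\<beta> 0 ^ k))"
        unfolding h(2) poly_altdef by (simp add: ext_scale_def coeff_map_poly degree_map_poly)
      also have "\<dots> = (\<Sum>k<n. ext_scale to_ac (coeff h k) (\<beta> 0 ^ k))"
        using h(1) by (intro sum.mono_neutral_left) (auto simp: ext_scale_def coeff_eq_0)
      finally have e: "b' = (\<Sum>k<n. ext_scale to_ac (coeff h k) (\<beta> 0 ^ k))" .
      have sp: "ext_scale to_ac (coeff h k) (\<beta> 0 ^ k) \<in> V.span B" "\<beta> 0 ^ k \<in> V.span B" for k
        using V.span_scale[of "\<beta> 0 ^ k" B] power_F[of k] B(2) by auto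
      show ?thesis unfolding rep_def
        by (subst e, subst V.representation_sum[OF B(1)]) (use sp in \<open>auto simp: V.representation_scale[OF B(1)]\<close>)
    qed
    also have "rep b' b = (if b' = b then 1 else 0)" unfolding rep_def using V.representation_basis[OF B(1) b(2)] by auto
    finally show ?thesis by simp
  qed
  have "to_ac (field_trace to_ac F x) = (\<Sum>b\<in>B. to_ac (rep (x * b) b))" unfolding tr by (rule to_ac_sum)
  also have "\<dots> = (\<Sum>b\<in>B. \<Sum>b'\<in>B. to_ac (rep (x * b) b') * (if b' = b then 1 else 0))"
    using finB by (intro sum.cong refl) (simp add: if_distrib cong: if_cong)
  also have "\<dots> = (\<Sum>b\<in>B. \<Sum>b'\<in>B. to_ac (rep (x * b) b') * (\<Sum>l<n. U b l * conj l b'))"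
    by (intro sum.cong refl) (simp add: U2)
  also have "\<dots> = (\<Sum>b\<in>B. \<Sum>b'\<in>B. \<Sum>l<n. U b l * (to_ac (rep (x * b) b') * conj l b'))"
    by (simp add: sum_distrib_left mult_ac)
  also have "\<dots> = (\<Sum>b\<in>B. \<Sum>l<n. \<Sum>b'\<in>B. U b l * (to_ac (rep (x * b) b') * conj l b'))"
    by (intro sum.cong refl sum.swap)
  also have "\<dots> = (\<Sum>b\<in>B. \<Sum>l<n. U b l * (conj l x * conj l b))"
  proof (intro sum.cong refl)
    fix b l assume b: "b \<in> B" and "l \<in> {..<n}"
    hence l: "l < n" by simp
    interpret c: field_hom "conj l" by (rule conj_hom[OF l])
    have "x * b \<in> F" using x b BF subfld_mult[OF F] by blast
    hence "conj l (x * b) = conj l (\<Sum>b'\<in>B. to_ac (rep (x * b) b') * b')" using rep_sum by simp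
    hence "conj l x * conj l b = (\<Sum>b'\<in>B. to_ac (rep (x * b) b') * conj l b')"
      by (simp add: c.hom_mult c.hom_sum conj_fixed[OF l])
    thus "(\<Sum>b'\<in>B. U b l * (to_ac (rep (x * b) b') * conj l b')) = U b l * (conj l x * conj l b)"
      by (simp add: sum_distrib_left)
  qed
  also have "\<dots> = (\<Sum>l<n. \<Sum>b\<in>B. conj l x * (U b l * conj l b))"
    by (subst sum.swap) (simp add: mult_ac)
  also have "\<dots> = (\<Sum>l<n. conj l x)" unfolding sum_distrib_left[symmetric] by (simp add: U1)
  finally show ?thesis .
qed

end

section \<open>Diagonalization\<close>

context vector_space
begin

lemma dual_family_independent:
  fixes f :: "nat \<Rightarrow> 'b \<Rightarrow> 'a"
  assumes V: "subspace V" and e: "\<And>i. i < n \<Longrightarrow> e i \<in> V"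
    and add: "\<And>i x y. i < n \<Longrightarrow> x \<in> V \<Longrightarrow> y \<in> V \<Longrightarrow> f i (x + y) = f i x + f i y"
    and scl: "\<And>i c x. i < n \<Longrightarrow> x \<in> V \<Longrightarrow> f i (scale c x) = c * f i x"
    and dual: "\<And>i j. i < n \<Longrightarrow> j < n \<Longrightarrow> f i (e j) = (if i = j then 1 else 0)"
  shows "i < n \<Longrightarrow> f i (\<Sum>j<n. scale (c j) (e j)) = c i"
    and "inj_on e {..<n}" and "\<not> dependent (e ` {..<n})"
proof -
  have lin: "f i (\<Sum>j\<in>J. scale (c j) (e j)) = (\<Sum>j\<in>J. c j * f i (e j))" if i: "i < n" and J: "J \<subseteq> {..<n}" for i c J
  proof -
    have f0: "f i 0 = 0" using scl[OF i subspace_0[OF V], of 0] by simp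
    show ?thesis using J
    proof (induction J rule: infinite_finite_induct)
      case (insert j J)
      have V1: "scale (c j) (e j) \<in> V" using insert.prems e by (intro subspace_scale[OF V]) auto
      have V2: "(\<Sum>j\<in>J. scale (c j) (e j)) \<in> V" using insert.prems e by (intro subspace_sum[OF V] subspace_scale[OF V]) auto
      have "f i (scale (c j) (e j)) = c j * f i (e j)" using insert.prems e by (intro scl[OF i]) auto
      thus ?case using insert by (simp add: add[OF i V1 V2])
    qed (simp_all add: f0)
  qed
  show at: "f i (\<Sum>j<n. scale (c j) (e j)) = c i" if "i < n" for i c
  proof -
    have "f i (\<Sum>j<n. scale (c j) (e j)) = (\<Sum>j<n. if i = j then c j else 0)"
      unfolding lin[OF that subset_refl] using that by (intro sum.cong refl) (simp add: dual)
    thus ?thesis using that by simp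
  qed
  show inj: "inj_on e {..<n}"
  proof (rule inj_onI)
    fix i j assume "i \<in> {..<n}" "j \<in> {..<n}" "e i = e j"
    thus "i = j" using dual[of i i] dual[of i j] by (simp split: if_splits)
  qed
  show "\<not> dependent (e ` {..<n})"
  proof
    assume "dependent (e ` {..<n})"
    then obtain u where u: "\<exists>v\<in>e ` {..<n}. u v \<noteq> 0" "(\<Sum>v\<in>e ` {..<n}. scale (u v) v) = 0"
      by (subst (asm) dependent_finite) auto
    have "(\<Sum>i<n. scale (u (e i)) (e i)) = 0" using u(2) by (simp add: sum.reindex[OF inj])
    hence "u (e i) = 0" if "i < n" for i using at[OF that, of "\<lambda>i. u (e i)"] scl[OF that subspace_0[OF V], of 0] by simp
    thus False using u(1) by auto
  qed
qed

text \<open>\<open>n\<close> independent elements in a space spanned by at most \<open>n\<close>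
  elements span it. Linearity of the functionals is asked only on \<open>V\<close>, because the
  trace is controlled only on \<open>F\<close>.\<close>

lemma dual_family_expansion:
  fixes f :: "nat \<Rightarrow> 'b \<Rightarrow> 'a"
  assumes V: "subspace V" and T: "finite T" "card T \<le> n" "V \<subseteq> span T" and e: "\<And>i. i < n \<Longrightarrow> e i \<in> V"
    and add: "\<And>i x y. i < n \<Longrightarrow> x \<in> V \<Longrightarrow> y \<in> V \<Longrightarrow> f i (x + y) = f i x + f i y"
    and scl: "\<And>i c x. i < n \<Longrightarrow> x \<in> V \<Longrightarrow> f i (scale c x) = c * f i x"
    and dual: "\<And>i j. i < n \<Longrightarrow> j < n \<Longrightarrow> f i (e j) = (if i = j then 1 else 0)"
    and x: "x \<in> V"
  shows "x = (\<Sum>i<n. scale (f i x) (e i))"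
proof -
  note d = dual_family_independent[of V n e f, OF V e add scl dual]
  have at: "f i (\<Sum>j<n. scale (c j) (e j)) = c i" if "i < n" for i c using d(1) that by blast
  have inj: "inj_on e {..<n}" using d(2) by blast
  have indep: "\<not> dependent (e ` {..<n})" using d(3) by blast
  have "x \<in> span (e ` {..<n})"
  proof (rule ccontr)
    assume nx: "x \<notin> span (e ` {..<n})"
    have "\<not> dependent (insert x (e ` {..<n}))" by (rule independent_insertI[OF nx indep])
    from independent_span_bound[OF T(1) this] have "card (insert x (e ` {..<n})) \<le> card T" using T(3) x e by auto
    moreover have "x \<notin> e ` {..<n}" using nx span_base[of x "e ` {..<n}"] by auto
    ultimately have "Suc (card (e ` {..<n})) \<le> card T" by simp
    thus False using T(2) card_image[OF inj] by simp
  qed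
  then obtain u where "x = (\<Sum>v\<in>e ` {..<n}. scale (u v) v)" by (subst (asm) span_finite) auto
  hence xu: "x = (\<Sum>i<n. scale (u (e i)) (e i))" by (simp add: sum.reindex[OF inj])
  have "f i x = u (e i)" if "i < n" for i unfolding xu by (rule at[OF that])
  hence "(\<Sum>i<n. scale (f i x) (e i)) = (\<Sum>i<n. scale (u (e i)) (e i))" by (intro sum.cong) auto
  thus ?thesis using xu by simp
qed

end

locale quadratic_space = vector_space s for s :: "'k::field \<Rightarrow> 'v::ab_group_add \<Rightarrow> 'v" +
  fixes q :: "'v \<Rightarrow> 'k"
  assumes q_scale: "q (s c x) = c ^ 2 * q x"
    and polar_add: "polar_form q x (y + z) = polar_form q x y + polar_form q x z"
    and polar_scale: "polar_form q x (s c y) = c * polar_form q x y"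
    and two: "(2::'k) \<noteq> 0"
begin

lemma polar_commute: "polar_form q x y = polar_form q y x"
  by (simp add: polar_form_def add.commute algebra_simps)

lemma q_add: "q (x + y) = q x + q y + polar_form q x y"
  by (simp add: polar_form_def)

lemma polar_self: "polar_form q x x = 2 * q x"
proof -
  have "x + x = s 2 x" using scale_left_distrib[of 1 1 x] by simp
  thus ?thesis using q_scale[of 2 x] by (simp add: polar_form_def)
qed

lemma q_0: "q 0 = 0"
  using q_scale[of 0 0] by simp

lemma polar_0: "polar_form q x 0 = 0"
  using polar_scale[of x 0 0] by simp

lemma polar_uminus: "polar_form q x (- y) = - polar_form q x y"
  using polar_scale[of x "-1" y] by simp

lemma polar_diff: "polar_form q x (y - z) = polar_form q x y - polar_form q x z"
  using polar_add[of x y "- z"] by (simp add: polar_uminus)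

lemma polar_sum: "polar_form q x (sum g I) = (\<Sum>i\<in>I. polar_form q x (g i))"
  by (induction I rule: infinite_finite_induct) (simp_all add: polar_0 polar_add)

lemma q_orthogonal_sum:
  fixes u :: "nat \<Rightarrow> 'v"
  assumes "\<And>i j. i < n \<Longrightarrow> j < n \<Longrightarrow> i \<noteq> j \<Longrightarrow> polar_form q (u i) (u j) = 0"
  shows "q (\<Sum>i<n. s (c i) (u i)) = (\<Sum>i<n. q (u i) * c i ^ 2)"
  using assms
proof (induction n)
  case (Suc n)
  have "polar_form q (s (c n) (u n)) (\<Sum>i<n. s (c i) (u i)) = 0"
    unfolding polar_sum
  proof (intro sum.neutral ballI)
    fix i assume "i \<in> {..<n}"
    hence "polar_form q (u i) (u n) = 0" using Suc.prems by simp
    thus "polar_form q (s (c n) (u n)) (s (c i) (u i)) = 0"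
      by (simp add: polar_scale polar_commute[of "s (c n) (u n)" "u i"])
  qed
  moreover have "q (\<Sum>i<n. s (c i) (u i)) = (\<Sum>i<n. q (u i) * c i ^ 2)" by (rule Suc.IH) (simp add: Suc.prems)
  ultimately show ?case
    by (simp add: q_add q_scale polar_commute[of "\<Sum>i<n. s (c i) (u i)"] mult.commute)
qed (simp add: q_0)

text \<open>Gram-Schmidt: \<open>r x\<close> is the part of \<open>x\<close> orthogonal to the
  family, and any \<open>x\<close> with \<open>q (r x) \<noteq> 0\<close> extends it. If there is
  none, polarization puts the range of \<open>r\<close> in the radical, so \<open>r\<close> vanishes
  and the \<open>m\<close> vectors span, contradicting \<open>m < n\<close>.\<close>

lemma orthogonal_family:
  assumes nd: "nondegenerate q" and n: "dim UNIV = n"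
  shows "m \<le> n \<Longrightarrow> \<exists>u. (\<forall>i<m. q (u i) \<noteq> 0) \<and> (\<forall>i<m. \<forall>j<m. i \<noteq> j \<longrightarrow> polar_form q (u i) (u j) = 0)"
proof (induction m)
  case (Suc m)
  then obtain u where u: "\<And>i. i < m \<Longrightarrow> q (u i) \<noteq> 0"
    "\<And>i j. i < m \<Longrightarrow> j < m \<Longrightarrow> i \<noteq> j \<Longrightarrow> polar_form q (u i) (u j) = 0" by auto
  define c where "c i x = polar_form q (u i) x / (2 * q (u i))" for i x
  define r where "r x = x - (\<Sum>i<m. s (c i x) (u i))" for x
  have ur: "polar_form q (u j) (r x) = 0" if j: "j < m" for j x
  proof -
    have "(\<Sum>i<m. c i x * polar_form q (u j) (u i)) = (\<Sum>i\<in>{j}. c i x * polar_form q (u j) (u i))"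
      by (rule sum.mono_neutral_right) (use j u(2) in auto)
    also have "\<dots> = polar_form q (u j) x" using u(1)[OF j] two by (simp add: c_def polar_self)
    finally show ?thesis by (simp add: r_def polar_diff polar_sum polar_scale)
  qed
  show ?case
  proof (cases "\<exists>x. q (r x) \<noteq> 0")
    case True
    then obtain x where x: "q (r x) \<noteq> 0" ..
    show ?thesis
    proof (intro exI[of _ "u(m := r x)"] conjI allI impI)
      fix i assume "i < Suc m" thus "q ((u(m := r x)) i) \<noteq> 0" using u(1)[of i] x by (cases "i = m") auto
      fix j assume "i < Suc m" "j < Suc m" "i \<noteq> j"
      thus "polar_form q ((u(m := r x)) i) ((u(m := r x)) j) = 0"
        using u(2)[of i j] ur[of i x] ur[of j x] by (auto simp: polar_commute[of "r x"] less_Suc_eq)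
    qed
  next
    case False
    hence qr: "q (r x) = 0" for x by blast
    have cadd: "c i (x + y) = c i x + c i y" for i x y by (simp add: c_def polar_add add_divide_distrib)
    have radd: "r (x + y) = r x + r y" for x y
      by (simp add: r_def cadd scale_left_distrib sum.distrib algebra_simps)
    have rr: "polar_form q (r x) (r y) = 0" for x y
      using qr[of "x + y"] qr[of x] qr[of y] by (simp add: polar_form_def radd)
    have r0: "r x = 0" for x
    proof -
      have "polar_form q (r x) y = 0" for y
      proof -
        have "polar_form q (r x) (r y + (\<Sum>i<m. s (c i y) (u i))) = (\<Sum>i<m. c i y * polar_form q (r x) (u i))"
          by (simp add: polar_add rr polar_sum polar_scale)
        also have "\<dots> = 0" by (intro sum.neutral ballI) (simp add: polar_commute[of "r x"] ur)
        finally show ?thesis by (simp add: r_def)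
      qed
      thus ?thesis using nd unfolding nondegenerate_def by blast
    qed
    have "UNIV \<subseteq> span (u ` {..<m})"
    proof
      fix x
      have "x = (\<Sum>i<m. s (c i x) (u i))" using r0[of x] by (simp add: r_def)
      also have "\<dots> \<in> span (u ` {..<m})" by (intro span_sum span_scale span_base) auto
      finally show "x \<in> span (u ` {..<m})" .
    qed
    hence "dim UNIV \<le> card (u ` {..<m})" by (intro dim_le_card) auto
    also have "\<dots> \<le> m" using card_image_le[of "{..<m}" u] by simp
    finally show ?thesis using n Suc.prems by simp
  qed
qed simp

theorem diagonalization:
  assumes nd: "nondegenerate q" and n: "dim UNIV = n" "n \<ge> 1"
  obtains a c u where "\<And>i. i < n \<Longrightarrow> a i \<noteq> 0" "\<And>x. x = (\<Sum>i<n. s (c i x) (u i))"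
    "\<And>x. q x = (\<Sum>i<n. a i * c i x ^ 2)"
    "\<And>i x y. c i (x + y) = c i x + c i y" "\<And>i r x. c i (s r x) = r * c i x"
    "\<And>i (g :: nat \<Rightarrow> 'k). i < n \<Longrightarrow> c i (\<Sum>i<n. s (g i) (u i)) = g i"
proof -
  obtain u where u: "\<And>i. i < n \<Longrightarrow> q (u i) \<noteq> 0"
    "\<And>i j. i < n \<Longrightarrow> j < n \<Longrightarrow> i \<noteq> j \<Longrightarrow> polar_form q (u i) (u j) = 0" using orthogonal_family[OF nd n(1), of n] by auto
  define c where "c i x = polar_form q (u i) x / (2 * q (u i))" for i x
  have cadd: "c i (x + y) = c i x + c i y" for i x y by (simp add: c_def polar_add add_divide_distrib)
  have cscale: "c i (s r x) = r * c i x" for i r x by (simp add: c_def polar_scale)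
  have dual: "c i (u j) = (if i = j then 1 else 0)" if "i < n" "j < n" for i j
    using u(1)[OF that(1)] u(2)[OF that] two by (auto simp: c_def polar_self)
  obtain T where T: "\<not> dependent T" "UNIV \<subseteq> span T" "card T = n" using basis_exists[of UNIV] n(1) by metis
  have finT: "finite T" using T(3) n(2) by (intro card_ge_0_finite) simp
  have ex: "x = (\<Sum>i<n. s (c i x) (u i))" for x
    by (rule dual_family_expansion[OF subspace_UNIV finT _ T(2)]) (use T(3) cadd cscale dual in auto)
  have qx: "q x = (\<Sum>i<n. q (u i) * c i x ^ 2)" for x
  proof -
    have "q x = q (\<Sum>i<n. s (c i x) (u i))" using ex[of x] by simp
    thus ?thesis using q_orthogonal_sum[of n u "\<lambda>i. c i x"] u(2) by simp
  qed
  have "c i (\<Sum>i<n. s (g i) (u i)) = g i" if "i < n" for i and g :: "nat \<Rightarrow> 'k"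
    by (rule dual_family_independent(1)[of UNIV n u c, OF subspace_UNIV]) (use cadd cscale dual that in auto)
  thus thesis using that[of "\<lambda>i. q (u i)" c u] u(1) ex qx cadd cscale by blast
qed

end

section \<open>The trace form of a pencil\<close>

context simple_extension_roots
begin

interpretation V: vector_space "ext_scale (to_ac :: 'k \<Rightarrow> 'k alg_closure)"
  by (rule ext_scale_vector_space[OF to_ac_hom])

text \<open>Linearity is read off the formula with conjugates rather than the definition through a
  chosen basis.\<close>

lemma field_trace_sum:
  assumes "\<And>i. i \<in> I \<Longrightarrow> x i \<in> F"
  shows "field_trace to_ac F (\<Sum>i\<in>I. to_ac (c i) * x i) = (\<Sum>i\<in>I. c i * field_trace to_ac F (x i))"
proof -
  have tF: "to_ac r \<in> F" for r using KF by (auto simp: K_def)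
  have sF: "(\<Sum>i\<in>I. to_ac (c i) * x i) \<in> F" using assms tF by (intro subfld_sum[OF F] subfld_mult[OF F]) auto
  have "to_ac (field_trace to_ac F (\<Sum>i\<in>I. to_ac (c i) * x i)) = (\<Sum>l<n. \<Sum>i\<in>I. to_ac (c i) * conj l (x i))"
    unfolding field_trace_conj[OF sF]
  proof (intro sum.cong refl)
    fix l assume "l \<in> {..<n}"
    hence l: "l < n" by simp
    interpret c: field_hom "conj l" by (rule conj_hom[OF l])
    show "conj l (\<Sum>i\<in>I. to_ac (c i) * x i) = (\<Sum>i\<in>I. to_ac (c i) * conj l (x i))"
      by (simp add: c.hom_sum c.hom_mult conj_fixed[OF l])
  qed
  also have "\<dots> = (\<Sum>i\<in>I. to_ac (c i) * (\<Sum>l<n. conj l (x i)))"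
    unfolding sum_distrib_left by (rule sum.swap)
  also have "\<dots> = to_ac (\<Sum>i\<in>I. c i * field_trace to_ac F (x i))"
    using assms by (simp add: field_trace_conj to_ac_sum)
  finally show ?thesis by simp
qed

text \<open>At a root \<open>\<beta> l\<close> of the pencil, \<open>S\<close> takes the value
  \<open>\<Prod>i<n. \<beta> l - d i\<close>, so \<open>\<alpha>\<close>, formed as the quotient of
  \<open>S\<close> by the derivative of \<open>Q\<close>, cancels the denominator of
  \<open>e j\<close> and leaves the sum of \<open>lagrange_sum\<close>. That makes the trace a
  multiple of the value of \<open>P j\<close> at \<open>d i\<close>, which is 0 for
  \<open>i \<noteq> j\<close>; for \<open>i = j\<close> the value of the pencil at
  \<open>d i\<close> leaves \<open>w i / v i ^ 2 = a i\<close>.\<close>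

theorem pencil_trace_form:
  assumes q: "q = pencil n d w" and w: "\<And>i. i < n \<Longrightarrow> w i = a i * v i ^ 2"
    and a: "\<And>i. i < n \<Longrightarrow> a i \<noteq> 0" and v: "\<And>i. i < n \<Longrightarrow> v i \<noteq> 0" and d: "inj_on d {..<n}"
  obtains \<alpha> e where "\<alpha> \<in> F" "\<alpha> \<noteq> 0" "\<And>i. i < n \<Longrightarrow> e i \<in> F"
    "\<And>i j. i < n \<Longrightarrow> j < n \<Longrightarrow> field_trace to_ac F (\<alpha> * (e i * e j)) = (if i = j then a i else 0)"
proof -
  interpret t: field_hom "to_ac :: 'k \<Rightarrow> 'k alg_closure" by (rule to_ac_hom)
  define t where "t = (to_ac :: 'k \<Rightarrow> 'k alg_closure)"
  have t0: "t c = 0 \<longleftrightarrow> c = 0" for c by (simp add: t_def)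
  have tmult: "t (x * y) = t x * t y" and tpow: "t (x ^ k) = t x ^ k" for x y k by (simp_all add: t_def)
  have tF: "t r \<in> F" and tK: "t r \<in> K" for r using KF by (auto simp: K_def t_def)
  have tinj: "t x = t y \<longleftrightarrow> x = y" for x y by (simp add: t_def)
  define P where "P i = (\<Prod>j\<in>{..<n}-{i}. [:- t (d j), 1:])" for i
  define S where "S = (\<Sum>i<n. smult (t (w i)) (P i))"
  define Q where "Q = map_poly to_ac q"
  have Qp: "Q = pencil n (\<lambda>i. t (d i)) (\<lambda>i. t (w i))"
    unfolding Q_def q t_def by (rule pencil_hom) (rule t.idom_hom_axioms)
  have Qprod: "Q = (\<Prod>l<n. [:- \<beta> l, 1:])" unfolding Q_def by (rule map_q)
  have QS: "Q = (\<Prod>i<n. [:- t (d i), 1:]) - S" unfolding Qp pencil_def S_def P_def ..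
  have w0: "w i \<noteq> 0" if "i < n" for i using w[OF that] a[OF that] v[OF that] by simp
  have Qd: "poly Q (t (d i)) = - t (w i) * poly (P i) (t (d i))" if "i < n" for i
    unfolding Qp pencil_at[OF that, of "\<lambda>i. t (d i)"] by (simp add: P_def poly_prod)
  have Pd: "poly (P i) (t (d i)) \<noteq> 0" if "i < n" for i
    using d that by (auto simp: P_def poly_prod tinj dest: inj_onD)
  have Pd0: "poly (P j) (t (d i)) = 0" if "i < n" "j < n" "i \<noteq> j" for i j
    unfolding P_def poly_prod by (rule prod_zero) (use that in auto)
  have b: "\<beta> l - t (d i) \<noteq> 0" if "l < n" "i < n" for l i
  proof
    assume "\<beta> l - t (d i) = 0"
    hence "poly Q (t (d i)) = 0" using \<beta>_root[OF that(1)] by (simp add: Q_def)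
    thus False using Qd[OF that(2)] Pd[OF that(2)] w0[OF that(2)] by (simp add: t0)
  qed
  define D where "D l = (\<Prod>m\<in>{..<n}-{l}. \<beta> l - \<beta> m)" for l
  have D0: "D l \<noteq> 0" if "l < n" for l using \<beta>_inj that by (auto simp: D_def dest: inj_onD)
  have QD: "poly (pderiv Q) (\<beta> l) = D l" if l: "l < n" for l
  proof -
    have z: "(\<Prod>m\<in>{..<n}-{k}. \<beta> l - \<beta> m) = 0" if "k \<noteq> l" for k using l that by (intro prod_zero) auto
    have "poly (pderiv Q) (\<beta> l) = (\<Sum>k<n. \<Prod>m\<in>{..<n}-{k}. \<beta> l - \<beta> m)"
      unfolding Qprod pderiv_prod by (simp add: poly_sum poly_prod pderiv_pCons)
    also have "\<dots> = (\<Sum>k\<in>{l}. \<Prod>m\<in>{..<n}-{k}. \<beta> l - \<beta> m)" using l z by (intro sum.mono_neutral_right) auto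
    finally show ?thesis by (simp add: D_def)
  qed
  have SP: "poly S (\<beta> l) = poly (P j) (\<beta> l) * (\<beta> l - t (d j))" if "l < n" "j < n" for l j
  proof -
    have "poly Q (\<beta> l) = 0" using \<beta>_root[OF that(1)] by (simp add: Q_def)
    hence "poly S (\<beta> l) = (\<Prod>i<n. \<beta> l - t (d i))" unfolding QS by (simp add: poly_prod)
    also have "\<dots> = (\<beta> l - t (d j)) * (\<Prod>i\<in>{..<n}-{j}. \<beta> l - t (d i))" using that(2) by (intro prod.remove) auto
    finally show ?thesis by (simp add: P_def poly_prod mult.commute)
  qed
  have QK: "Q \<in> polys K" unfolding Q_def K_def using polys_range_iff by blast
  have SK: "S \<in> polys K" unfolding S_def P_def
    by (intro polys_sum[OF K] polys_smult[OF K] polys_prod[OF K] polys_pCons[OF K] polys_0[OF K] tK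
        subfld_uminus[OF K] subfld_1[OF K])
  define \<alpha> where "\<alpha> = poly S (\<beta> 0) / poly (pderiv Q) (\<beta> 0)"
  define e where "e i = t (w i) / (t (v i) * (\<beta> 0 - t (d i)))" for i
  have \<alpha>F: "\<alpha> \<in> F" unfolding \<alpha>_def using polys_mono[OF KF] QK SK
    by (intro subfld_divide[OF F] poly_in_subfld[OF F] polys_pderiv[OF F] \<beta>F) auto
  have eF: "e i \<in> F" for i unfolding e_def
    by (intro subfld_divide[OF F] subfld_mult[OF F] subfld_diff[OF F] tF \<beta>F)
  have \<alpha>c: "conj l \<alpha> = poly S (\<beta> l) / D l" and ec: "conj l (e i) = t (w i) / (t (v i) * (\<beta> l - t (d i)))" if l: "l < n" for l i
  proof -
    interpret c: field_hom "conj l" by (rule conj_hom[OF l])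
    note hp = homs_over_poly[OF conj(1)[OF l], of _ "\<beta> 0", unfolded conj(2)[OF l]]
    show "conj l \<alpha> = poly S (\<beta> l) / D l"
      unfolding \<alpha>_def c.hom_div hp[OF SK, symmetric] hp[OF polys_pderiv[OF K QK], symmetric] QD[OF l] ..
    show "conj l (e i) = t (w i) / (t (v i) * (\<beta> l - t (d i)))"
      unfolding e_def t_def c.hom_div c.hom_mult c.hom_minus conj_fixed[OF l] conj(2)[OF l] ..
  qed
  have \<alpha>0: "\<alpha> \<noteq> 0"
  proof -
    have "poly S (\<beta> 0) = (\<Prod>i<n. \<beta> 0 - t (d i))"
      using \<beta>_root[OF n_pos] unfolding Q_def[symmetric] QS by (simp add: poly_prod)
    moreover have "\<dots> \<noteq> 0" using b[OF n_pos] by auto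
    ultimately show ?thesis using QD[OF n_pos] D0[OF n_pos] by (simp add: \<alpha>_def)
  qed
  have tr: "field_trace to_ac F (\<alpha> * (e i * e j)) = (if i = j then a i else 0)" if i: "i < n" and j: "j < n" for i j
  proof -
    define k where "k = t (w i) / t (v i) * (t (w j) / t (v j))"
    have "to_ac (field_trace to_ac F (\<alpha> * (e i * e j))) = (\<Sum>l<n. conj l (\<alpha> * (e i * e j)))"
      by (rule field_trace_conj) (intro subfld_mult[OF F] \<alpha>F eF)
    also have "\<dots> = (\<Sum>l<n. k * (poly (P j) (\<beta> l) / (D l * (\<beta> l - t (d i)))))"
    proof (intro sum.cong refl)
      fix l assume "l \<in> {..<n}"
      hence l: "l < n" by simp
      interpret c: field_hom "conj l" by (rule conj_hom[OF l])
      have "conj l (\<alpha> * (e i * e j)) = poly (P j) (\<beta> l) * (\<beta> l - t (d j)) / D l *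
          (t (w i) / (t (v i) * (\<beta> l - t (d i))) * (t (w j) / (t (v j) * (\<beta> l - t (d j)))))"
        unfolding c.hom_mult \<alpha>c[OF l] ec[OF l] SP[OF l j] ..
      also have "\<dots> = k * (poly (P j) (\<beta> l) / (D l * (\<beta> l - t (d i))))"
        using b[OF l j] unfolding k_def by (simp add: mult_ac)
      finally show "conj l (\<alpha> * (e i * e j)) = k * (poly (P j) (\<beta> l) / (D l * (\<beta> l - t (d i))))" .
    qed
    also have "\<dots> = k * (\<Sum>l<n. poly (P j) (\<beta> l) / (D l * (\<beta> l - t (d i))))" by (rule sum_distrib_left[symmetric])
    also have "(\<Sum>l<n. poly (P j) (\<beta> l) / (D l * (\<beta> l - t (d i)))) = - poly (P j) (t (d i)) / (\<Prod>l<n. t (d i) - \<beta> l)"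
      unfolding D_def
    proof (rule lagrange_sum[OF \<beta>_inj])
      have "degree (P j) = n - 1" unfolding P_def using j by (subst degree_prod_eq_sum_degree) auto
      thus "degree (P j) < n" using j by simp
      show "\<beta> l \<noteq> t (d i)" if "l < n" for l using b[OF that i] by simp
    qed
    also have "(\<Prod>l<n. t (d i) - \<beta> l) = poly Q (t (d i))" unfolding Qprod by (simp add: poly_prod)
    also have "\<dots> = - t (w i) * poly (P i) (t (d i))" by (rule Qd[OF i])
    also have "k * (- poly (P j) (t (d i)) / (- t (w i) * poly (P i) (t (d i)))) = to_ac (if i = j then a i else 0)"
    proof (cases "i = j")
      case True
      have "t (w i) = t (a i) * (t (v i) * t (v i))" using w[OF i] by (simp add: tmult tpow power2_eq_square)
      moreover have "t (v i) \<noteq> 0" "t (a i) \<noteq> 0" using v[OF i] a[OF i] by (simp_all add: t0)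
      moreover have "poly (P i) (t (d i)) \<noteq> 0" by (rule Pd[OF i])
      ultimately have "k * (- poly (P j) (t (d i)) / (- t (w i) * poly (P i) (t (d i)))) = t (a i)"
        unfolding k_def True[symmetric] by simp
      thus ?thesis using True by (simp add: t_def)
    next
      case False
      thus ?thesis using Pd0[OF i j] by simp
    qed
    finally show ?thesis by simp
  qed
  show thesis by (rule that[OF \<alpha>F \<alpha>0 eF tr])
qed

text \<open>The \<open>e i\<close> form an orthogonal basis of \<open>F\<close> whose coordinate
  functionals are the traces against \<open>\<alpha> * e i\<close>, divided by \<open>a i\<close>;
  matching coordinates in both spaces gives the isometry.\<close>

theorem diagonal_form_isomorphic:
  assumes sp: "vector_space s" and \<alpha>F: "\<alpha> \<in> F" and eF: "\<And>i. i < n \<Longrightarrow> e i \<in> F"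
    and tr: "\<And>i j. i < n \<Longrightarrow> j < n \<Longrightarrow> field_trace to_ac F (\<alpha> * (e i * e j)) = (if i = j then a i else 0)"
    and a: "\<And>i. i < n \<Longrightarrow> a i \<noteq> 0"
    and ex: "\<And>x :: 'v::ab_group_add. x = (\<Sum>i<n. s (c i x) (u i))" and qx: "\<And>x. g x = (\<Sum>i<n. a i * c i x ^ 2)"
    and cadd: "\<And>i x y. c i (x + y) = c i x + c i y" and cscale: "\<And>i r x. c i (s r x) = r * c i x"
    and cu: "\<And>i (h :: nat \<Rightarrow> 'k). i < n \<Longrightarrow> c i (\<Sum>i<n. s (h i) (u i)) = h i"
  shows "isomorphic_forms s g (ext_scale to_ac) F (scaled_trace_form to_ac F \<alpha>)"
proof -
  define T where "T = field_trace to_ac F"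
  have tF: "to_ac r \<in> F" for r using KF by (auto simp: K_def)
  define f where "f i x = T (\<alpha> * (e i * x)) / a i" for i x
  have T1: "T (to_ac r * x) = r * T x" if "x \<in> F" for r x
    using field_trace_sum[of "{0::nat}" "\<lambda>_. x" "\<lambda>_. r"] that by (simp add: T_def)
  have T2: "T (x + y) = T x + T y" if "x \<in> F" "y \<in> F" for x y
    using field_trace_sum[of "{True, False}" "\<lambda>z. if z then x else y" "\<lambda>_. 1"] that by (simp add: T_def)
  have aeF: "\<alpha> * (e i * x) \<in> F" if "i < n" "x \<in> F" for i x using that \<alpha>F eF by (intro subfld_mult[OF F]) auto
  have fadd: "f i (x + y) = f i x + f i y" if "i < n" "x \<in> F" "y \<in> F" for i x y
    using T2[OF aeF[OF that(1,2)] aeF[OF that(1,3)]] by (simp add: f_def distrib_left add_divide_distrib)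
  have fscale: "f i (ext_scale to_ac r x) = r * f i x" if "i < n" "x \<in> F" for i r x
    using T1[OF aeF[OF that], of r] by (simp add: f_def ext_scale_def mult.left_commute)
  have dual: "f i (e j) = (if i = j then 1 else 0)" if "i < n" "j < n" for i j
    using tr[OF that] a[OF that(1)] by (cases "i = j") (simp_all add: f_def T_def)
  have exF: "x = (\<Sum>i<n. ext_scale to_ac (f i x) (e i))" if "x \<in> F" for x
    by (rule V.dual_family_expansion[OF F_subspace, of "(\<lambda>k. \<beta> 0 ^ k) ` {..<n}"])
      (use card_image_le[of "{..<n}" "\<lambda>k. \<beta> 0 ^ k"] F_span eF fadd fscale dual that in auto)
  have fe: "f i (\<Sum>j<n. ext_scale to_ac (h j) (e j)) = h i" if "i < n" for i h
    by (rule V.dual_family_independent(1)[of F n e f, OF F_subspace eF fadd fscale dual that])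
  define \<phi> where "\<phi> x = (\<Sum>i<n. ext_scale to_ac (c i x) (e i))" for x
  interpret W: vector_space s by fact
  show ?thesis unfolding isomorphic_forms_def
  proof (intro exI[of _ \<phi>] conjI allI)
    show "Vector_Spaces.linear s (ext_scale to_ac) \<phi>"
    proof
      show "\<phi> (x + y) = \<phi> x + \<phi> y" for x y
        by (simp add: \<phi>_def cadd ext_scale_def distrib_right sum.distrib)
      show "\<phi> (s r x) = ext_scale to_ac r (\<phi> x)" for r x
        by (simp add: \<phi>_def cscale ext_scale_def sum_distrib_left mult.assoc)
    qed
    show "bij_betw \<phi> UNIV F" unfolding bij_betw_def
    proof (intro conjI equalityI subsetI)
      show "inj \<phi>"
      proof (rule injI)
        fix x y assume xy: "\<phi> x = \<phi> y"
        have "c i x = c i y" if "i < n" for i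
          using fe[OF that, of "\<lambda>i. c i x"] fe[OF that, of "\<lambda>i. c i y"] xy by (simp add: \<phi>_def)
        hence "(\<Sum>i<n. s (c i x) (u i)) = (\<Sum>i<n. s (c i y) (u i))" by (intro sum.cong) auto
        thus "x = y" using ex[of x] ex[of y] by simp
      qed
      show "z \<in> F" if "z \<in> range \<phi>" for z
        using that eF tF by (auto simp: \<phi>_def ext_scale_def intro!: subfld_sum[OF F] subfld_mult[OF F])
      show "z \<in> range \<phi>" if "z \<in> F" for z
      proof
        show "z = \<phi> (\<Sum>i<n. s (f i z) (u i))" unfolding \<phi>_def
          by (rule trans[OF exF[OF that]]) (intro sum.cong refl, simp add: cu)
      qed simp
    qed
    fix x
    have "\<alpha> * \<phi> x ^ 2 = (\<Sum>i<n. to_ac (c i x) * (\<Sum>j<n. to_ac (c j x) * (\<alpha> * (e i * e j))))"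
      by (simp add: \<phi>_def ext_scale_def power2_eq_square sum_product sum_distrib_left mult_ac)
    hence "scaled_trace_form to_ac F \<alpha> (\<phi> x) = T (\<Sum>i<n. to_ac (c i x) * (\<Sum>j<n. to_ac (c j x) * (\<alpha> * (e i * e j))))"
      by (simp add: scaled_trace_form_def T_def)
    also have "\<dots> = (\<Sum>i<n. c i x * T (\<Sum>j<n. to_ac (c j x) * (\<alpha> * (e i * e j))))"
      unfolding T_def by (rule field_trace_sum) (use eF \<alpha>F tF in \<open>auto intro!: subfld_sum[OF F] subfld_mult[OF F]\<close>)
    also have "\<dots> = (\<Sum>i<n. c i x * (\<Sum>j<n. c j x * T (\<alpha> * (e i * e j))))"
      unfolding T_def by (intro sum.cong refl arg_cong[of _ _ "\<lambda>y. _ * y"] field_trace_sum) (use eF aeF in auto)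
    also have "\<dots> = (\<Sum>i<n. c i x * (\<Sum>j<n. if i = j then c j x * a i else 0))"
      by (intro sum.cong refl arg_cong[of _ _ "\<lambda>y. _ * y"]) (simp add: T_def tr)
    also have "\<dots> = g x" unfolding qx by (intro sum.cong refl) (simp add: power2_eq_square mult_ac)
    finally show "scaled_trace_form to_ac F \<alpha> (\<phi> x) = g x" .
  qed
qed

end

section \<open>Generators of separable extensions\<close>

text \<open>The primitive element theorem is stated in algebraically closed types, whereas
  \<open>L\<close> sits in an arbitrary field. Adjoining the members of \<open>S\<close> one at a
  time moves a finitely generated part of \<open>L\<close> into the algebraic closure of
  \<open>'m\<close>.\<close>

lemma embed_finitely_generated:
  assumes j: "field_hom (j :: 'm::field \<Rightarrow> 'l::field)" and L: "subfld L" "range j \<subseteq> L"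
    and alg: "\<And>x. x \<in> L \<Longrightarrow> alg_over (range j) x" and S: "finite S" "S \<subseteq> L"
  obtains A \<psi> where "subfld A" "range j \<subseteq> A" "A \<subseteq> L" "S \<subseteq> A" "hom_on A \<psi>"
    "\<And>c. \<psi> (j c) = (to_ac c :: 'm alg_closure)"
proof -
  interpret j: field_hom j by fact
  have "\<exists>A \<psi>. subfld A \<and> range j \<subseteq> A \<and> A \<subseteq> L \<and> S \<subseteq> A \<and> hom_on A \<psi> \<and> (\<forall>c. \<psi> (j c) = (to_ac c :: 'm alg_closure))"
    using S
  proof (induction S)
    case empty
    define \<psi> where "\<psi> x = (to_ac (inv_into UNIV j x) :: 'm alg_closure)" for x
    have \<psi>: "\<psi> (j c) = to_ac c" for c unfolding \<psi>_def using j.injectivity by (simp add: inv_into_f_f inj_def)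
    have "\<psi> 1 = 1" using \<psi>[of 1] by simp
    moreover have "\<psi> (j a - j b) = \<psi> (j a) - \<psi> (j b)" "\<psi> (j a * j b) = \<psi> (j a) * \<psi> (j b)" for a b
      using \<psi>[of "a - b"] \<psi>[of "a * b"] by (simp_all add: \<psi> j.hom_minus j.hom_mult)
    ultimately have "hom_on (range j) \<psi>" unfolding hom_on_def by auto
    thus ?case using \<psi> L(2) by (intro exI[of _ "range j"] exI[of _ \<psi>]) (auto simp: subfld_range[OF j])
  next
    case (insert x S)
    then obtain A \<psi> where A: "subfld A" "range j \<subseteq> A" "A \<subseteq> L" "S \<subseteq> A" "hom_on A \<psi>"
      "\<And>c. \<psi> (j c) = (to_ac c :: 'm alg_closure)" by auto
    have x: "x \<in> L" using insert.prems by simp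
    have ax: "alg_over A x" by (rule alg_over_mono[OF A(2) alg[OF x]])
    obtain \<chi> where \<chi>: "hom_on (adj A x) \<chi>" "\<And>a. a \<in> A \<Longrightarrow> \<chi> a = \<psi> a"
      by (rule hom_extend_root[OF A(1,5) ax]) (rule that)
    have sub: "A \<subseteq> adj A x" "x \<in> adj A x" by (rule adj_base[OF A(1)], rule adj_gen[OF A(1)])
    have "\<chi> (j c) = to_ac c" for c using \<chi>(2)[of "j c"] A(2,6) by auto
    moreover have "adj A x \<subseteq> L" by (rule adj_least[OF L(1) A(3) x])
    ultimately show ?case using subfld_adj[OF A(1) ax] sub A(2,4) \<chi>(1)
      by (intro exI[of _ "adj A x"] exI[of _ \<chi>]) auto
  qed
  thus thesis using that by auto
qed

text \<open>A primitive element \<open>c\<close> of the copy of \<open>L\<close> in the closure is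
  pulled back to \<open>c0\<close> in \<open>L\<close>. Its minimal polynomial divides a separable
  one, and the powers of \<open>c0\<close> below its degree form a basis of \<open>L\<close>, so
  this degree is \<open>n\<close>.\<close>

theorem separable_extension_generator:
  fixes j :: "'m::field \<Rightarrow> 'l::field"
  assumes sep: "separable_extension j L" and deg: "extension_degree j L = n" "n \<ge> 1"
    and inf: "infinite (UNIV :: 'm set)"
  obtains p :: "'m poly" where "irreducible p" "separable_poly p" "degree p = n"
proof -
  have jh: "field_hom j" and L: "subfld L" "range j \<subseteq> L"
    using sep by (auto simp: separable_extension_def field_extension_def subfield_iff_subfld)
  have sepx: "\<exists>p :: 'm poly. irreducible p \<and> separable_poly p \<and> poly (map_poly j p) x = 0" if "x \<in> L" for x
    using sep that by (simp add: separable_extension_def)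
  interpret j: field_hom j by fact
  interpret mj: map_poly_inj_idom_hom j ..
  interpret t: field_hom "to_ac :: 'm \<Rightarrow> 'm alg_closure" by (rule to_ac_hom)
  interpret mt: map_poly_inj_idom_hom "to_ac :: 'm \<Rightarrow> 'm alg_closure" ..
  interpret V: vector_space "ext_scale j" by (rule ext_scale_vector_space[OF jh])
  have Jp: "map_poly j p \<in> polys (range j)" for p using polys_range[OF jh] by blast
  have alg: "alg_over (range j) x" if x: "x \<in> L" for x
  proof -
    obtain p where p: "irreducible p" "poly (map_poly j p) x = 0" using sepx[OF x] by blast
    hence "map_poly j p \<noteq> 0" by auto
    thus ?thesis using p(2) Jp[of p] unfolding alg_over_def by blast
  qed
  have subspace: "V.subspace A" if A: "subfld A" "range j \<subseteq> A" for A
  proof (rule V.subspaceI)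
    show "ext_scale j c x \<in> A" if "x \<in> A" for c x
      unfolding ext_scale_def using A(2) that by (intro subfld_mult[OF A(1)]) auto
  qed (use subfld_0[OF A(1)] subfld_add[OF A(1)] in auto)
  obtain S where S: "S \<subseteq> L" "L \<subseteq> V.span S" "card S = n"
    using V.basis_exists[of L] deg(1) unfolding extension_degree_def by metis
  \<comment> \<open>Positivity of \<open>n\<close> matters here: an infinite set has
    \<open>card\<close> 0.\<close>
  have finS: "finite S" using S(3) deg(2) by (intro card_ge_0_finite) simp
  obtain A \<psi> where A: "subfld A" "range j \<subseteq> A" "A \<subseteq> L" "S \<subseteq> A" "hom_on A \<psi>"
    "\<And>c. \<psi> (j c) = (to_ac c :: 'm alg_closure)"
    by (rule embed_finitely_generated[OF jh L alg finS S(1)]) (assumption | rule that)+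
  \<comment> \<open>\<open>S\<close> spans \<open>L\<close> over the base field, so a subfield
    between the base field and \<open>L\<close> containing \<open>S\<close> is all of
    \<open>L\<close>.\<close>
  have "L \<subseteq> A" using S(2) V.span_minimal[OF A(4) subspace[OF A(1,2)]] by blast
  hence LA: "A = L" using A(3) by blast
  note \<psi> = A(5)[unfolded LA] and \<psi>j = A(6)
  have \<psi>p: "\<psi> (poly (map_poly j p) x) = poly (map_poly to_ac p) (\<psi> x)" if "x \<in> L" for p x
  proof -
    have "map_poly \<psi> (map_poly j p) = map_poly to_ac p"
      by (rule poly_eqI) (simp add: coeff_map_poly hom_on_0[OF L(1) \<psi>] \<psi>j)
    moreover have "map_poly j p \<in> polys L" using Jp polys_mono[OF L(2)] by blast
    ultimately show ?thesis using hom_on_poly[OF L(1) \<psi> _ that] by metis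
  qed
  have \<psi>inj: "x = y" if "x \<in> L" "y \<in> L" "\<psi> x = \<psi> y" for x y
    using hom_on_eq_0[OF L(1) \<psi> subfld_diff[OF L(1) that(1,2)]] hom_on_diff[OF L(1) \<psi> that(1,2)] that(3) by simp
  define M where "M = range (to_ac :: 'm \<Rightarrow> 'm alg_closure)"
  have M: "subfld M" unfolding M_def by (rule subfld_range[OF to_ac_hom])
  have infM: "infinite M" unfolding M_def using inf finite_imageD[of to_ac UNIV] t.injectivity by (auto simp: inj_def)
  have algM: "alg_over M x" for x unfolding M_def by (rule alg_closure_alg_over)
  have sepM: "sep_over M (\<psi> x)" if x: "x \<in> L" for x
  proof -
    obtain p where p: "separable_poly p" "poly (map_poly j p) x = 0" using sepx[OF x] by blast
    have "poly (map_poly to_ac p) (\<psi> x) = 0" using \<psi>p[OF x, of p] p(2) hom_on_0[OF L(1) \<psi>] by simp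
    moreover have "map_poly to_ac p \<in> polys M" unfolding M_def using polys_range_iff by blast
    ultimately show ?thesis using p(1) unfolding sep_over_def separable_poly_def by blast
  qed
  obtain c where c: "c \<in> gen_fld M (\<psi> ` S)" "\<psi> ` S \<subseteq> adj M c"
  proof (rule primitive_element[OF _ M infM algM])
    show "finite (\<psi> ` S)" using finS by simp
    show "sep_over M a" if "a \<in> \<psi> ` S" for a using that sepM S(1) by auto
  qed blast
  have "subfld (\<psi> ` L)"
  proof (rule subfldI)
    show "1 \<in> \<psi> ` L" using hom_on_1[OF L(1) \<psi>] subfld_1[OF L(1)] by (metis imageI)
    show "x - y \<in> \<psi> ` L" if "x \<in> \<psi> ` L" "y \<in> \<psi> ` L" for x y
      using that by (auto simp flip: hom_on_diff[OF L(1) \<psi>] intro!: imageI subfld_diff[OF L(1)])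
    show "x * y \<in> \<psi> ` L" if "x \<in> \<psi> ` L" "y \<in> \<psi> ` L" for x y
      using that by (auto simp flip: hom_on_mult[OF L(1) \<psi>] intro!: imageI subfld_mult[OF L(1)])
    show "inverse x \<in> \<psi> ` L" if "x \<in> \<psi> ` L" for x
      using that by (auto simp flip: hom_on_inverse[OF L(1) \<psi>] intro!: imageI subfld_inverse[OF L(1)])
  qed
  moreover have "M \<subseteq> \<psi> ` L"
  proof
    fix x assume "x \<in> M"
    then obtain y where "x = \<psi> (j y)" by (auto simp: M_def \<psi>j)
    thus "x \<in> \<psi> ` L" using L(2) by auto
  qed
  ultimately have "gen_fld M (\<psi> ` S) \<subseteq> \<psi> ` L" using S(1) by (intro gen_fld_least) auto
  then obtain c0 where c0: "c0 \<in> L" "c = \<psi> c0" using c(1) by blast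
  obtain p where p: "irreducible p" "lead_coeff p = 1" "poly (map_poly j p) c0 = 0"
    "\<And>g. poly (map_poly j g) c0 = 0 \<Longrightarrow> p dvd g"
    using minimal_polynomial_type[OF jh alg[OF c0(1)]] by blast
  have p0: "p \<noteq> 0" using p(1) by auto
  have psep: "separable_poly p"
  proof -
    obtain g where g: "separable_poly g" "poly (map_poly j g) c0 = 0" using sepx[OF c0(1)] by blast
    have "map_poly to_ac p dvd map_poly to_ac g" by (rule mt.hom_dvd[OF p(4)[OF g(2)]])
    thus ?thesis using g(1) rsquarefree_dvd unfolding separable_poly_def by blast
  qed
  define J where "J = adj (range j) c0"
  have J: "subfld J" unfolding J_def by (rule subfld_adj[OF subfld_range[OF jh] alg[OF c0(1)]])
  have jJ: "range j \<subseteq> J" unfolding J_def by (rule adj_base[OF subfld_range[OF jh]])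
  have "S \<subseteq> J"
  proof
    fix s assume s: "s \<in> S"
    hence "\<psi> s \<in> adj M c" using c(2) by blast
    then obtain g where "g \<in> polys M" "\<psi> s = poly g c" by (auto simp: adj_def)
    then obtain g' where "\<psi> s = poly (map_poly to_ac g') c" unfolding M_def polys_range_iff by blast
    hence "\<psi> s = \<psi> (poly (map_poly j g') c0)" using \<psi>p[OF c0(1)] c0(2) by simp
    moreover have "poly (map_poly j g') c0 \<in> L" using Jp polys_mono[OF L(2)] by (intro poly_in_subfld[OF L(1) _ c0(1)]) blast
    ultimately have "s = poly (map_poly j g') c0" using \<psi>inj s S(1) by blast
    thus "s \<in> J" unfolding J_def adj_def using Jp by blast
  qed
  hence LJ: "L \<subseteq> J" using S(2) V.span_minimal[OF _ subspace[OF J jJ], of S] by blast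
  have small: "h = 0" if h: "degree h < degree p" "poly (map_poly j h) c0 = 0" for h
  proof (rule ccontr)
    assume "h \<noteq> 0"
    with dvd_imp_degree_le[OF p(4)[OF h(2)]] h(1) show False by simp
  qed
  have sum_poly: "poly (map_poly j (\<Sum>k<m. monom (u k) k)) c0 = (\<Sum>k<m. ext_scale j (u k) (c0 ^ k))" for m u
    by (simp add: mj.hom_sum poly_sum poly_monom ext_scale_def)
  have dsum: "(\<Sum>k<degree p. monom (u k) k) = 0" if "(\<Sum>k<degree p. ext_scale j (u k) (c0 ^ k)) = 0" for u
  proof (rule small)
    have "degree p > 0"
    proof (rule ccontr)
      assume "\<not> degree p > 0"
      then obtain a where "p = [:a:]" by (metis degree_0_id neq0_conv)
      thus False using p(3) p0 by simp
    qed
    moreover have "degree (\<Sum>k<degree p. monom (u k) k) \<le> degree p - 1"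
      by (rule degree_sum_le) (auto intro: order.trans[OF degree_monom_le])
    ultimately show "degree (\<Sum>k<degree p. monom (u k) k) < degree p" by simp
  qed (use that sum_poly in simp)
  have zero: "u k = 0" if "(\<Sum>k<degree p. ext_scale j (u k) (c0 ^ k)) = 0" "k < degree p" for u k
  proof -
    have "coeff (\<Sum>k<degree p. monom (u k) k) k = u k" using that(2) by (simp add: coeff_sum)
    thus ?thesis using dsum[OF that(1)] by simp
  qed
  have inj: "inj_on (\<lambda>k. c0 ^ k) {..<degree p}"
  proof (rule inj_onI, rule ccontr)
    fix a b assume ab: "a \<in> {..<degree p}" "b \<in> {..<degree p}" "c0 ^ a = c0 ^ b" "a \<noteq> b"
    define u where "u k = (if k = a then 1 else if k = b then - 1 else (0::'m))" for k
    have "(\<Sum>k<degree p. ext_scale j (u k) (c0 ^ k)) = (\<Sum>k\<in>{a,b}. ext_scale j (u k) (c0 ^ k))"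
      by (rule sum.mono_neutral_right) (use ab in \<open>auto simp: u_def ext_scale_def\<close>)
    also have "\<dots> = 0" using ab by (simp add: u_def ext_scale_def j.hom_uminus)
    finally have "u a = 0" by (rule zero) (use ab in simp)
    thus False by (simp add: u_def)
  qed
  define B where "B = (\<lambda>k. c0 ^ k) ` {..<degree p}"
  have "V.dim L = degree p"
  proof (rule V.dim_unique)
    show "B \<subseteq> L" unfolding B_def using subfld_power[OF L(1) c0(1)] by auto
    show "card B = degree p" unfolding B_def by (simp add: card_image[OF inj])
    show "\<not> V.dependent B"
    proof
      assume "V.dependent B"
      then obtain u where u: "\<exists>v\<in>B. u v \<noteq> 0" "(\<Sum>v\<in>B. ext_scale j (u v) v) = 0"
        by (subst (asm) V.dependent_finite) (auto simp: B_def)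
      have "(\<Sum>k<degree p. ext_scale j (u (c0 ^ k)) (c0 ^ k)) = 0" using u(2) by (simp add: B_def sum.reindex[OF inj])
      hence "u (c0 ^ k) = 0" if "k < degree p" for k using zero[of "\<lambda>k. u (c0 ^ k)"] that by blast
      thus False using u(1) by (auto simp: B_def)
    qed
    show "L \<subseteq> V.span B"
    proof
      fix x assume "x \<in> L"
      hence "x \<in> adj (range j) c0" using LJ unfolding J_def by blast
      then obtain g where "g \<in> polys (range j)" "x = poly g c0" by (auto simp: adj_def)
      then obtain g' where g: "x = poly (map_poly j g') c0" unfolding polys_range[OF jh] by blast
      define h where "h = g' mod p"
      have "g' = p * (g' div p) + h" by (simp add: h_def)
      hence "map_poly j g' = map_poly j p * map_poly j (g' div p) + map_poly j h" by (metis mj.hom_add mj.hom_mult)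
      hence x: "x = poly (map_poly j h) c0" using g p(3) by simp
      have hd: "h = 0 \<or> degree h < degree p" using degree_mod_less[OF p0] by (simp add: h_def)
      have "x = (\<Sum>k\<le>degree h. ext_scale j (coeff h k) (c0 ^ k))"
        unfolding x poly_altdef by (simp add: ext_scale_def coeff_map_poly)
      also have "\<dots> \<in> V.span B"
      proof (rule V.span_sum)
        fix k assume "k \<in> {..degree h}"
        hence k: "k \<le> degree h" by simp
        show "ext_scale j (coeff h k) (c0 ^ k) \<in> V.span B"
        proof (cases "h = 0")
          case True thus ?thesis by (simp add: V.span_zero ext_scale_def)
        next
          case False
          hence "c0 ^ k \<in> B" using hd k by (auto simp: B_def)
          thus ?thesis by (intro V.span_scale V.span_base)
        qed
      qed
      finally show "x \<in> V.span B" .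
    qed
  qed
  hence "degree p = n" using deg(1) by (simp add: extension_degree_def)
  with p(1) psep show thesis by (rule that)
qed

section \<open>Scaled trace forms\<close>

lemma two_neq_0_if_CHAR: "CHAR('k::field) \<noteq> 2 \<Longrightarrow> (2::'k) \<noteq> 0"
proof
  assume c: "CHAR('k) \<noteq> 2" and "(2::'k) = 0"
  hence "of_nat 2 = (0::'k)" by simp
  hence "CHAR('k) dvd 2" by (simp only: of_nat_eq_0_iff_char_dvd)
  moreover from this have "CHAR('k) \<noteq> 0" by (metis dvd_0_left_iff zero_neq_numeral)
  ultimately have "CHAR('k) \<le> 2" "CHAR('k) \<noteq> 0" by (auto dest: dvd_imp_le)
  moreover have "CHAR('k) \<noteq> 1" using CHAR_not_1 by simp
  ultimately show False using c by simp
qed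

theorem theorem4:
  fixes i :: "'k::field \<Rightarrow> 'm::field"
    and j :: "'m \<Rightarrow> 'l::field" and L :: "'l set"
    and s :: "'k \<Rightarrow> 'v::ab_group_add \<Rightarrow> 'v" and q :: "'v \<Rightarrow> 'k"
    and n :: nat
  assumes "CHAR('k) \<noteq> 2" and "n \<ge> 1"
    and "PAC_extension i"
    and "separable_extension j L" and "extension_degree j L = n"
    and "quadratic_form s q" and "vector_space.dim s (UNIV :: 'v set) = n"
    and "nondegenerate q"
  shows "\<exists>F \<alpha>. finite_extension (to_ac :: 'k \<Rightarrow> 'k alg_closure) F \<and>
           separable_extension (to_ac :: 'k \<Rightarrow> 'k alg_closure) F \<and>
           \<alpha> \<in> F \<and> \<alpha> \<noteq> 0 \<and>
           isomorphic_forms s q (ext_scale to_ac) F (scaled_trace_form to_ac F \<alpha>)"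
proof -
  have two: "(2::'k) \<noteq> 0" by (rule two_neq_0_if_CHAR[OF assms(1)])
  interpret i: field_hom i using assms(3) by (simp add: PAC_extension_def)
  have "inj i" by (rule injI) (rule i.injectivity)
  \<comment> \<open>The generator of the given extension is found by the primitive element theorem,
    which needs an infinite field; \<open>'m\<close> contains a copy of \<open>'k\<close>.\<close>
  hence "infinite (range i)" using PAC_extension_infinite[OF assms(3)] finite_imageD[of i UNIV] by blast
  hence inf: "infinite (UNIV :: 'm set)" using finite_subset subset_UNIV by blast
  obtain p :: "'m poly" where p: "irreducible p" "separable_poly p" "degree p = n"
    by (rule separable_extension_generator[OF assms(4,5,2) inf])
  have vs: "vector_space s" using assms(6) by (simp add: quadratic_form_def)
  interpret W: vector_space s by (rule vs)
  interpret Q: quadratic_space s q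
  proof
    show "q (s c x) = c ^ 2 * q x" for c x using assms(6) by (simp add: quadratic_form_def)
    have lin: "Vector_Spaces.linear s (*) (polar_form q x)" for x using assms(6) by (simp add: quadratic_form_def)
    show "polar_form q x (y + z) = polar_form q x y + polar_form q x z" for x y z
      by (rule module_hom.add[OF Vector_Spaces.linear.axioms(3)[OF lin]])
    show "polar_form q x (s c y) = c * polar_form q x y" for x c y
      by (rule module_hom.scale[OF Vector_Spaces.linear.axioms(3)[OF lin]])
  qed (rule two)
  obtain a c u where a: "\<And>i. i < n \<Longrightarrow> a i \<noteq> 0" and ex: "\<And>x. x = (\<Sum>i<n. s (c i x) (u i))"
    and qx: "\<And>x. q x = (\<Sum>i<n. a i * c i x ^ 2)"
    and cadd: "\<And>i x y. c i (x + y) = c i x + c i y" and cscale: "\<And>i r x. c i (s r x) = r * c i x"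
    and cu: "\<And>i (g :: nat \<Rightarrow> 'k). i < n \<Longrightarrow> c i (\<Sum>i<n. s (g i) (u i)) = g i"
    by (rule Q.diagonalization[OF assms(8,7,2)]) (rule that)
  obtain d v where d: "inj_on d {..<n}" and v: "\<And>l. l < n \<Longrightarrow> v l \<noteq> 0"
    and irr: "irreducible (pencil n d (\<lambda>l. a l * v l ^ 2))" and sep: "separable_poly (pencil n d (\<lambda>l. a l * v l ^ 2))"
    by (rule PAC_pencil[OF assms(3) two p assms(2) a]) (assumption | rule that)+
  define r where "r = pencil n d (\<lambda>l. a l * v l ^ 2)"
  have rdeg: "degree r = n" "lead_coeff r = 1" unfolding r_def using degree_pencil[OF assms(2)] by auto
  define R where "R = {x. poly (map_poly to_ac r) x = 0}"
  have "rsquarefree (map_poly to_ac r)" using sep by (simp add: r_def separable_poly_def)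
  from rsquarefree_split(2)[OF this] have "card R = degree (map_poly to_ac r)" by (simp add: R_def)
  also have "\<dots> = degree r" by (rule degree_map_poly) simp
  finally have cR: "card R = n" unfolding rdeg .
  hence "finite R" using assms(2) by (intro card_ge_0_finite) simp
  from ex_bij_betw_nat_finite[OF this] obtain \<beta> where \<beta>: "bij_betw \<beta> {..<n} R" unfolding cR lessThan_atLeast0 ..
  interpret E: simple_extension_roots r n \<beta>
    by unfold_locales (use irr rdeg \<beta> in \<open>simp_all add: r_def R_def\<close>)
  obtain \<alpha> e where \<alpha>: "\<alpha> \<in> E.F" "\<alpha> \<noteq> 0" and e: "\<And>i. i < n \<Longrightarrow> e i \<in> E.F"
    and tr: "\<And>i j. i < n \<Longrightarrow> j < n \<Longrightarrow> field_trace to_ac E.F (\<alpha> * (e i * e j)) = (if i = j then a i else 0)"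
    by (rule E.pencil_trace_form[OF r_def refl a v d]) (assumption | rule that)+
  have "isomorphic_forms s q (ext_scale to_ac) E.F (scaled_trace_form to_ac E.F \<alpha>)"
    by (rule E.diagonal_form_isomorphic[OF vs \<alpha>(1) e tr a ex qx cadd cscale cu])
  thus ?thesis using E.F_finite E.F_separable \<alpha> by blast
qed

end
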